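(* Let $E\subset[1,2]$ be nonempty with upper Minkowski dimension $\beta$, and let $\mu$ be a compactly supported finite measure on $\mathbb{R}^{2d}$ such that $\hat\mu$ is $a$-admissible with $2a>d+\beta$. If $a\le d+\beta/2$, then $$\mathcal{A}_{\hat\mu,E}:L^p\times L^q\to L^r$$ is bounded for $\frac{2d}{2a-\beta}<p,q\le2$ with $\frac1p+\frac1q<\frac12+\frac{2a-\beta}{2d}$ and any $r$ with $2\ge r\ge r_H(p,q)$, where $r_H=r_H(p,q)$ is given by the Hölder relation $1/r_H=1/p+1/q$. Moreover, if $a>d+\beta/2$, the same conclusion holds with the hypotheses on $p,q$ replaced by $1<p,q\le2$ and $1/p+1/q<3/2$.
   Context: Here $d\ge1$ and $\hat\mu(\xi,\eta)=\int e^{-2\pi i(y\cdot\xi+z\cdot\eta)}\,d\mu(y,z)$. The function $\hat\mu$ is $a$-admissible if $a>\frac d2$ and $|\hat\mu(\xi,\eta)|\lesssim(1+|\xi|+|\eta|)^{-a}$ for all $\xi,\eta\in\mathbb{R}^d$. The single-scale maximal operator, initially defined for $f,g\in C_0^\infty(\mathbb{R}^d)$, is $$\mathcal{A}_{\hat\mu,E}(f,g)(x)=\sup_{t\in E}\left|\int f(x-ty)g(x-tz)\,d\mu(y,z)\right|.$$ Boundedness means $\|\mathcal{A}_{\hat\mu,E}(f,g)\|_{L^r}\le C\|f\|_{L^p}\|g\|_{L^q}$ with $C$ independent of $f,g$. Upper Minkowski dimension: $\dim_M(E)=\limsup_{\delta\to0}\frac{\log N(E,\delta)}{\log(1/\delta)}$,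 where $N(E,\delta)$ is the minimal number of closed intervals of length $\delta$ needed to cover $E$. *)

theory Defs
  imports "HOL-Analysis.Analysis"
begin

text \<open>
  The dimension $d$ is \<open>CARD('n)\<close>, and $R^{2d}$ is the product
  \<open>(real ^ 'n) \<times> (real ^ 'n)\<close>, whose points are the pairs $(y,z)$.
\<close>

definition compactly_supported_measure :: "'a::topological_space measure \<Rightarrow> bool" where
  "compactly_supported_measure \<mu> \<longleftrightarrow> (\<exists>K. compact K \<and> emeasure \<mu> (- K) = 0)"

definition fourier_measure ::
    "((real ^ 'n) \<times> (real ^ 'n)) measure \<Rightarrow> real ^ 'n \<Rightarrow> real ^ 'n \<Rightarrow> complex" where
  "fourier_measure \<mu> \<xi> \<eta> =
     (LINT (y, z)|\<mu>. exp (- 2 * of_real pi * \<i> * of_real (y \<bullet> \<xi> + z \<bullet> \<eta>)))"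

definition admissible :: "real \<Rightarrow> (real ^ 'n \<Rightarrow> real ^ 'n \<Rightarrow> complex) \<Rightarrow> bool" where
  "admissible a m \<longleftrightarrow> a > real CARD('n) / 2 \<and>
     (\<exists>C. \<forall>\<xi> \<eta>. cmod (m \<xi> \<eta>) \<le> C * (1 + norm \<xi> + norm \<eta>) powr (- a))"

text \<open>Each closed interval of length \<open>\<delta>\<close> is represented by its left endpoint.\<close>

definition covering_number :: "real set \<Rightarrow> real \<Rightarrow> nat" where
  "covering_number E \<delta> =
     (LEAST n. \<exists>S. finite S \<and> card S = n \<and> E \<subseteq> (\<Union>c\<in>S. {c..c + \<delta>}))"

definition upper_minkowski_dim :: "real set \<Rightarrow> ereal" where
  "upper_minkowski_dim E =
     Limsup (at_right 0) (\<lambda>\<delta>. ereal (ln (real (covering_number E \<delta>)) / ln (1 / \<delta>)))"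

fun k_times_cont_diff :: "nat \<Rightarrow> ('a::euclidean_space \<Rightarrow> 'b::real_normed_vector) \<Rightarrow> bool" where
  "k_times_cont_diff 0 f \<longleftrightarrow> continuous_on UNIV f"
| "k_times_cont_diff (Suc k) f \<longleftrightarrow> (\<forall>x. f differentiable (at x)) \<and>
     (\<forall>v. k_times_cont_diff k (\<lambda>x. frechet_derivative f (at x) v))"

definition test_functions :: "('a::euclidean_space \<Rightarrow> complex) set" where
  "test_functions = {f. (\<forall>k. k_times_cont_diff k f) \<and> compact (closure {x. f x \<noteq> 0})}"

text \<open>
  For test functions \<open>f\<close>, \<open>g\<close> and a finite measure \<open>\<mu>\<close> the integrals below are bounded
  uniformly in \<open>t\<close> and \<open>x\<close>, so for nonempty \<open>E\<close> the real supremum is the genuine one.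
\<close>

definition bilinear_maximal ::
    "((real ^ 'n) \<times> (real ^ 'n)) measure \<Rightarrow> real set \<Rightarrow>
     (real ^ 'n \<Rightarrow> complex) \<Rightarrow> (real ^ 'n \<Rightarrow> complex) \<Rightarrow> real ^ 'n \<Rightarrow> real" where
  "bilinear_maximal \<mu> E f g x =
     (SUP t\<in>E. cmod (LINT (y, z)|\<mu>. f (x - t *\<^sub>R y) * g (x - t *\<^sub>R z)))"

text \<open>
  The $L^p$ (quasi-)norm for real \<open>p > 0\<close>; values \<open>p < 1\<close> do occur as target exponents.
  It is \<open>\<infinity>\<close> when the integral diverges, hence an inequality with finite right-hand
  side includes membership in $L^p$.
\<close>

definition Lp_norm :: "real \<Rightarrow> ('a::euclidean_space \<Rightarrow> 'b::real_normed_vector) \<Rightarrow> ennreal" where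
  "Lp_norm p f =
     (let I = (\<integral>\<^sup>+ x. ennreal (norm (f x) powr p) \<partial>lborel)
      in if I = \<infinity> then \<infinity> else ennreal (enn2real I powr (1 / p)))"

definition bilinear_maximal_bounded ::
    "((real ^ 'n) \<times> (real ^ 'n)) measure \<Rightarrow> real set \<Rightarrow> real \<Rightarrow> real \<Rightarrow> real \<Rightarrow> bool" where
  "bilinear_maximal_bounded \<mu> E p q r \<longleftrightarrow>
     (\<exists>C\<ge>0. \<forall>f\<in>test_functions. \<forall>g\<in>test_functions.
        Lp_norm r (bilinear_maximal \<mu> E f g) \<le> ennreal C * Lp_norm p f * Lp_norm q g)"

definition hoelder_exponent :: "real \<Rightarrow> real \<Rightarrow> real" where
  "hoelder_exponent p q = 1 / (1 / p + 1 / q)"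

end

theory Submission
  imports Defs
begin

text \<open>
  On a large cube, test functions are uniform limits of trigonometric polynomials of period
  \<open>L\<close>, so by translation and cut-off it suffices to bound the maximal function of two such
  polynomials in $L^2$ of the cube.  Split the frequency pairs \<open>(k, l)\<close> into dyadic shells of
  size $2^j$.  For fixed \<open>t\<close>, Parseval and Cauchy--Schwarz together with the decay of the
  multiplier give the gain $2^{-j(a-d/2)}$ on $L^2\times L^2$.  Since the multiplier is
  band-limited in \<open>t\<close>, Newton interpolation recovers it on an interval of length
  $2^{-j(1+\epsilon)}$ from finitely many values of \<open>t\<close>, up to an error smaller than any prescribed
  power of $2^{-j}$; as \<open>E\<close> is covered by about $2^{j(1+\epsilon)(\beta+\epsilon)}$ such intervals,
  the supremum costs $2^{j(\beta/2+O(\epsilon))}$.  Bernstein's inequality replaces the $L^2$ norms by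
  $L^p$ and $L^q$ norms at the cost $2^{jd(1/p+1/q-1)}$, and the hypothesis on \<open>p\<close>, \<open>q\<close> says exactly
  that the resulting series over \<open>j\<close> converges.  Averaging the local estimate over all translates
  and using $r/p+r/q\ge1$ yields the global one for every $r_H\le r\le2$.
\<close>

section \<open>Trigonometric sums on the torus\<close>

text \<open>Working with finite sums of waves keeps every frequency argument exact, but each
  constant must then be independent of the degree: this is why the estimates fix their constants
  before a frequency cube \<open>int_cube (2 ^ J)\<close> is named. The period can be fixed once,
  because an average at x sees the functions only within distance 2R of x, where R bounds both
  components of the support of \<mu>. Intervals of length 2^(-j) would be too long for the
  interpolation: there the multiplier turns by an angle of order one and differences gain nothing.
  The extra factor 2^(-\<epsilon> j) is gained anew with every further difference, and the order K
  is chosen so large that even a crude treatment of the remainder does no harm. Sharp truncation to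
  a frequency cube is harmless near p = 1, because Bernstein's inequality is used to bound square
  sums of coefficients and never the L^p norm of a truncation. The condition p, q \<le> 2 enters
  there, while r \<le> 2 is what allows passing from L^2 to L^r on a unit cube.\<close>

definition real_vec :: "int ^ 'n \<Rightarrow> real ^ 'n" where
  "real_vec k = (\<chi> i. real_of_int (k $ i))"

definition wave :: "real \<Rightarrow> int ^ 'n \<Rightarrow> real ^ 'n \<Rightarrow> complex" where
  "wave L k x = cis (2 * pi / L * (real_vec k \<bullet> x))"

text \<open>The closed cube with plain Lebesgue measure, neither a quotient space nor normalised:
  orthogonality of the waves therefore carries the factor \<open>L ^ CARD('n)\<close>, and functions
  that are not periodic can be integrated as well.\<close>

definition torus :: "real \<Rightarrow> (real ^ 'n) measure" where
  "torus L = restrict_space lborel (cbox (\<chi> i. - L / 2) (\<chi> i. L / 2))"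

lemma real_vec_add: "real_vec (k + l) = real_vec k + real_vec l"
  by (simp add: real_vec_def vec_eq_iff)

lemma real_vec_diff: "real_vec (k - l) = real_vec k - real_vec l"
  by (simp add: real_vec_def vec_eq_iff)

lemma real_vec_0 [simp]: "real_vec 0 = 0"
  by (simp add: real_vec_def vec_eq_iff)

lemma wave_0 [simp]: "wave L 0 x = 1"
  by (simp add: wave_def)

lemma wave_add: "wave L (k + l) x = wave L k x * wave L l x"
  by (simp add: wave_def real_vec_add inner_add_left cis_mult distrib_left)

lemma wave_mult_cnj: "wave L k x * cnj (wave L l x) = wave L (k - l) x"
  by (simp add: wave_def real_vec_diff inner_diff_left cis_mult cis_cnj right_diff_distrib)

lemma wave_diff: "wave L k (x - y) = wave L k x * cis (- (2 * pi / L * (real_vec k \<bullet> y)))"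
  by (simp add: wave_def inner_diff_right cis_mult right_diff_distrib)

lemma norm_wave [simp]: "cmod (wave L k x) = 1"
  by (simp add: wave_def)

lemma continuous_on_wave: "continuous_on S (wave L k)"
  unfolding wave_def cis_conv_exp by (intro continuous_intros)

lemma measurable_torus [measurable]: "f \<in> borel_measurable borel \<Longrightarrow> f \<in> borel_measurable (torus L)"
  by (simp add: torus_def measurable_restrict_space1)

lemma space_torus: "space (torus L) = cbox (\<chi> i. - L / 2) (\<chi> i. L / 2)"
  by (simp add: torus_def space_restrict_space)

lemma finite_measure_torus: "finite_measure (torus L)"
  by (rule finite_measureI)
     (simp add: torus_def space_restrict_space emeasure_restrict_space emeasure_lborel_cbox_eq)

lemma integrable_torus_bounded:
  fixes f :: "real ^ 'n \<Rightarrow> 'b::{banach, second_countable_topology}"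
  assumes "f \<in> borel_measurable borel" "\<And>x. x \<in> space (torus L) \<Longrightarrow> norm (f x) \<le> B"
  shows "integrable (torus L) f"
proof -
  interpret finite_measure "torus L :: (real ^ 'n) measure" by (rule finite_measure_torus)
  show ?thesis
    by (rule integrable_const_bound[OF AE_I2[OF assms(2)] measurable_torus[OF assms(1)]])
qed

lemma cis_sum: "finite A \<Longrightarrow> cis (\<Sum>x\<in>A. f x) = (\<Prod>x\<in>A. cis (f x))"
  by (induction A rule: finite_induct) (auto simp: cis_mult[symmetric])

lemma integral_cis_period:
  assumes L: "L > 0"
  shows "(LINT s|lborel. indicat_real {- L / 2..L / 2} s *\<^sub>R cis (2 * pi / L * real_of_int m * s))
    = (if m = 0 then of_real L else 0)"
proof (cases "m = 0")
  case True
  then show ?thesis using L by (simp add: scaleR_conv_of_real)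
next
  case False
  define w where "w = 2 * pi / L * real_of_int m"
  have w: "w \<noteq> 0" using False L by (simp add: w_def)
  define F where "F = (\<lambda>s::real. cis (w * s) / (\<i> * of_real w))"
  have "(LINT s|lborel. indicat_real {- L / 2..L / 2} s *\<^sub>R cis (w * s)) = F (L / 2) - F (- L / 2)"
  proof (rule integral_FTC_Icc)
    show "(F has_vector_derivative cis (w * s)) (at s within {- L / 2..L / 2})" for s
    proof -
      have "((\<lambda>s. exp (\<i> * of_real w * s) / (\<i> * of_real w)) has_field_derivative
        exp (\<i> * of_real w * of_real s)) (at (of_real s))"
        using w by (auto intro!: derivative_eq_intros)
      from has_vector_derivative_real_field[OF this]
      show ?thesis by (simp add: F_def cis_conv_exp mult_ac o_def)
    qed
    show "continuous_on {- L / 2..L / 2} (\<lambda>s. cis (w * s))"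
      unfolding cis_conv_exp by (intro continuous_intros)
  qed (use L in simp)
  also have "cis (w * (L / 2)) = cis (w * (- L / 2))"
  proof -
    have "w * (L / 2) = w * (- L / 2) + 2 * pi * of_int m"
      using L by (simp add: w_def field_simps)
    then have "cis (w * (L / 2)) = cis (w * (- L / 2)) * cis (2 * pi * of_int m)"
      by (simp only: cis_mult)
    also have "cis (2 * pi * of_int m) = 1" by (rule cis_multiple_2pi) simp
    finally show ?thesis by simp
  qed
  then have "F (L / 2) - F (- L / 2) = 0" by (simp add: F_def)
  finally show ?thesis using False by (simp add: w_def)
qed

text \<open>Lebesgue measure is the image of a product measure indexed by the basis, and both the
  indicator of the cube and the wave factor over the coordinates; the product vanishes as soon as
  one \<open>k $ i\<close> is nonzero.\<close>

lemma integral_wave: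
  fixes k :: "int ^ 'n"
  assumes L: "L > 0"
  shows "(LINT x|torus L. wave L k x) = (if k = 0 then of_real L ^ CARD('n) else 0)"
proof -
  interpret product_sigma_finite "\<lambda>b :: real ^ 'n. lborel :: real measure" ..
  let ?f = "\<lambda>(b :: real ^ 'n) s. indicat_real {- L / 2..L / 2} s *\<^sub>R cis (2 * pi / L * (real_vec k \<bullet> b) * s)"
  have int: "integrable lborel (?f b)" for b
    by (rule borel_integrable_compact) (use L in \<open>auto simp: cis_conv_exp intro!: continuous_intros\<close>)
  have "(LINT x|torus L. wave L k x) =
      (LINT x|lborel. indicat_real (cbox (\<chi> i. - L / 2) (\<chi> i. L / 2)) x *\<^sub>R wave L k x)"
    unfolding torus_def by (subst integral_restrict_space) (auto simp: set_lebesgue_integral_def)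
  also have "\<dots> = (LINT x|lborel. (\<Prod>b\<in>Basis. ?f b (x \<bullet> b)))"
  proof (rule Bochner_Integration.integral_cong[OF refl])
    fix x :: "real ^ 'n"
    have box: "x \<in> cbox (\<chi> i. - L / 2) (\<chi> i. L / 2) \<longleftrightarrow> (\<forall>b\<in>Basis. x \<bullet> b \<in> {- L / 2..L / 2})"
      by (simp add: mem_box Basis_vec_def inner_axis)
    have ind: "indicat_real (cbox (\<chi> i. - L / 2) (\<chi> i. L / 2)) x
        = (\<Prod>b\<in>Basis. indicat_real {- L / 2..L / 2} (x \<bullet> b))"
    proof (cases "x \<in> cbox (\<chi> i. - L / 2) (\<chi> i. L / 2)")
      case True
      then show ?thesis using box by simp
    next
      case False
      then obtain b where "b \<in> Basis" "indicat_real {- L / 2..L / 2} (x \<bullet> b) = 0"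
        using box by (auto simp: indicator_def)
      then show ?thesis using False by (auto intro!: prod_zero[symmetric])
    qed
    have sm: "real_vec k \<bullet> x = (\<Sum>b\<in>Basis. (real_vec k \<bullet> b) * (x \<bullet> b))"
      by (rule euclidean_inner)
    have "wave L k x = cis (\<Sum>b\<in>Basis. 2 * pi / L * (real_vec k \<bullet> b) * (x \<bullet> b))"
      unfolding wave_def sm sum_distrib_left by (simp only: mult.assoc)
    also have "\<dots> = (\<Prod>b\<in>Basis. cis (2 * pi / L * (real_vec k \<bullet> b) * (x \<bullet> b)))"
      by (rule cis_sum) (rule finite_Basis)
    finally have wp: "wave L k x = (\<Prod>b\<in>Basis. cis (2 * pi / L * (real_vec k \<bullet> b) * (x \<bullet> b)))" .
    show "indicat_real (cbox (\<chi> i. - L / 2) (\<chi> i. L / 2)) x *\<^sub>R wave L k x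
      = (\<Prod>b\<in>Basis. ?f b (x \<bullet> b))"
      unfolding ind wp scaleR_conv_of_real of_real_prod prod.distrib ..
  qed
  also have "\<dots> = (LINT y|(\<Pi>\<^sub>M b\<in>Basis. lborel). (\<Prod>b\<in>Basis. ?f b ((\<Sum>c\<in>Basis. y c *\<^sub>R c) \<bullet> b)))"
    by (subst lborel_eq, subst integral_distr) (auto simp: cis_conv_exp)
  also have "\<dots> = (LINT y|(\<Pi>\<^sub>M b\<in>Basis. lborel). (\<Prod>b\<in>Basis. ?f b (y b)))"
    by (intro Bochner_Integration.integral_cong prod.cong refl) (simp add: inner_sum_left inner_Basis if_distrib sum.delta cong: if_cong)
  also have "\<dots> = (\<Prod>b\<in>Basis. LINT s|lborel. ?f b s)"
    by (rule product_integral_prod) (use int in auto)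
  also have "\<dots> = (\<Prod>i\<in>(UNIV::'n set). LINT s|lborel. ?f (axis i 1) s)"
    by (subst Basis_vec_def) (simp add: prod.UNION_disjoint UNION_singleton_eq_range prod.reindex inj_on_def axis_eq_axis)
  also have "\<dots> = (\<Prod>i\<in>(UNIV::'n set). if k $ i = 0 then of_real L else 0)"
    using integral_cis_period[OF L] by (intro prod.cong refl) (simp add: real_vec_def inner_axis)
  also have "\<dots> = (if k = 0 then of_real L ^ CARD('n) else 0)"
    by (auto simp: vec_eq_iff)
  finally show ?thesis .
qed

lemma integrable_torus_continuous:
  fixes f :: "real ^ 'n \<Rightarrow> 'b::{banach, second_countable_topology}"
  assumes "continuous_on UNIV f"
  shows "integrable (torus L) f"
proof -
  have "compact (f ` cbox (\<chi> i. - L / 2) (\<chi> i. L / 2))"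
    by (intro compact_continuous_image continuous_on_subset[OF assms]) auto
  then obtain B where "\<forall>y\<in>f ` cbox (\<chi> i. - L / 2) (\<chi> i. L / 2). norm y \<le> B"
    using compact_imp_bounded bounded_iff by metis
  then show ?thesis
    by (intro integrable_torus_bounded[where B=B] borel_measurable_continuous_onI assms)
       (auto simp: space_torus)
qed

definition trig_sum :: "real \<Rightarrow> (int ^ 'n) set \<Rightarrow> (int ^ 'n \<Rightarrow> complex) \<Rightarrow> real ^ 'n \<Rightarrow> complex" where
  "trig_sum L F a x = (\<Sum>k\<in>F. a k * wave L k x)"

lemma continuous_on_trig_sum: "continuous_on S (trig_sum L F a)"
  unfolding trig_sum_def by (intro continuous_intros continuous_on_wave)

text \<open>The nesting of the two frequency sets is what Bernstein's inequality needs: there a full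
  sum is paired with its own truncation, and the frequencies outside \<open>G\<close> integrate to
  zero.\<close>

lemma integral_trig_sum_cnj:
  fixes F G :: "(int ^ 'n) set"
  assumes L: "L > 0" and F: "finite F" and G: "G \<subseteq> F"
  shows "(LINT x|torus L. trig_sum L F a x * cnj (trig_sum L G b x))
    = of_real L ^ CARD('n) * (\<Sum>k\<in>G. a k * cnj (b k))"
proof -
  have fG: "finite G" using F G finite_subset by blast
  have "(LINT x|torus L. trig_sum L F a x * cnj (trig_sum L G b x))
      = (LINT x|torus L. (\<Sum>k\<in>F. \<Sum>l\<in>G. (a k * cnj (b l)) * wave L (k - l) x))"
    unfolding trig_sum_def
    by (simp add: sum_product wave_mult_cnj[symmetric] mult_ac)
  also have "\<dots> = (\<Sum>k\<in>F. \<Sum>l\<in>G. (a k * cnj (b l)) * (LINT x|torus L. wave L (k - l) x))"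
    by (subst Bochner_Integration.integral_sum
       | (intro Bochner_Integration.integrable_sum integrable_torus_continuous continuous_intros continuous_on_wave; fail)
       | rule sum.cong refl | simp)+
  also have "\<dots> = (\<Sum>k\<in>F. \<Sum>l\<in>G. if k = l then of_real L ^ CARD('n) * (a k * cnj (b l)) else 0)"
    by (intro sum.cong refl) (simp add: integral_wave[OF L])
  also have "\<dots> = (\<Sum>l\<in>G. \<Sum>k\<in>F. if k = l then of_real L ^ CARD('n) * (a k * cnj (b l)) else 0)"
    by (rule sum.swap)
  also have "\<dots> = (\<Sum>l\<in>G. of_real L ^ CARD('n) * (a l * cnj (b l)))"
    using F G by (intro sum.cong refl) (auto simp: sum.delta)
  finally show ?thesis by (simp add: sum_distrib_left)
qed

lemma parseval_trig_sum:
  fixes F :: "(int ^ 'n) set"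
  assumes L: "L > 0" and F: "finite F"
  shows "(LINT x|torus L. (cmod (trig_sum L F a x))\<^sup>2) = L ^ CARD('n) * (\<Sum>k\<in>F. (cmod (a k))\<^sup>2)"
proof -
  have "complex_of_real (LINT x|torus L. (cmod (trig_sum L F a x))\<^sup>2)
     = (LINT x|torus L. complex_of_real ((cmod (trig_sum L F a x))\<^sup>2))"
    by (rule integral_complex_of_real[symmetric])
  also have "\<dots> = (LINT x|torus L. trig_sum L F a x * cnj (trig_sum L F a x))"
    by (simp add: complex_norm_square del: of_real_power)
  also have "\<dots> = of_real L ^ CARD('n) * (\<Sum>k\<in>F. a k * cnj (a k))"
    by (rule integral_trig_sum_cnj[OF L F order_refl])
  also have "\<dots> = of_real (L ^ CARD('n) * (\<Sum>k\<in>F. (cmod (a k))\<^sup>2))"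
    by (simp add: complex_norm_square del: of_real_power) simp
  finally show ?thesis by (simp only: of_real_eq_iff)
qed

section \<open>Cubes of integer frequencies\<close>

definition int_cube :: "nat \<Rightarrow> (int ^ 'n) set" where
  "int_cube N = {k. \<forall>i. \<bar>k $ i\<bar> \<le> int N}"

lemma int_cube_eq: "int_cube N = (\<lambda>h. \<chi> i. h i) ` (\<Pi>\<^sub>E i\<in>(UNIV::'n::finite set). {- int N..int N})"
proof -
  have iff: "\<bar>z\<bar> \<le> int N \<longleftrightarrow> z \<in> {- int N..int N}" for z
    by auto
  have "k \<in> (\<lambda>h. \<chi> i. h i) ` (\<Pi>\<^sub>E i\<in>UNIV. {- int N..int N})"
    if "\<forall>i. \<bar>k $ i\<bar> \<le> int N" for k :: "int ^ 'n"
    using that by (intro image_eqI[where x="\<lambda>i. k $ i"]) (auto simp: iff simp del: atLeastAtMost_iff)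
  then show ?thesis by (auto simp: int_cube_def PiE_iff iff simp del: atLeastAtMost_iff)
qed

lemma finite_int_cube [simp]: "finite (int_cube N :: (int ^ 'n) set)"
  unfolding int_cube_eq by (intro finite_imageI finite_PiE) auto

lemma card_int_cube: "card (int_cube N :: (int ^ 'n) set) = (2 * N + 1) ^ CARD('n)"
proof -
  have "inj_on (\<lambda>h :: 'n \<Rightarrow> int. \<chi> i. h i) S" for S
    by (auto simp: inj_on_def vec_eq_iff)
  then show ?thesis
    unfolding int_cube_eq by (simp add: card_image card_PiE nat_add_distrib nat_mult_distrib)
qed

lemma int_cube_mono: "M \<le> N \<Longrightarrow> int_cube M \<subseteq> int_cube N"
  unfolding int_cube_def by (auto intro: order_trans)

lemma finite_subset_int_cube:
  fixes F :: "(int ^ 'n) set"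
  assumes "finite F"
  shows "\<exists>N. \<forall>M\<ge>N. F \<subseteq> int_cube M"
proof -
  define N where "N = (\<Sum>k\<in>F. \<Sum>i\<in>UNIV. nat \<bar>k $ i\<bar>)"
  have "\<bar>k $ i\<bar> \<le> int M" if "k \<in> F" "M \<ge> N" for k i M
  proof -
    have "nat \<bar>k $ i\<bar> \<le> (\<Sum>i\<in>UNIV. nat \<bar>k $ i\<bar>)"
      by (rule member_le_sum) auto
    also have "\<dots> \<le> N"
      unfolding N_def using assms that by (intro member_le_sum) auto
    finally show ?thesis using that by linarith
  qed
  then show ?thesis by (auto simp: int_cube_def intro!: exI[of _ N])
qed

section \<open>Bernstein, bilinear and interpolation estimates\<close>

text \<open>Stands in for Hoelder's inequality in the proof of Bernstein's inequality: the term
  \<open>h\<^sup>2 / 2\<close> is absorbed by Parseval.\<close>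

lemma mult_le_half_square_plus_powr:
  fixes u h M p :: real
  assumes "0 \<le> u" "0 \<le> h" "h \<le> M" "0 < M" "1 \<le> p" "p \<le> 2"
  shows "u * h \<le> h\<^sup>2 / 2 + 3 / 2 * (M powr (2 - p) * u powr p)"
proof -
  define s where "s = u / M"
  have s: "s \<ge> 0" "u = M * s" using assms by (auto simp: s_def)
  have eq: "M powr (2 - p) * u powr p = M\<^sup>2 * s powr p"
  proof -
    have "M powr (2 - p) * u powr p = (M powr (2 - p) * M powr p) * s powr p"
      using assms s by (simp add: powr_mult)
    also have "M powr (2 - p) * M powr p = M\<^sup>2"
      using assms by (simp add: powr_add[symmetric])
    finally show ?thesis .
  qed
  have nn: "0 \<le> M\<^sup>2 * s powr p" by simp
  show ?thesis
  proof (cases "s \<ge> 1")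
    case True
    then have "s \<le> s powr p" using powr_mono[of 1 p s] assms by simp
    then have "M\<^sup>2 * s \<le> M\<^sup>2 * s powr p" by (intro mult_left_mono) auto
    moreover have "u * h \<le> M\<^sup>2 * s"
      using mult_left_mono[of h M u] assms s by (simp add: power2_eq_square mult_ac)
    ultimately show ?thesis using eq nn zero_le_power2[of h] by linarith
  next
    case False
    have "s\<^sup>2 \<le> s powr p"
    proof (cases "s = 0")
      case False
      then have "s powr 2 \<le> s powr p" using \<open>\<not> 1 \<le> s\<close> s assms by (intro powr_mono') auto
      then show ?thesis using s False by (simp add: powr_numeral)
    qed auto
    then have "M\<^sup>2 * s\<^sup>2 \<le> M\<^sup>2 * s powr p" by (intro mult_left_mono) auto
    moreover have "u * h \<le> h\<^sup>2 / 2 + u\<^sup>2 / 2"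
      using sum_squares_bound[of u h] by (simp add: field_simps)
    moreover have "u\<^sup>2 = M\<^sup>2 * s\<^sup>2" by (simp add: s(2) power_mult_distrib)
    ultimately show ?thesis using eq nn by linarith
  qed
qed

text \<open>Duality without dual norms: pairing the sum \<open>?P\<close> with its truncation
  \<open>?H\<close> produces \<open>V * D\<close>. The uniform bound for \<open>?H\<close> itself
  contains \<open>D\<close>, but it enters with a power below one, so the inequality can be solved
  for \<open>D\<close>.\<close>

lemma bernstein_trig_sum:
  fixes F B :: "(int ^ 'n) set"
  assumes L: "L > 0" and p: "1 \<le> p" "p \<le> 2" and F: "finite F" and B: "B \<subseteq> F"
  shows "(\<Sum>k\<in>B. (cmod (a k))\<^sup>2) \<le>
    (3 / L ^ CARD('n) * (LINT x|torus L. cmod (trig_sum L F a x) powr p)) powr (2 / p)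
      * real (card B) powr (2 / p - 1)"
proof -
  define D where "D = (\<Sum>k\<in>B. (cmod (a k))\<^sup>2)"
  define V where "V = L ^ CARD('n)"
  define I where "I = (LINT x|torus L. cmod (trig_sum L F a x) powr p)"
  let ?P = "trig_sum L F a" and ?H = "trig_sum L B a"
  have fB: "finite B" using F B finite_subset by blast
  have V: "V > 0" using L by (simp add: V_def)
  have D0: "D \<ge> 0" unfolding D_def by (simp add: sum_nonneg)
  have I0: "I \<ge> 0" unfolding I_def by (intro Bochner_Integration.integral_nonneg) simp
  show ?thesis
  proof (cases "D = 0")
    case True
    then show ?thesis unfolding D_def[symmetric] using I0 V by simp
  next
    case False
    then have D: "D > 0" using D0 by simp
    then have "B \<noteq> {}" by (auto simp: D_def)
    then have c: "real (card B) > 0" using fB by (simp add: card_gt_0_iff)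
    \<comment> \<open>\<open>M\<close> bounds \<open>?H\<close> uniformly: the l^1 norm of the
      coefficients against their l^2 norm.\<close>
    define M where "M = sqrt (real (card B) * D)"
    have M: "M > 0" using c D by (simp add: M_def)
    have HM: "cmod (?H x) \<le> M" for x
    proof -
      have "cmod (?H x) \<le> (\<Sum>k\<in>B. cmod (a k))"
        unfolding trig_sum_def by (rule order_trans[OF norm_sum]) (simp add: norm_mult)
      also have "\<dots> \<le> M"
        unfolding M_def D_def using sum_squared_le_sum_of_squares[of "\<lambda>k. cmod (a k)" B]
        by (intro real_le_rsqrt) (simp add: mult.commute)
      finally show ?thesis .
    qed
    have ptw: "cmod (?P x * cnj (?H x)) \<le> (cmod (?H x))\<^sup>2 / 2 + 3 / 2 * (M powr (2 - p) * cmod (?P x) powr p)" for x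
      unfolding norm_mult complex_mod_cnj
      using mult_le_half_square_plus_powr[OF norm_ge_zero norm_ge_zero HM M p] by blast
    have int1: "integrable (torus L) (\<lambda>x. ?P x * cnj (?H x))"
      by (intro integrable_torus_continuous continuous_intros continuous_on_trig_sum)
    have int2: "integrable (torus L) (\<lambda>x. (cmod (?H x))\<^sup>2)"
      by (intro integrable_torus_continuous continuous_intros continuous_on_trig_sum)
    have int3: "integrable (torus L) (\<lambda>x. cmod (?P x) powr p)"
      using p by (intro integrable_torus_continuous continuous_on_powr' continuous_intros continuous_on_trig_sum) auto
    have "complex_of_real (V * D) = (LINT x|torus L. ?P x * cnj (?H x))"
      unfolding integral_trig_sum_cnj[OF L F B] V_def D_def
      by (simp add: complex_norm_square del: of_real_power) simp
    then have "V * D = cmod (LINT x|torus L. ?P x * cnj (?H x))"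
      using V D by (metis norm_of_real abs_of_pos mult_pos_pos)
    also have "\<dots> \<le> (LINT x|torus L. cmod (?P x * cnj (?H x)))"
      by simp
    also have "\<dots> \<le> (LINT x|torus L. (cmod (?H x))\<^sup>2 / 2 + 3 / 2 * (M powr (2 - p) * cmod (?P x) powr p))"
      using int1 int2 int3 ptw by (intro integral_mono) auto
    also have "\<dots> = (LINT x|torus L. (cmod (?H x))\<^sup>2) / 2 + 3 / 2 * (M powr (2 - p) * I)"
      using int2 int3 by (simp add: I_def)
    also have "(LINT x|torus L. (cmod (?H x))\<^sup>2) = V * D"
      unfolding parseval_trig_sum[OF L fB] V_def D_def ..
    \<comment> \<open>Half of \<open>V * D\<close>, coming from Parseval for \<open>?H\<close>, is
      absorbed on the left; this is the origin of the 3.\<close>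
    finally have *: "V * D \<le> 3 * (M powr (2 - p) * I)" by simp
    have Mp: "M powr (2 - p) = real (card B) powr (1 - p / 2) * D powr (1 - p / 2)"
      using c D by (simp add: M_def powr_half_sqrt[symmetric] powr_powr powr_mult diff_divide_distrib)
    \<comment> \<open>Cancels the power of \<open>D\<close> contained in
      \<open>M powr (2 - p)\<close>.\<close>
    have "D powr (p / 2) * D powr (1 - p / 2) = D" using D by (simp add: powr_add[symmetric])
    then have "D powr (p / 2) * D powr (1 - p / 2) \<le>
        (3 / V * I * real (card B) powr (1 - p / 2)) * D powr (1 - p / 2)"
      using * V by (simp add: Mp field_simps)
    then have "D powr (p / 2) \<le> 3 / V * I * real (card B) powr (1 - p / 2)"
      by (rule mult_right_le_imp_le) (use D in simp)
    then have "(D powr (p / 2)) powr (2 / p) \<le> (3 / V * I * real (card B) powr (1 - p / 2)) powr (2 / p)"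
      using p by (intro powr_mono2) auto
    moreover have "(D powr (p / 2)) powr (2 / p) = D" using D p by (simp add: powr_powr)
    moreover have "(3 / V * I * real (card B) powr (1 - p / 2)) powr (2 / p)
        = (3 / V * I) powr (2 / p) * real (card B) powr (2 / p - 1)"
    proof -
      have "(1 - p / 2) * (2 / p) = 2 / p - 1" using p by (simp add: field_simps)
      then show ?thesis using V I0 by (subst powr_mult) (auto simp: powr_powr)
    qed
    ultimately show ?thesis unfolding D_def V_def I_def by simp
  qed
qed

text \<open>Pairs are grouped by the output frequency k + l. Inside a group k determines l, so a
  group has at most \<open>card B\<close> members and Cauchy--Schwarz costs only that factor instead
  of the number of all pairs.\<close>

lemma integral_bilinear_sum_le:
  fixes B :: "(int ^ 'n) set"
  assumes L: "L > 0" and B: "finite B" and S: "S \<subseteq> B \<times> B" and W: "W \<ge> 0"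
    and c: "\<And>k l. (k, l) \<in> S \<Longrightarrow> cmod (c k l) \<le> W * (cmod (a k) * cmod (b l))"
  shows "(LINT x|torus L. (cmod (\<Sum>(k, l)\<in>S. c k l * wave L (k + l) x))\<^sup>2) \<le>
    L ^ CARD('n) * (W\<^sup>2 * real (card B) * (\<Sum>k\<in>B. (cmod (a k))\<^sup>2) * (\<Sum>l\<in>B. (cmod (b l))\<^sup>2))"
proof -
  define T where "T = (\<lambda>(k, l). k + l) ` S"
  define h where "h = (\<lambda>n. \<Sum>z\<in>{z\<in>S. (\<lambda>(k, l). k + l) z = n}. (\<lambda>(k, l). c k l) z)"
  have fS: "finite S" using B S finite_subset by blast
  then have fT: "finite T" by (simp add: T_def)
  have eq: "(\<Sum>(k, l)\<in>S. c k l * wave L (k + l) x) = trig_sum L T h x" for x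
  proof -
    have "trig_sum L T h x = (\<Sum>n\<in>T. \<Sum>z\<in>{z\<in>S. (\<lambda>(k, l). k + l) z = n}. (\<lambda>(k, l). c k l * wave L (k + l) x) z)"
      unfolding trig_sum_def h_def sum_distrib_right
      by (intro sum.cong refl) auto
    also have "\<dots> = (\<Sum>(k, l)\<in>S. c k l * wave L (k + l) x)"
      by (rule sum.group[OF fS fT]) (simp add: T_def)
    finally show ?thesis by simp
  qed
  have hn: "(cmod (h n))\<^sup>2 \<le> W\<^sup>2 * real (card B) *
      (\<Sum>z\<in>{z\<in>S. (\<lambda>(k, l). k + l) z = n}. (\<lambda>(k, l). (cmod (a k))\<^sup>2 * (cmod (b l))\<^sup>2) z)" for n
  proof -
    let ?Sn = "{z\<in>S. (\<lambda>(k, l). k + l) z = n}"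
    have "inj_on fst ?Sn" by (auto simp: inj_on_def)
    moreover have "fst ` ?Sn \<subseteq> B" using S by auto
    ultimately have card: "card ?Sn \<le> card B" by (rule card_inj_on_le) (rule B)
    have "cmod (h n) \<le> (\<Sum>z\<in>?Sn. (\<lambda>(k, l). W * (cmod (a k) * cmod (b l))) z)"
      unfolding h_def by (rule order_trans[OF norm_sum sum_mono]) (use c in auto)
    then have "(cmod (h n))\<^sup>2 \<le> (\<Sum>z\<in>?Sn. (\<lambda>(k, l). W * (cmod (a k) * cmod (b l))) z)\<^sup>2"
      by (intro power_mono) auto
    also have "\<dots> \<le> (\<Sum>z\<in>?Sn. ((\<lambda>(k, l). W * (cmod (a k) * cmod (b l))) z)\<^sup>2) * real (card ?Sn)"
      by (rule sum_squared_le_sum_of_squares)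
    also have "\<dots> \<le> (\<Sum>z\<in>?Sn. ((\<lambda>(k, l). W * (cmod (a k) * cmod (b l))) z)\<^sup>2) * real (card B)"
      using card by (intro mult_left_mono sum_nonneg) auto
    also have "\<dots> = W\<^sup>2 * real (card B) * (\<Sum>z\<in>?Sn. (\<lambda>(k, l). (cmod (a k))\<^sup>2 * (cmod (b l))\<^sup>2) z)"
      by (simp add: sum_distrib_left sum_distrib_right case_prod_beta power_mult_distrib mult_ac)
    finally show ?thesis .
  qed
  have "(LINT x|torus L. (cmod (\<Sum>(k, l)\<in>S. c k l * wave L (k + l) x))\<^sup>2)
      = L ^ CARD('n) * (\<Sum>n\<in>T. (cmod (h n))\<^sup>2)"
    unfolding eq by (rule parseval_trig_sum[OF L fT])
  also have "\<dots> \<le> L ^ CARD('n) * (\<Sum>n\<in>T. W\<^sup>2 * real (card B) *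
      (\<Sum>z\<in>{z\<in>S. (\<lambda>(k, l). k + l) z = n}. (\<lambda>(k, l). (cmod (a k))\<^sup>2 * (cmod (b l))\<^sup>2) z))"
    using L by (intro mult_left_mono sum_mono hn) auto
  also have "\<dots> = L ^ CARD('n) * (W\<^sup>2 * real (card B) *
      (\<Sum>(k, l)\<in>S. (cmod (a k))\<^sup>2 * (cmod (b l))\<^sup>2))"
    unfolding sum_distrib_left[symmetric]
    by (subst sum.group[OF fS fT]) (simp_all add: T_def)
  also have "\<dots> \<le> L ^ CARD('n) * (W\<^sup>2 * real (card B) *
      (\<Sum>(k, l)\<in>B \<times> B. (cmod (a k))\<^sup>2 * (cmod (b l))\<^sup>2))"
    using L B S by (intro mult_left_mono sum_mono2) auto
  finally show ?thesis
    by (simp add: sum_product sum.cartesian_product mult.assoc)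
qed

text \<open>Passing from n to n + 1 multiplies the coefficient by (\<sigma> - n) / (n + 1), which
  has modulus at most one for 0 \<le> \<sigma> \<le> 1.\<close>

lemma norm_gbinomial_le_1:
  assumes "0 \<le> \<sigma>" "\<sigma> \<le> 1"
  shows "cmod (complex_of_real \<sigma> gchoose n) \<le> 1"
proof (induction n)
  case (Suc n)
  have "of_nat (Suc n) * (complex_of_real \<sigma> gchoose Suc n) = (complex_of_real \<sigma> gchoose n) * (of_real \<sigma> - of_nat n)"
    using gbinomial_mult_1'[of "complex_of_real \<sigma>" n] by (simp add: algebra_simps)
  then have "real (Suc n) * cmod (complex_of_real \<sigma> gchoose Suc n)
      = cmod (complex_of_real \<sigma> gchoose n) * cmod (of_real \<sigma> - of_nat n)"
    by (metis norm_mult norm_of_nat)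
  also have "cmod (of_real \<sigma> - of_nat n) = \<bar>\<sigma> - real n\<bar>"
    by (metis norm_of_real of_real_diff of_real_of_nat_eq)
  also have "cmod (complex_of_real \<sigma> gchoose n) * \<bar>\<sigma> - real n\<bar> \<le> 1 * real (Suc n)"
    using Suc assms by (intro mult_mono) auto
  finally show ?case by (simp add: mult_le_cancel_left_pos del: of_nat_Suc)
qed simp

lemma norm_cis_minus_1_le: "cmod (cis x - 1) \<le> \<bar>x\<bar>"
proof -
  have "cmod (cis x - 1) = 2 * \<bar>sin (x / 2)\<bar>" by (simp add: cis_conv_exp dist_exp_i_1)
  also have "\<dots> \<le> \<bar>x\<bar>" using abs_sin_x_le_abs_x[of "x / 2"] by simp
  finally show ?thesis .
qed

text \<open>Newton's forward difference formula is the binomial series of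
  \<open>(1 + (cis x - 1)) powr \<sigma>\<close>.\<close>

lemma newton_cis:
  assumes \<sigma>: "0 \<le> \<sigma>" "\<sigma> \<le> 1"
  shows "\<exists>\<nu>. (\<forall>i. cmod (\<nu> i) \<le> 2 ^ K) \<and>
    (\<forall>x. \<bar>x\<bar> \<le> 1 / 2 \<longrightarrow>
      cmod (cis (\<sigma> * x) - (\<Sum>i<K. \<nu> i * cis (real i * x))) \<le> 2 * \<bar>x\<bar> ^ K)"
proof -
  let ?g = "\<lambda>n. complex_of_real \<sigma> gchoose n"
  \<comment> \<open>Obtained by expanding \<open>(cis x - 1) ^ n\<close> and collecting powers of
    \<open>cis x\<close>. The weights depend on \<sigma> and K but not on x, so one choice serves
    all frequencies at once.\<close>
  define \<nu> where "\<nu> = (\<lambda>i. \<Sum>n<K. ?g n * of_nat (n choose i) * (- 1) ^ (n - i))"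
  have bd: "cmod (\<nu> i) \<le> 2 ^ K" for i
  proof -
    have "cmod (\<nu> i) \<le> (\<Sum>n<K. 2 ^ n)"
      unfolding \<nu>_def
    proof (rule order_trans[OF norm_sum sum_mono])
      fix n
      have "real (n choose i) \<le> 2 ^ n"
        using binomial_le_pow2[of n i] by (metis of_nat_le_iff of_nat_numeral of_nat_power)
      then have "cmod (?g n) * real (n choose i) \<le> 1 * 2 ^ n"
        using norm_gbinomial_le_1[OF \<sigma>, of n] by (intro mult_mono) auto
      then show "cmod (?g n * of_nat (n choose i) * (- 1) ^ (n - i)) \<le> 2 ^ n"
        by (simp add: norm_mult norm_power)
    qed
    also have "\<dots> = 2 ^ K - (1::real)" by (induction K) auto
    finally show ?thesis by simp
  qed
  have approx: "cmod (cis (\<sigma> * x) - (\<Sum>i<K. \<nu> i * cis (real i * x))) \<le> 2 * \<bar>x\<bar> ^ K"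
    if x: "\<bar>x\<bar> \<le> 1 / 2" for x
  proof -
    define z where "z = cis x - 1"
    have z: "cmod z \<le> \<bar>x\<bar>" unfolding z_def by (rule norm_cis_minus_1_le)
    then have z1: "cmod z < 1" using x by linarith
    \<comment> \<open>The bound 1/2 on |x|, being below pi, keeps the argument in the principal
      branch, so the binomial series sums to the intended power.\<close>
    have "Ln (cis x) = \<i> * x"
      by (rule Ln_unique) (use x pi_gt3 in \<open>auto simp: cis_conv_exp\<close>)
    then have "(1 + z) powr \<sigma> = cis (\<sigma> * x)"
      by (simp add: z_def powr_def cis_conv_exp mult_ac)
    then have sums: "(\<lambda>n. ?g n * z ^ n) sums cis (\<sigma> * x)"
      using gen_binomial_complex[OF z1, of "complex_of_real \<sigma>"] by simp
    have poly: "(\<Sum>n<K. ?g n * z ^ n) = (\<Sum>i<K. \<nu> i * cis (real i * x))"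
    proof -
      have "(\<Sum>n<K. ?g n * z ^ n) = (\<Sum>n<K. \<Sum>i<K. ?g n * of_nat (n choose i) * (- 1) ^ (n - i) * cis (real i * x))"
      proof (intro sum.cong refl)
        fix n assume n: "n \<in> {..<K}"
        have "z ^ n = (\<Sum>i\<le>n. of_nat (n choose i) * cis x ^ i * (- 1) ^ (n - i))"
          using binomial_ring[of "cis x" "-1" n] by (simp add: z_def)
        \<comment> \<open>The range of i may be enlarged up to K because \<open>n choose i\<close>
          is 0 for i > n.\<close>
        also have "\<dots> = (\<Sum>i<K. of_nat (n choose i) * cis x ^ i * (- 1) ^ (n - i))"
          using n by (intro sum.mono_neutral_left) auto
        finally show "?g n * z ^ n = (\<Sum>i<K. ?g n * of_nat (n choose i) * (- 1) ^ (n - i) * cis (real i * x))"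
          by (simp add: sum_distrib_left Complex.DeMoivre mult_ac)
      qed
      also have "\<dots> = (\<Sum>i<K. \<nu> i * cis (real i * x))"
        by (subst sum.swap) (simp add: \<nu>_def sum_distrib_right)
      finally show ?thesis .
    qed
    have "(\<lambda>n. ?g (n + K) * z ^ (n + K)) sums (cis (\<sigma> * x) - (\<Sum>n<K. ?g n * z ^ n))"
      by (rule sums_split_initial_segment[OF sums])
    \<comment> \<open>The tail is dominated by a geometric series of ratio 1/2, whose sum is the 2
      in the error bound.\<close>
    moreover have "norm (?g (n + K) * z ^ (n + K)) \<le> (1 / 2) ^ n * \<bar>x\<bar> ^ K" for n
    proof -
      have "norm (?g (n + K) * z ^ (n + K)) \<le> 1 * cmod z ^ (n + K)"
        unfolding norm_mult norm_power using norm_gbinomial_le_1[OF \<sigma>] by (intro mult_right_mono) auto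
      also have "\<dots> \<le> 1 * \<bar>x\<bar> ^ (n + K)" using z by (intro mult_left_mono power_mono) auto
      also have "\<dots> \<le> (1 / 2) ^ n * \<bar>x\<bar> ^ K"
        unfolding power_add using x by (auto intro!: mult_mono power_mono)
      finally show ?thesis .
    qed
    moreover have "(\<lambda>n. (1 / 2) ^ n * \<bar>x\<bar> ^ K) sums (2 * \<bar>x\<bar> ^ K)"
      using sums_mult2[OF geometric_sums[of "1 / 2 :: real"], of "\<bar>x\<bar> ^ K"] by simp
    ultimately have "norm (cis (\<sigma> * x) - (\<Sum>n<K. ?g n * z ^ n)) \<le> 2 * \<bar>x\<bar> ^ K"
      by (metis (no_types, lifting) norm_sums_le)
    then show ?thesis by (simp only: poly)
  qed
  show ?thesis using bd approx by blast
qed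

section \<open>The dyadic pieces of the multiplier\<close>

text \<open>The limsup defining the dimension lies below \<beta> + \<epsilon>, hence so does the
  quotient of logarithms at all small scales. Endpoints are kept above 1/2 because they later serve
  as dilations, and the decay of the multiplier in the frequency requires dilations bounded away
  from zero.\<close>

lemma Minkowski_cover:
  assumes E: "E \<subseteq> {1..2}" and dim: "upper_minkowski_dim E = ereal \<beta>" and \<epsilon>: "\<epsilon> > 0"
  shows "\<exists>\<delta>'>0. \<forall>\<delta>. 0 < \<delta> \<and> \<delta> < \<delta>' \<longrightarrow>
    (\<exists>S. finite S \<and> E \<subseteq> (\<Union>c\<in>S. {c..c + \<delta>}) \<and> (\<forall>c\<in>S. 1 / 2 \<le> c) \<and>
      real (card S) \<le> \<delta> powr - (\<beta> + \<epsilon>))"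
proof -
  have "Limsup (at_right 0) (\<lambda>\<delta>. ereal (ln (real (covering_number E \<delta>)) / ln (1 / \<delta>))) < ereal (\<beta> + \<epsilon>)"
    using dim \<epsilon> by (simp add: upper_minkowski_dim_def)
  then have "\<forall>\<^sub>F \<delta> in at_right 0. ereal (ln (real (covering_number E \<delta>)) / ln (1 / \<delta>)) < ereal (\<beta> + \<epsilon>)"
    by (rule Limsup_lessD)
  then obtain b where b: "b > 0"
    "\<And>\<delta>. 0 < \<delta> \<Longrightarrow> \<delta> < b \<Longrightarrow> ln (real (covering_number E \<delta>)) / ln (1 / \<delta>) < \<beta> + \<epsilon>"
    by (auto simp: eventually_at_right_field)
  have "\<exists>S. finite S \<and> E \<subseteq> (\<Union>c\<in>S. {c..c + \<delta>}) \<and> (\<forall>c\<in>S. 1 / 2 \<le> c) \<and>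
      real (card S) \<le> \<delta> powr - (\<beta> + \<epsilon>)" if \<delta>: "0 < \<delta>" "\<delta> < min b (1 / 2)" for \<delta>
  proof -
    let ?P = "\<lambda>n. \<exists>S. finite S \<and> card S = n \<and> E \<subseteq> (\<Union>c\<in>S. {c..c + \<delta>})"
    \<comment> \<open>Some finite cover must exist before the \<open>LEAST\<close> in the definition
      says anything; an arithmetic progression of step \<delta> provides one.\<close>
    have "\<exists>n. ?P n"
    proof -
      define m where "m = nat \<lceil>1 / \<delta>\<rceil>"
      have "\<exists>c\<in>(\<lambda>i. 1 + real i * \<delta>) ` {..m}. t \<in> {c..c + \<delta>}" if "t \<in> E" for t
      proof -
        define i where "i = nat \<lfloor>(t - 1) / \<delta>\<rfloor>"
        have t: "1 \<le> t" "t \<le> 2" using E that by auto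
        have "0 \<le> (t - 1) / \<delta>" using t \<delta> by simp
        then have i: "real i \<le> (t - 1) / \<delta>" "(t - 1) / \<delta> < real i + 1"
          unfolding i_def by linarith+
        have "(t - 1) / \<delta> \<le> 1 / \<delta>" using t \<delta> by (intro divide_right_mono) auto
        then have "i \<le> m" unfolding i_def m_def by linarith
        moreover have "t \<in> {1 + real i * \<delta>..1 + real i * \<delta> + \<delta>}"
          using i \<delta> by (simp add: field_simps)
        ultimately show ?thesis by blast
      qed
      then have "E \<subseteq> (\<Union>c\<in>(\<lambda>i. 1 + real i * \<delta>) ` {..m}. {c..c + \<delta>})" by auto
      then have "?P (card ((\<lambda>i. 1 + real i * \<delta>) ` {..m}))" by blast
      then show ?thesis by blast
    qed
    then have "?P (covering_number E \<delta>)"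
      unfolding covering_number_def by (rule LeastI_ex)
    then obtain S where S: "finite S" "card S = covering_number E \<delta>" "E \<subseteq> (\<Union>c\<in>S. {c..c + \<delta>})"
      by blast
    \<comment> \<open>Since \<delta> < 1/2, an interval starting below 1/2 ends before 1 and misses
      \<open>E\<close>.\<close>
    define S' where "S' = {c\<in>S. 1 / 2 \<le> c}"
    have "E \<subseteq> (\<Union>c\<in>S'. {c..c + \<delta>})"
    proof
      fix t assume t: "t \<in> E"
      then obtain c where "c \<in> S" "t \<in> {c..c + \<delta>}" using S by blast
      moreover have "1 \<le> t" using t E by auto
      ultimately show "t \<in> (\<Union>c\<in>S'. {c..c + \<delta>})" using \<delta> by (auto simp: S'_def)
    qed
    moreover have "real (card S') \<le> \<delta> powr - (\<beta> + \<epsilon>)"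
    proof (cases "card S = 0")
      case True
      then show ?thesis using S by (simp add: S'_def)
    next
      case False
      have ln: "ln (1 / \<delta>) > 0" using \<delta> by simp
      have "ln (real (card S)) < (\<beta> + \<epsilon>) * ln (1 / \<delta>)"
        using b(2)[of \<delta>] \<delta> ln S(2) by (simp add: pos_divide_less_eq)
      then have "real (card S) < exp ((\<beta> + \<epsilon>) * ln (1 / \<delta>))"
        using False by (metis exp_less_mono exp_ln of_nat_0_less_iff not_gr_zero)
      also have "\<dots> = \<delta> powr - (\<beta> + \<epsilon>)"
        using \<delta> by (simp add: powr_def ln_div algebra_simps)
      finally have "real (card S) < \<delta> powr - (\<beta> + \<epsilon>)" .
      moreover have "card S' \<le> card S" unfolding S'_def using S by (intro card_mono) auto
      ultimately show ?thesis by linarith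
    qed
    ultimately show ?thesis using S(1) by (intro exI[of _ S']) (auto simp: S'_def)
  qed
  then show ?thesis using b(1) by (intro exI[of _ "min b (1 / 2)"]) auto
qed

section \<open>Dyadic shells and the multiplier at a fixed dilation\<close>

definition bilinear_average ::
    "((real ^ 'n) \<times> (real ^ 'n)) measure \<Rightarrow> (real ^ 'n \<Rightarrow> complex) \<Rightarrow> (real ^ 'n \<Rightarrow> complex) \<Rightarrow>
     real \<Rightarrow> real ^ 'n \<Rightarrow> complex" where
  "bilinear_average \<mu> f g t x = (LINT (y, z)|\<mu>. f (x - t *\<^sub>R y) * g (x - t *\<^sub>R z))"

text \<open>A difference of products and not a product of differences: one of the two frequencies
  has size about 2^j while the other may be arbitrarily small. The zeroth shell takes in all the low
  pairs, so that the shells exhaust everything.\<close>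

definition shell :: "nat \<Rightarrow> ((int ^ 'n) \<times> (int ^ 'n)) set" where
  "shell j = (if j = 0 then int_cube 1 \<times> int_cube 1
     else int_cube (2 ^ j) \<times> int_cube (2 ^ j) - int_cube (2 ^ (j - 1)) \<times> int_cube (2 ^ (j - 1)))"

lemma shell_subset: "shell j \<subseteq> int_cube (2 ^ j) \<times> int_cube (2 ^ j)"
  by (auto simp: shell_def)

lemma finite_shell [simp]: "finite (shell j)"
  by (rule finite_subset[OF shell_subset]) simp

lemma sum_shells:
  fixes h :: "(int ^ 'n) \<times> (int ^ 'n) \<Rightarrow> complex"
  shows "(\<Sum>z\<in>int_cube (2 ^ J) \<times> int_cube (2 ^ J). h z) = (\<Sum>j\<le>J. \<Sum>z\<in>shell j. h z)"
proof (induction J)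
  case (Suc J)
  have "(int_cube (2 ^ J) :: (int ^ 'n) set) \<subseteq> int_cube (2 ^ Suc J)"
    by (rule int_cube_mono) simp
  then have "(\<Sum>z\<in>int_cube (2 ^ Suc J) \<times> int_cube (2 ^ Suc J). h z) =
      (\<Sum>z\<in>shell (Suc J). h z) + (\<Sum>z\<in>int_cube (2 ^ J) \<times> int_cube (2 ^ J). h z)"
    unfolding shell_def by (subst sum.subset_diff) auto
  then show ?case using Suc by (simp add: add.commute)
qed (simp add: shell_def)

text \<open>\<open>C\<close> and \<open>R\<close> are parameters so that later constants may depend
  on them. The support condition treats the two components separately, since they translate the two
  functions; how \<open>a\<close> compares with the dimension enters later, through the condition on
  p and q.\<close>

locale decaying_measure = finite_measure \<mu>
  for \<mu> :: "((real ^ 'n) \<times> (real ^ 'n)) measure" +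
  fixes a C R :: real
  assumes sets_eq: "sets \<mu> = sets borel"
    and R: "R > 0" "AE w in \<mu>. norm (fst w) \<le> R \<and> norm (snd w) \<le> R"
    and C: "C \<ge> 0"
    and decay: "cmod (fourier_measure \<mu> \<xi> \<eta>) \<le> C * (1 + norm \<xi> + norm \<eta>) powr - a"
    and a: "a > 0"
begin

lemma space_eq: "space \<mu> = UNIV"
  using sets_eq_imp_space_eq[OF sets_eq] by simp

lemma measurable_eq: "f \<in> borel_measurable borel \<Longrightarrow> f \<in> borel_measurable \<mu>"
  using measurable_cong_sets[OF sets_eq refl] by blast

lemma integrable_bounded_continuous:
  fixes h :: "(real ^ 'n) \<times> (real ^ 'n) \<Rightarrow> complex"
  assumes "continuous_on UNIV h" "\<And>w. cmod (h w) \<le> B"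
  shows "integrable \<mu> h"
  by (rule integrable_const_bound[of _ B])
     (use assms in \<open>auto intro!: measurable_eq borel_measurable_continuous_onI\<close>)

definition symb :: "real \<Rightarrow> real \<Rightarrow> int ^ 'n \<Rightarrow> int ^ 'n \<Rightarrow> complex" where
  "symb L t k l = fourier_measure \<mu> ((t / L) *\<^sub>R real_vec k) ((t / L) *\<^sub>R real_vec l)"

text \<open>The angular frequency of the multiplier as a function of t: with t factored out,
  \<open>symb\<close> becomes a superposition of \<open>cis (t * phase L k l w)\<close> over the
  support of \<mu>, hence band-limited in t.\<close>

definition phase :: "real \<Rightarrow> int ^ 'n \<Rightarrow> int ^ 'n \<Rightarrow> (real ^ 'n) \<times> (real ^ 'n) \<Rightarrow> real" where
  "phase L k l w = - (2 * pi / L * (real_vec k \<bullet> fst w + real_vec l \<bullet> snd w))"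

lemma integrable_phase: "integrable \<mu> (\<lambda>w. cis (s * phase L k l w))"
proof -
  have "continuous_on UNIV (\<lambda>w. cis (s * - (\<kappa> * (real_vec k \<bullet> fst w + real_vec l \<bullet> snd w))))" for \<kappa>
    unfolding cis_conv_exp by (intro continuous_intros)
  then show ?thesis
    unfolding phase_def by (rule integrable_bounded_continuous[where B=1]) simp
qed

lemma symb_eq: "symb L t k l = (LINT w|\<mu>. cis (t * phase L k l w))"
  unfolding symb_def fourier_measure_def
  by (rule Bochner_Integration.integral_cong)
     (auto simp: phase_def cis_conv_exp inner_commute algebra_simps add_divide_distrib)

lemma bilinear_average_trig_sum:
  assumes F: "finite F" and G: "finite G"
  shows "bilinear_average \<mu> (trig_sum L F \<alpha>) (trig_sum L G \<gamma>) t x =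
    (\<Sum>(k, l)\<in>F \<times> G. \<alpha> k * \<gamma> l * symb L t k l * wave L (k + l) x)"
proof -
  have ptw: "trig_sum L F \<alpha> (x - t *\<^sub>R fst w) * trig_sum L G \<gamma> (x - t *\<^sub>R snd w) =
    (\<Sum>(k, l)\<in>F \<times> G. (\<alpha> k * \<gamma> l * wave L (k + l) x) * cis (t * phase L k l w))" for w
  proof -
    have "\<alpha> k * wave L k (x - t *\<^sub>R fst w) * (\<gamma> l * wave L l (x - t *\<^sub>R snd w))
        = (\<alpha> k * \<gamma> l * wave L (k + l) x) * cis (t * phase L k l w)" for k l
    proof -
      have "- (2 * pi / L * (real_vec k \<bullet> t *\<^sub>R fst w)) + - (2 * pi / L * (real_vec l \<bullet> t *\<^sub>R snd w))
          = t * phase L k l w"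
        unfolding phase_def by (simp add: algebra_simps)
      then have eq: "cis (- (2 * pi / L * (real_vec k \<bullet> t *\<^sub>R fst w))) * cis (- (2 * pi / L * (real_vec l \<bullet> t *\<^sub>R snd w)))
          = cis (t * phase L k l w)"
        by (simp only: cis_mult)
      show ?thesis
        unfolding wave_diff wave_add eq[symmetric] by (simp only: mult_ac)
    qed
    then show ?thesis
      unfolding trig_sum_def sum_product sum.cartesian_product by (simp only:)
  qed
  have "bilinear_average \<mu> (trig_sum L F \<alpha>) (trig_sum L G \<gamma>) t x =
    (LINT w|\<mu>. (\<Sum>(k, l)\<in>F \<times> G. (\<alpha> k * \<gamma> l * wave L (k + l) x) * cis (t * phase L k l w)))"
    unfolding bilinear_average_def case_prod_beta ptw[unfolded case_prod_beta] ..
  also have "\<dots> = (\<Sum>z\<in>F \<times> G. LINT w|\<mu>. (\<alpha> (fst z) * \<gamma> (snd z) * wave L (fst z + snd z) x) * cis (t * phase L (fst z) (snd z) w))"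
    unfolding case_prod_beta
    by (rule Bochner_Integration.integral_sum) (intro integrable_mult_right integrable_phase)
  also have "\<dots> = (\<Sum>(k, l)\<in>F \<times> G. \<alpha> k * \<gamma> l * symb L t k l * wave L (k + l) x)"
    by (simp add: symb_eq case_prod_beta mult_ac)
  finally show ?thesis .
qed

lemma norm_real_vec_ge: "\<bar>real_of_int (k $ i)\<bar> \<le> norm (real_vec k)"
  using component_le_norm_cart[of "real_vec k" i] by (simp add: real_vec_def)

lemma norm_real_vec_le:
  assumes "k \<in> int_cube N"
  shows "norm (real_vec k :: real ^ 'n) \<le> real CARD('n) * real N"
proof -
  have "norm (real_vec k :: real ^ 'n) \<le> (\<Sum>i\<in>UNIV. \<bar>real_vec k $ i\<bar>)"
    by (rule norm_le_l1_cart)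
  also have "\<dots> \<le> (\<Sum>i\<in>(UNIV::'n set). real N)"
  proof (rule sum_mono)
    fix i
    have "\<bar>k $ i\<bar> \<le> int N" using assms by (simp add: int_cube_def)
    then show "\<bar>(real_vec k :: real ^ 'n) $ i\<bar> \<le> real N" by (simp add: real_vec_def)
  qed
  finally show ?thesis by simp
qed

text \<open>Outside the inner cube some coordinate exceeds \<open>2 ^ (j - 1)\<close>, and t \<ge>
  1/2 may halve this once more; hence the 4. For j = 0, where no frequency is bounded below, the
  summand 1 suffices because L \<ge> 1.\<close>

lemma symb_decay:
  assumes L: "L \<ge> 1" and t: "t \<ge> 1 / 2" and kl: "(k, l) \<in> shell j"
  shows "cmod (symb L t k l) \<le> C * (2 ^ j / (4 * L)) powr - a"
proof -
  let ?n = "\<lambda>k. norm ((t / L) *\<^sub>R real_vec k :: real ^ 'n)"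
  have "2 ^ j / (4 * L) \<le> 1 + ?n k + ?n l"
  proof (cases "j = 0")
    case True
    then have "2 ^ j / (4 * L) \<le> 1" using L by simp
    then show ?thesis by (smt (verit) norm_ge_zero)
  next
    case False
    have big: "2 ^ j / (4 * L) \<le> ?n m" if m: "m \<notin> int_cube (2 ^ (j - 1))" for m
    proof -
      obtain i where "\<not> \<bar>m $ i\<bar> \<le> int (2 ^ (j - 1))"
        using m unfolding int_cube_def by blast
      then have "real_of_int (int (2 ^ (j - 1))) \<le> \<bar>real_of_int (m $ i)\<bar>"
        unfolding of_int_abs[symmetric] of_int_le_iff by simp
      then have m: "2 ^ (j - 1) \<le> norm (real_vec m)" using norm_real_vec_ge[of m i] by simp
      have "2 ^ j / (4 * L) = (1 / 2) / L * 2 ^ (j - 1)"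
        using False by (cases j) auto
      also have "\<dots> \<le> t / L * norm (real_vec m)"
        using t L m by (intro mult_mono divide_right_mono) auto
      also have "\<dots> = ?n m" using t L by simp
      finally show ?thesis .
    qed
    have "k \<notin> int_cube (2 ^ (j - 1)) \<or> l \<notin> int_cube (2 ^ (j - 1))"
      using kl False by (auto simp: shell_def)
    then show ?thesis
    proof
      assume "k \<notin> int_cube (2 ^ (j - 1))"
      from big[OF this] show ?thesis using norm_ge_zero[of "(t / L) *\<^sub>R real_vec l"] by linarith
    next
      assume "l \<notin> int_cube (2 ^ (j - 1))"
      from big[OF this] show ?thesis using norm_ge_zero[of "(t / L) *\<^sub>R real_vec k"] by linarith
    qed
  qed
  then have "(1 + ?n k + ?n l) powr - a \<le> (2 ^ j / (4 * L)) powr - a"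
    using L a by (intro powr_mono2') auto
  then have "C * (1 + ?n k + ?n l) powr - a \<le> C * (2 ^ j / (4 * L)) powr - a"
    using C by (rule mult_left_mono)
  then show ?thesis unfolding symb_def using decay order_trans by blast
qed

text \<open>For \<open>k\<close>, \<open>l\<close> in \<open>int_cube N\<close> and \<open>w\<close> in the support of \<open>\<mu>\<close>, the frequency
  \<open>phase L k l w\<close> of the multiplier as a function of \<open>t\<close> is at most \<open>osc L * N\<close>.\<close>

definition osc :: "real \<Rightarrow> real" where
  "osc L = 4 * pi * R * real CARD('n) / L"

text \<open>The interpolation is done under the integral over \<mu>. Since the weights depend only
  on the position of t in its interval and on K, the same ones work for all k and l, which allows
  whole pieces of the operator to be interpolated.\<close>

lemma symb_newton:
  assumes L: "L > 0" and \<delta>: "\<delta> > 0" and t: "t \<in> {c..c + \<delta>}" and small: "osc L * \<delta> * real N \<le> 1 / 2"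
  shows "\<exists>\<nu>. (\<forall>i. cmod (\<nu> i) \<le> 2 ^ K) \<and> (\<forall>k\<in>int_cube N. \<forall>l\<in>int_cube N.
    cmod (symb L t k l - (\<Sum>i<K. \<nu> i * symb L (c + real i * \<delta>) k l))
      \<le> 2 * (osc L * \<delta> * real N) ^ K * measure \<mu> UNIV)"
proof -
  define \<sigma> where "\<sigma> = (t - c) / \<delta>"
  have \<sigma>: "0 \<le> \<sigma>" "\<sigma> \<le> 1" "t = c + \<sigma> * \<delta>" using t \<delta> by (auto simp: \<sigma>_def field_simps)
  define \<eta> where "\<eta> = osc L * \<delta> * real N"
  obtain \<nu> where \<nu>: "\<forall>i. cmod (\<nu> i) \<le> 2 ^ K"
    "\<And>x. \<bar>x\<bar> \<le> 1 / 2 \<Longrightarrow> cmod (cis (\<sigma> * x) - (\<Sum>i<K. \<nu> i * cis (real i * x))) \<le> 2 * \<bar>x\<bar> ^ K"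
    using newton_cis[OF \<sigma>(1,2)] by blast
  have "cmod (symb L t k l - (\<Sum>i<K. \<nu> i * symb L (c + real i * \<delta>) k l)) \<le> 2 * \<eta> ^ K * measure \<mu> UNIV"
    if k: "k \<in> int_cube N" and l: "l \<in> int_cube N" for k l
  proof -
    let ?ph = "phase L k l"
    let ?f = "\<lambda>w. cis (t * ?ph w) - (\<Sum>i<K. \<nu> i * cis ((c + real i * \<delta>) * ?ph w))"
    have int: "integrable \<mu> (\<lambda>w. \<Sum>i<K. \<nu> i * cis ((c + real i * \<delta>) * ?ph w))"
      by (intro Bochner_Integration.integrable_sum integrable_mult_right integrable_phase)
    have "symb L t k l - (\<Sum>i<K. \<nu> i * symb L (c + real i * \<delta>) k l) = (LINT w|\<mu>. ?f w)"
      using int by (simp add: symb_eq integrable_phase)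
    then have "cmod (symb L t k l - (\<Sum>i<K. \<nu> i * symb L (c + real i * \<delta>) k l)) \<le> (LINT w|\<mu>. cmod (?f w))"
      by simp
    also have "\<dots> \<le> (LINT w|\<mu>. 2 * \<eta> ^ K)"
    proof (rule integral_mono_AE)
      show "integrable \<mu> (\<lambda>w. cmod (?f w))"
        by (intro integrable_norm Bochner_Integration.integrable_diff integrable_phase int)
      show "AE w in \<mu>. cmod (?f w) \<le> 2 * \<eta> ^ K"
        using R(2)
      proof eventually_elim
        case (elim w)
        have inner: "\<bar>real_vec m \<bullet> v\<bar> \<le> real CARD('n) * real N * R"
          if "m \<in> int_cube N" "norm v \<le> R" for m :: "int ^ 'n" and v
          using Cauchy_Schwarz_ineq2[of "real_vec m" v] norm_real_vec_le[OF that(1)] that(2)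
          by (smt (verit) mult_mono norm_ge_zero)
        have "\<bar>\<delta> * ?ph w\<bar> = \<delta> * (2 * pi / L * \<bar>real_vec k \<bullet> fst w + real_vec l \<bullet> snd w\<bar>)"
          using \<delta> L by (simp add: phase_def abs_mult)
        also have "\<dots> \<le> \<delta> * (2 * pi / L * (2 * (real CARD('n) * real N * R)))"
          using \<delta> L inner[OF k] inner[OF l] elim by (intro mult_left_mono) (force, auto)
        also have "\<dots> = \<eta>" by (simp add: \<eta>_def osc_def)
        finally have x: "\<bar>\<delta> * ?ph w\<bar> \<le> \<eta>" .
        \<comment> \<open>Pulling out the unimodular factor at the left endpoint moves the nodes to
          multiples of \<delta>, which is the situation of \<open>newton_cis\<close>.\<close>
        have "?f w = cis (c * ?ph w) * (cis (\<sigma> * (\<delta> * ?ph w)) - (\<Sum>i<K. \<nu> i * cis (real i * (\<delta> * ?ph w))))"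
          unfolding \<sigma>(3) by (simp add: right_diff_distrib sum_distrib_left cis_mult algebra_simps)
        then have "cmod (?f w) = cmod (cis (\<sigma> * (\<delta> * ?ph w)) - (\<Sum>i<K. \<nu> i * cis (real i * (\<delta> * ?ph w))))"
          by (simp add: norm_mult)
        also have "\<dots> \<le> 2 * \<bar>\<delta> * ?ph w\<bar> ^ K"
          using x small by (intro \<nu>(2)) (simp add: \<eta>_def)
        also have "\<dots> \<le> 2 * \<eta> ^ K"
          using x by (intro mult_left_mono power_mono) auto
        finally show ?case .
      qed
    qed simp
    also have "\<dots> = 2 * \<eta> ^ K * measure \<mu> UNIV" by (simp add: space_eq)
    finally show ?thesis .
  qed
  then show ?thesis using \<nu>(1) unfolding \<eta>_def by blast
qed

text \<open>\<open>S\<close> need not be a product set, so this is in general not the average of two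
  truncated sums: the operator is decomposed, not its arguments.\<close>

definition piece where
  "piece L \<alpha> \<gamma> S t x = (\<Sum>(k, l)\<in>S. \<alpha> k * \<gamma> l * symb L t k l * wave L (k + l) x)"

lemma continuous_on_piece: "continuous_on A (piece L \<alpha> \<gamma> S t)"
  unfolding piece_def case_prod_beta by (intro continuous_intros continuous_on_wave)

text \<open>The main term is Cauchy--Schwarz over the K nodes, with weights at most 2^K. The
  remainder is estimated without orthogonality, by l^1 norms of the coefficients, which costs
  \<open>card B\<close> twice; a large K pays for this later.\<close>

lemma piece_newton:
  fixes B :: "(int ^ 'n) set"
  assumes L: "L > 0" and \<delta>: "\<delta> > 0" and t: "t \<in> {c..c + \<delta>}" and small: "osc L * \<delta> * real N \<le> 1 / 2"
    and B: "B = int_cube N" and S: "S \<subseteq> B \<times> B"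
  shows "(cmod (piece L \<alpha> \<gamma> S t x))\<^sup>2 \<le>
    2 * 4 ^ K * real K * (\<Sum>i<K. (cmod (piece L \<alpha> \<gamma> S (c + real i * \<delta>) x))\<^sup>2)
    + 8 * (osc L * \<delta> * real N) ^ (2 * K) * (measure \<mu> UNIV)\<^sup>2 * (real (card B))\<^sup>2 *
      (\<Sum>k\<in>B. (cmod (\<alpha> k))\<^sup>2) * (\<Sum>l\<in>B. (cmod (\<gamma> l))\<^sup>2)"
proof -
  define rem where "rem = 2 * (osc L * \<delta> * real N) ^ K * measure \<mu> UNIV"
  have "\<exists>\<nu>. (\<forall>i. cmod (\<nu> i) \<le> 2 ^ K) \<and> (\<forall>k\<in>B. \<forall>l\<in>B.
      cmod (symb L t k l - (\<Sum>i<K. \<nu> i * symb L (c + real i * \<delta>) k l)) \<le> rem)"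
    unfolding B rem_def by (rule symb_newton[OF L \<delta> t small])
  then obtain \<nu> where \<nu>': "(\<forall>i. cmod (\<nu> i) \<le> 2 ^ K) \<and> (\<forall>k\<in>B. \<forall>l\<in>B.
      cmod (symb L t k l - (\<Sum>i<K. \<nu> i * symb L (c + real i * \<delta>) k l)) \<le> rem)" ..
  note \<nu> = conjunct1[OF \<nu>', rule_format] conjunct2[OF \<nu>', rule_format]
  have fS: "finite S" by (rule finite_subset[OF S]) (simp add: B)
  have rem0: "rem \<ge> 0" unfolding rem_def osc_def using L \<delta> R by simp
  let ?P = "\<lambda>t. piece L \<alpha> \<gamma> S t x"
  let ?Q = "\<Sum>i<K. \<nu> i * ?P (c + real i * \<delta>)"
  have "?Q = (\<Sum>(k, l)\<in>S. \<Sum>i<K. \<nu> i * (\<alpha> k * \<gamma> l * symb L (c + real i * \<delta>) k l * wave L (k + l) x))"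
    unfolding piece_def sum_distrib_left case_prod_beta by (rule sum.swap)
  also have "\<dots> = (\<Sum>(k, l)\<in>S. \<alpha> k * \<gamma> l * (\<Sum>i<K. \<nu> i * symb L (c + real i * \<delta>) k l) * wave L (k + l) x)"
    by (intro sum.cong refl) (auto simp: sum_distrib_left sum_distrib_right mult_ac)
  finally have Q: "?Q = (\<Sum>(k, l)\<in>S. \<alpha> k * \<gamma> l * (\<Sum>i<K. \<nu> i * symb L (c + real i * \<delta>) k l) * wave L (k + l) x)" .
  have diffeq: "?P t - ?Q = (\<Sum>(k, l)\<in>S. \<alpha> k * \<gamma> l *
      (symb L t k l - (\<Sum>i<K. \<nu> i * symb L (c + real i * \<delta>) k l)) * wave L (k + l) x)"
    unfolding Q unfolding piece_def sum_subtractf[symmetric]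
    by (intro sum.cong refl) (auto simp: right_diff_distrib left_diff_distrib)
  have "cmod (?P t - ?Q) \<le> (\<Sum>(k, l)\<in>S. (cmod (\<alpha> k) * cmod (\<gamma> l)) * rem)"
    unfolding diffeq
  proof (rule order_trans[OF norm_sum], rule sum_mono)
    fix z assume z: "z \<in> S"
    obtain k l where kl: "z = (k, l)" by fastforce
    have "cmod (symb L t k l - (\<Sum>i<K. \<nu> i * symb L (c + real i * \<delta>) k l)) \<le> rem"
      using S z kl by (intro \<nu>(2)) auto
    then show "cmod (case z of (k, l) \<Rightarrow> \<alpha> k * \<gamma> l *
        (symb L t k l - (\<Sum>i<K. \<nu> i * symb L (c + real i * \<delta>) k l)) * wave L (k + l) x)
      \<le> (case z of (k, l) \<Rightarrow> cmod (\<alpha> k) * cmod (\<gamma> l) * rem)"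
      by (simp add: kl norm_mult mult_left_mono)
  qed
  also have "\<dots> \<le> (\<Sum>(k, l)\<in>B \<times> B. (cmod (\<alpha> k) * cmod (\<gamma> l)) * rem)"
  proof (rule sum_mono2)
    show "finite (B \<times> B)" by (simp add: B)
  qed (use S rem0 in auto)
  also have "\<dots> = (\<Sum>k\<in>B. cmod (\<alpha> k)) * (\<Sum>l\<in>B. cmod (\<gamma> l)) * rem"
    unfolding sum_product unfolding sum_distrib_right sum.cartesian_product by (simp add: case_prod_beta)
  finally have diff: "cmod (?P t - ?Q) \<le> (\<Sum>k\<in>B. cmod (\<alpha> k)) * (\<Sum>l\<in>B. cmod (\<gamma> l)) * rem" .
  have "(cmod (?P t - ?Q))\<^sup>2 \<le> ((\<Sum>k\<in>B. cmod (\<alpha> k)) * (\<Sum>l\<in>B. cmod (\<gamma> l)) * rem)\<^sup>2"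
    using diff by (intro power_mono) auto
  also have "\<dots> = (\<Sum>k\<in>B. cmod (\<alpha> k))\<^sup>2 * (\<Sum>l\<in>B. cmod (\<gamma> l))\<^sup>2 * rem\<^sup>2"
    by (simp add: power_mult_distrib)
  also have "\<dots> \<le> ((\<Sum>k\<in>B. (cmod (\<alpha> k))\<^sup>2) * real (card B)) * ((\<Sum>k\<in>B. (cmod (\<gamma> k))\<^sup>2) * real (card B)) * rem\<^sup>2"
    by (intro mult_mono sum_squared_le_sum_of_squares) (auto intro!: mult_nonneg_nonneg sum_nonneg)
  finally have sq1: "(cmod (?P t - ?Q))\<^sup>2 \<le> rem\<^sup>2 * (real (card B))\<^sup>2 *
      (\<Sum>k\<in>B. (cmod (\<alpha> k))\<^sup>2) * (\<Sum>l\<in>B. (cmod (\<gamma> l))\<^sup>2)"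
    by (simp add: power2_eq_square mult_ac)
  have "cmod ?Q \<le> (\<Sum>i<K. 2 ^ K * cmod (?P (c + real i * \<delta>)))"
    by (rule order_trans[OF norm_sum sum_mono]) (simp add: norm_mult mult_right_mono \<nu>(1))
  then have "(cmod ?Q)\<^sup>2 \<le> (\<Sum>i<K. 2 ^ K * cmod (?P (c + real i * \<delta>)))\<^sup>2"
    by (intro power_mono) auto
  also have "\<dots> \<le> (\<Sum>i<K. (2 ^ K * cmod (?P (c + real i * \<delta>)))\<^sup>2) * real K"
    using sum_squared_le_sum_of_squares[of _ "{..<K}"] by simp
  also have "\<dots> = 4 ^ K * real K * (\<Sum>i<K. (cmod (?P (c + real i * \<delta>)))\<^sup>2)"
  proof -
    have "((2::real) ^ K)\<^sup>2 = 4 ^ K" by (simp add: power2_eq_square flip: power_mult_distrib)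
    then show ?thesis by (simp add: power_mult_distrib flip: sum_distrib_left)
  qed
  finally have sq2: "(cmod ?Q)\<^sup>2 \<le> 4 ^ K * real K * (\<Sum>i<K. (cmod (?P (c + real i * \<delta>)))\<^sup>2)" .
  have "cmod (?P t) \<le> cmod ?Q + cmod (?P t - ?Q)"
    using norm_triangle_ineq[of ?Q "?P t - ?Q"] by simp
  then have "(cmod (?P t))\<^sup>2 \<le> (cmod ?Q + cmod (?P t - ?Q))\<^sup>2" by (intro power_mono) auto
  also have "\<dots> \<le> 2 * (cmod ?Q)\<^sup>2 + 2 * (cmod (?P t - ?Q))\<^sup>2"
    using sum_squares_bound[of "cmod ?Q" "cmod (?P t - ?Q)"] by (simp add: power2_sum)
  also have "\<dots> \<le> 2 * (4 ^ K * real K * (\<Sum>i<K. (cmod (?P (c + real i * \<delta>)))\<^sup>2)) +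
      2 * (rem\<^sup>2 * (real (card B))\<^sup>2 * (\<Sum>k\<in>B. (cmod (\<alpha> k))\<^sup>2) * (\<Sum>l\<in>B. (cmod (\<gamma> l))\<^sup>2))"
    using sq1 sq2 by linarith
  also have "rem\<^sup>2 = 4 * (osc L * \<delta> * real N) ^ (2 * K) * (measure \<mu> UNIV)\<^sup>2"
    by (simp add: rem_def power_mult_distrib power_mult[symmetric] mult.commute[of K 2])
  finally show ?thesis by (simp add: mult.assoc)
qed

text \<open>The supremum over \<open>E\<close> gives way to a sum over all intervals and all nodes.
  Asking for a continuous majorant settles integrability over the torus and avoids treating the
  supremum itself as a function of x.\<close>

lemma piece_majorant:
  fixes B :: "(int ^ 'n) set"
  assumes L: "L \<ge> 1" and \<delta>: "\<delta> > 0" and small: "osc L * \<delta> * 2 ^ j \<le> 1 / 2"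
    and B: "B = int_cube (2 ^ j)"
    and Sc: "finite Sc" "E \<subseteq> (\<Union>c\<in>Sc. {c..c + \<delta>})" "\<And>c. c \<in> Sc \<Longrightarrow> 1 / 2 \<le> c"
  shows "\<exists>G. continuous_on UNIV G \<and> (\<forall>x. 0 \<le> G x) \<and>
    (\<forall>t\<in>E. \<forall>x. (cmod (piece L \<alpha> \<gamma> (shell j) t x))\<^sup>2 \<le> G x) \<and>
    (LINT x|torus L. G x) \<le> L ^ CARD('n) *
      (2 * 4 ^ K * (real K)\<^sup>2 * real (card Sc) * C\<^sup>2 * (2 ^ j / (4 * L)) powr (- 2 * a)
        + 8 * (osc L * \<delta> * 2 ^ j) ^ (2 * K) * (measure \<mu> UNIV)\<^sup>2 * real (card B)) * real (card B) *
      (\<Sum>k\<in>B. (cmod (\<alpha> k))\<^sup>2) * (\<Sum>l\<in>B. (cmod (\<gamma> l))\<^sup>2)"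
proof -
  define P where "P = (\<lambda>t x. (cmod (piece L \<alpha> \<gamma> (shell j) t x))\<^sup>2)"
  define D where "D = (\<Sum>k\<in>B. (cmod (\<alpha> k))\<^sup>2) * (\<Sum>l\<in>B. (cmod (\<gamma> l))\<^sup>2)"
  define rem where "rem = 8 * (osc L * \<delta> * 2 ^ j) ^ (2 * K) * (measure \<mu> UNIV)\<^sup>2 * (real (card B))\<^sup>2 * D"
  \<comment> \<open>Summing over every c in \<open>Sc\<close>, not only over the interval containing
    t, makes the majorant independent of t; the price is the factor \<open>card Sc\<close>.\<close>
  define G where "G = (\<lambda>x. 2 * 4 ^ K * real K * (\<Sum>c\<in>Sc. \<Sum>i<K. P (c + real i * \<delta>) x) + rem)"
  define W where "W = C * (2 ^ j / (4 * L)) powr - a"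
  have L0: "L > 0" using L by simp
  have small': "osc L * \<delta> * real (2 ^ j) \<le> 1 / 2" using small by simp
  have sub: "shell j \<subseteq> B \<times> B" unfolding B by (rule shell_subset)
  have D0: "D \<ge> 0" by (simp add: D_def sum_nonneg)
  have rem0: "rem \<ge> 0" unfolding rem_def osc_def using L0 \<delta> R D0 by simp
  have P0: "P t x \<ge> 0" for t x by (simp add: P_def)
  have contP: "continuous_on UNIV (P t)" for t
    unfolding P_def by (intro continuous_intros continuous_on_piece)
  have contG: "continuous_on UNIV G"
    unfolding G_def by (intro continuous_intros contP)
  have G0: "0 \<le> G x" for x
    unfolding G_def using rem0 P0 by (intro add_nonneg_nonneg mult_nonneg_nonneg sum_nonneg) auto
  have bound: "P t x \<le> G x" if t: "t \<in> E" for t x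
  proof -
    obtain c where c: "c \<in> Sc" "t \<in> {c..c + \<delta>}" using t Sc by blast
    have "P t x \<le> 2 * 4 ^ K * real K * (\<Sum>i<K. P (c + real i * \<delta>) x) + rem"
      using piece_newton[OF L0 \<delta> c(2) small' B sub, where x=x and K=K and \<alpha>=\<alpha> and \<gamma>=\<gamma>]
      unfolding P_def rem_def D_def by (simp add: mult.assoc)
    also have "(\<Sum>i<K. P (c + real i * \<delta>) x) \<le> (\<Sum>c\<in>Sc. \<Sum>i<K. P (c + real i * \<delta>) x)"
      using Sc(1) c(1) P0 by (intro member_le_sum) (auto intro!: sum_nonneg)
    finally show ?thesis unfolding G_def by (simp add: mult_left_mono)
  qed
  have intP: "(LINT x|torus L. P t x) \<le> L ^ CARD('n) * (W\<^sup>2 * real (card B) * D)" if t: "t \<ge> 1 / 2" for t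
  proof -
    have "(LINT x|torus L. P t x) \<le> L ^ CARD('n) * (W\<^sup>2 * real (card B) *
        (\<Sum>k\<in>B. (cmod (\<alpha> k))\<^sup>2) * (\<Sum>l\<in>B. (cmod (\<gamma> l))\<^sup>2))"
      unfolding P_def piece_def
    proof (rule integral_bilinear_sum_le[OF L0])
      show "finite B" by (simp add: B)
      show "shell j \<subseteq> B \<times> B" unfolding B by (rule shell_subset)
      show "0 \<le> W" using C by (simp add: W_def)
      show "cmod (\<alpha> k * \<gamma> l * symb L t k l) \<le> W * (cmod (\<alpha> k) * cmod (\<gamma> l))" if "(k, l) \<in> shell j" for k l
        using symb_decay[OF L t that] unfolding W_def norm_mult
        by (simp add: mult.commute mult_left_mono)
    qed
    then show ?thesis by (simp add: D_def mult.assoc)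
  qed
  have "(LINT x|torus L. G x) = 2 * 4 ^ K * real K * (\<Sum>c\<in>Sc. \<Sum>i<K. (LINT x|torus L. P (c + real i * \<delta>) x)) + L ^ CARD('n) * rem"
  proof -
    interpret T: finite_measure "torus L :: (real ^ 'n) measure" by (rule finite_measure_torus)
    have i: "integrable (torus L) (P t)" for t by (rule integrable_torus_continuous[OF contP])
    \<comment> \<open>The volume of the torus is read off as the integral of the wave of frequency
      0.\<close>
    have "(LINT x|(torus L :: (real ^ 'n) measure). (1::real)) = L ^ CARD('n)"
    proof -
      have "complex_of_real (LINT x|(torus L :: (real ^ 'n) measure). (1::real)) = (LINT x|torus L. wave L (0 :: int ^ 'n) x)"
        unfolding wave_0 by (subst integral_complex_of_real[symmetric]) simp
      also have "\<dots> = complex_of_real (L ^ CARD('n))" by (simp only: integral_wave[OF L0]) simp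
      finally show ?thesis by (simp only: of_real_eq_iff)
    qed
    then have m: "measure (torus L :: (real ^ 'n) measure) (space (torus L)) = L ^ CARD('n)" by simp
    show ?thesis
      unfolding G_def using i m
      by (simp add: Bochner_Integration.integral_add Bochner_Integration.integrable_sum)
  qed
  also have "\<dots> \<le> 2 * 4 ^ K * real K * (\<Sum>c\<in>Sc. \<Sum>i<K. L ^ CARD('n) * (W\<^sup>2 * real (card B) * D)) + L ^ CARD('n) * rem"
  proof -
    \<comment> \<open>The nodes may lie outside \<open>E\<close>; the fixed-time estimate asks only
      for a dilation of at least 1/2.\<close>
    have "c + real i * \<delta> \<ge> 1 / 2" if "c \<in> Sc" for c i
      using Sc(3)[OF that] \<delta> by (simp add: add_increasing2)
    then show ?thesis by (intro add_right_mono mult_left_mono sum_mono intP) auto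
  qed
  also have "\<dots> = L ^ CARD('n) * (2 * 4 ^ K * (real K)\<^sup>2 * real (card Sc) * W\<^sup>2
        + 8 * (osc L * \<delta> * 2 ^ j) ^ (2 * K) * (measure \<mu> UNIV)\<^sup>2 * real (card B)) * real (card B) * D"
    unfolding rem_def by (simp add: algebra_simps power2_eq_square)
  also have "W\<^sup>2 = C\<^sup>2 * (2 ^ j / (4 * L)) powr (- 2 * a)"
  proof -
    have "((2 ^ j / (4 * L)) powr - a)\<^sup>2 = (2 ^ j / (4 * L)) powr (- 2 * a)"
      using L0 by (simp add: power2_eq_square powr_add[symmetric])
    then show ?thesis by (simp add: W_def power_mult_distrib)
  qed
  finally show ?thesis
    using contG G0 bound unfolding P_def D_def by (intro exI[of _ G]) (auto simp: mult.assoc)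
qed

end

section \<open>The maximal estimate for trigonometric sums\<close>

text \<open>One \<epsilon> serves two purposes: shortening the intervals beyond 2^(-j), and
  exceeding the dimension in the count of intervals. By continuity the product of the two losses is
  as close to \<beta> as desired.\<close>

lemma exists_loss_parameter:
  fixes \<beta> G :: real
  assumes "\<beta> < G"
  shows "\<exists>\<epsilon>>0. (1 + \<epsilon>) * (\<beta> + \<epsilon>) < G"
proof -
  have "((\<lambda>\<epsilon>. (1 + \<epsilon>) * (\<beta> + \<epsilon>)) \<longlongrightarrow> (1 + 0) * (\<beta> + 0)) (at_right 0)"
    by (intro tendsto_intros)
  then have "\<forall>\<^sub>F \<epsilon> in at_right 0. (1 + \<epsilon>) * (\<beta> + \<epsilon>) < G"
    by (rule order_tendstoD) (use assms in simp)
  then have "\<forall>\<^sub>F \<epsilon> in at_right 0. \<epsilon> > 0 \<and> (1 + \<epsilon>) * (\<beta> + \<epsilon>) < G"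
    using eventually_at_right_less by (rule eventually_conj[rotated])
  then show ?thesis using eventually_happens'[OF trivial_limit_at_right_real] by fastforce
qed

lemma card_int_cube_pow2_le:
  "real (card (int_cube (2 ^ j) :: (int ^ 'n) set)) \<le> 3 ^ CARD('n) * 2 powr (real CARD('n) * real j)"
proof -
  have "real (card (int_cube (2 ^ j) :: (int ^ 'n) set)) = (2 * 2 ^ j + 1) ^ CARD('n)"
    unfolding card_int_cube by (simp add: add.commute)
  also have "\<dots> \<le> (3 * 2 ^ j) ^ CARD('n)"
    by (intro power_mono) auto
  also have "\<dots> = 3 ^ CARD('n) * 2 powr (real CARD('n) * real j)"
    by (simp add: power_mult_distrib powr_realpow[symmetric] powr_powr mult.commute flip: powr_realpow)
  finally show ?thesis .
qed

lemma sum_pow2_le: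
  assumes "\<rho> > 0"
  shows "(\<Sum>j\<le>J. 2 powr (- \<rho> * real j)) \<le> 1 / (1 - 2 powr - \<rho>)"
proof -
  have lt: "2 powr - \<rho> < 1" using assms by (simp add: powr_less_one)
  have "(\<Sum>j\<le>J. 2 powr (- \<rho> * real j)) = (\<Sum>j\<le>J. (2 powr - \<rho>) ^ j)"
    by (intro sum.cong refl) (simp add: powr_powr flip: powr_realpow)
  also have "\<dots> \<le> (\<Sum>j. (2 powr - \<rho>) ^ j)"
    using lt by (intro sum_le_suminf summable_geometric) auto
  also have "\<dots> = 1 / (1 - 2 powr - \<rho>)"
    using lt by (intro suminf_geometric) simp
  finally show ?thesis .
qed

text \<open>Takes the place of the triangle inequality in L^2: squares of the summands can be
  majorised pointwise, one shell at a time.\<close>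

lemma weighted_sum_squared_le:
  fixes u w :: "nat \<Rightarrow> real"
  assumes "\<And>j. w j > 0"
  shows "(\<Sum>j\<in>I. u j)\<^sup>2 \<le> (\<Sum>j\<in>I. w j) * (\<Sum>j\<in>I. (u j)\<^sup>2 / w j)"
proof -
  have "(\<Sum>j\<in>I. u j)\<^sup>2 = (\<Sum>j\<in>I. sqrt (w j) * (u j / sqrt (w j)))\<^sup>2"
    using assms by (simp add: less_imp_neq[THEN not_sym])
  also have "\<dots> \<le> (\<Sum>j\<in>I. (sqrt (w j))\<^sup>2) * (\<Sum>j\<in>I. (u j / sqrt (w j))\<^sup>2)"
    by (rule Cauchy_Schwarz_ineq_sum)
  also have "\<dots> = (\<Sum>j\<in>I. w j) * (\<Sum>j\<in>I. (u j)\<^sup>2 / w j)"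
    using assms[THEN less_imp_le] by (simp add: power_divide)
  finally show ?thesis .
qed

text \<open>The norm on the right is that of the whole polynomial, whereas the factor in front
  depends on j and not on J. L \<ge> 1 removes the power of L, and 9 bounds 3 to the power
  2/p.\<close>

lemma bernstein_int_cube:
  fixes \<alpha> :: "int ^ 'n \<Rightarrow> complex"
  assumes L: "L \<ge> 1" and p: "1 \<le> p" "p \<le> 2" and j: "j \<le> J"
  shows "(\<Sum>k\<in>int_cube (2 ^ j). (cmod (\<alpha> k))\<^sup>2) \<le>
    9 * 3 ^ CARD('n) * 2 powr (real CARD('n) * (2 / p - 1) * real j) *
    (LINT x|torus L. cmod (trig_sum L (int_cube (2 ^ J)) \<alpha> x) powr p) powr (2 / p)"
proof -
  let ?B = "int_cube (2 ^ j) :: (int ^ 'n) set"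
  define I where "I = (LINT x|torus L. cmod (trig_sum L (int_cube (2 ^ J)) \<alpha> x) powr p)"
  have I: "I \<ge> 0" unfolding I_def by (intro Bochner_Integration.integral_nonneg) simp
  have L0: "L > 0" using L by simp
  have e: "0 \<le> 2 / p - 1" "2 / p - 1 \<le> 1" "2 / p \<le> 2" using p by (auto simp: field_simps)
  have "(\<Sum>k\<in>?B. (cmod (\<alpha> k))\<^sup>2) \<le> (3 / L ^ CARD('n) * I) powr (2 / p) * real (card ?B) powr (2 / p - 1)"
    unfolding I_def
    by (rule bernstein_trig_sum[OF L0 p]) (use j in \<open>auto intro!: int_cube_mono\<close>)
  also have "\<dots> \<le> (9 * I powr (2 / p)) * (3 ^ CARD('n) * 2 powr (real CARD('n) * (2 / p - 1) * real j))"
  proof (intro mult_mono)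
    have "3 / L ^ CARD('n) \<le> 3" using L by (simp add: field_simps one_le_power)
    then have "(3 / L ^ CARD('n)) powr (2 / p) \<le> 3 powr (2 / p)"
      using p L by (intro powr_mono2) auto
    also have "\<dots> \<le> 3 powr 2" using e by (intro powr_mono) auto
    finally have "(3 / L ^ CARD('n)) powr (2 / p) \<le> 9" by simp
    then show "(3 / L ^ CARD('n) * I) powr (2 / p) \<le> 9 * I powr (2 / p)"
      using I L by (subst powr_mult) (auto intro: mult_right_mono)
    have "real (card ?B) powr (2 / p - 1) \<le> (3 ^ CARD('n) * 2 powr (real CARD('n) * real j)) powr (2 / p - 1)"
      using e card_int_cube_pow2_le by (intro powr_mono2) auto
    also have "\<dots> = (3 ^ CARD('n)) powr (2 / p - 1) * 2 powr (real CARD('n) * (2 / p - 1) * real j)"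
      by (subst powr_mult) (auto simp: powr_powr mult_ac)
    also have "(3 ^ CARD('n)) powr (2 / p - 1) \<le> (3 ^ CARD('n)) powr 1"
      using e by (intro powr_mono) auto
    finally show "real (card ?B) powr (2 / p - 1) \<le> 3 ^ CARD('n) * 2 powr (real CARD('n) * (2 / p - 1) * real j)"
      by simp
  qed auto
  finally show ?thesis by (simp add: I_def mult_ac)
qed

context decaying_measure
begin

text \<open>Bookkeeping of powers of 2^j for the squared L^2 norm: (1 + \<epsilon>)(\<beta> +
  \<epsilon>) from the number of intervals, -2a from the decay, d from Cauchy--Schwarz, and s from
  the two Bernstein inequalities. The strict inequality for p and q leaves room for a total of
  -\<rho>.\<close>

lemma shell_estimate:
  assumes L: "L \<ge> 1" and E: "E \<subseteq> {1..2}" and dim: "upper_minkowski_dim E = ereal \<beta>"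
    and p: "1 \<le> p" "p \<le> 2" and q: "1 \<le> q" "q \<le> 2"
    and gap: "1 / p + 1 / q < 1 / 2 + (2 * a - \<beta>) / (2 * real CARD('n))"
  shows "\<exists>\<rho>>0. \<exists>M\<ge>0. \<forall>J. \<forall>j\<le>J. \<forall>\<alpha> \<gamma>. \<exists>G. continuous_on UNIV G \<and> (\<forall>x. 0 \<le> G x) \<and>
    (\<forall>t\<in>E. \<forall>x. (cmod (piece L \<alpha> \<gamma> (shell j) t x))\<^sup>2 \<le> G x) \<and>
    (LINT x|torus L. G x) \<le> M * 2 powr (- \<rho> * real j) *
      ((LINT x|torus L. cmod (trig_sum L (int_cube (2 ^ J)) \<alpha> x) powr p) powr (2 / p) *
       (LINT x|torus L. cmod (trig_sum L (int_cube (2 ^ J)) \<gamma> x) powr q) powr (2 / q))"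
proof -
  define d where "d = real CARD('n)"
  define s where "s = d * (2 / p - 1) + d * (2 / q - 1)"
  have d: "d > 0" by (simp add: d_def)
  \<comment> \<open>Multiplied by 2d, the hypothesis becomes \<beta> < 2a - d - s.\<close>
  have "2 * d * (1 / p + 1 / q) < 2 * d * (1 / 2 + (2 * a - \<beta>) / (2 * d))"
    using gap d by (intro mult_strict_left_mono) (auto simp: d_def)
  then have "2 * d / p + 2 * d / q < d + (2 * a - \<beta>)"
    using d by (simp add: distrib_left)
  then have "\<beta> < 2 * a - d - s" by (simp add: s_def algebra_simps)
  then obtain \<epsilon> where \<epsilon>: "\<epsilon> > 0" "(1 + \<epsilon>) * (\<beta> + \<epsilon>) < 2 * a - d - s"
    using exists_loss_parameter by blast
  define \<rho> where "\<rho> = 2 * a - d - s - (1 + \<epsilon>) * (\<beta> + \<epsilon>)"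
  have \<rho>: "\<rho> > 0" using \<epsilon> by (simp add: \<rho>_def)
  \<comment> \<open>The remainder carries the exponent 2d + s - 2K\<epsilon>: twice d for the crude
    count of pairs, s from Bernstein, and a gain of 2\<epsilon> for each order of interpolation.
    \<open>K\<close> makes this at most -\<rho>.\<close>
  obtain K :: nat where K: "(2 * d + s + \<rho>) / (2 * \<epsilon>) \<le> real K"
    using real_arch_simple by blast
  then have K': "2 * d + s - 2 * real K * \<epsilon> \<le> - \<rho>"
    using \<epsilon> by (simp add: pos_divide_le_eq algebra_simps)
  obtain \<delta>' where \<delta>': "\<delta>' > 0" "\<And>\<delta>. 0 < \<delta> \<Longrightarrow> \<delta> < \<delta>' \<Longrightarrow>
    (\<exists>S. finite S \<and> E \<subseteq> (\<Union>c\<in>S. {c..c + \<delta>}) \<and> (\<forall>c\<in>S. 1 / 2 \<le> c) \<and> real (card S) \<le> \<delta> powr - (\<beta> + \<epsilon>))"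
    using Minkowski_cover[OF E dim \<epsilon>(1)] by auto
  define o' where "o' = osc L"
  have o': "o' > 0" unfolding o'_def osc_def using L R by simp
  \<comment> \<open>The first bound makes the covering estimate applicable, the second keeps the
    phase increments within the 1/2 required by \<open>newton_cis\<close>.\<close>
  define \<delta>0 where "\<delta>0 = min (\<delta>' / 2) (1 / (2 * o'))"
  have \<delta>0: "\<delta>0 > 0" "\<delta>0 < \<delta>'" "o' * \<delta>0 \<le> 1 / 2"
    using \<delta>' o' by (auto simp: \<delta>0_def min_def field_simps)
  define m where "m = measure \<mu> UNIV"
  define A1 where "A1 = 2 * 4 ^ K * (real K)\<^sup>2 * \<delta>0 powr - (\<beta> + \<epsilon>) * C\<^sup>2 * (4 * L) powr (2 * a)"
  define A2 where "A2 = 8 * m\<^sup>2 * 3 ^ CARD('n)"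
  define M where "M = L ^ CARD('n) * (A1 + A2) * 3 ^ CARD('n) * (9 * 3 ^ CARD('n)) * (9 * 3 ^ CARD('n))"
  have A: "A1 \<ge> 0" "A2 \<ge> 0" using C by (auto simp: A1_def A2_def)
  have M: "M \<ge> 0" unfolding M_def using A L by (intro mult_nonneg_nonneg) auto
  have main: "\<exists>G. continuous_on UNIV G \<and> (\<forall>x. 0 \<le> G x) \<and>
    (\<forall>t\<in>E. \<forall>x. (cmod (piece L \<alpha> \<gamma> (shell j) t x))\<^sup>2 \<le> G x) \<and>
    (LINT x|torus L. G x) \<le> M * 2 powr (- \<rho> * real j) * (X * Y)"
    if j: "j \<le> J"
      and X: "X = (LINT x|torus L. cmod (trig_sum L (int_cube (2 ^ J)) \<alpha> x) powr p) powr (2 / p)"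
      and Y: "Y = (LINT x|torus L. cmod (trig_sum L (int_cube (2 ^ J)) \<gamma> x) powr q) powr (2 / q)"
    for j J \<alpha> \<gamma> X Y
  proof -
    \<comment> \<open>Everything is written as a power of 2^j with a real exponent, so that the
      estimates become comparisons of exponents.\<close>
    define r where "r = (\<lambda>x::real. 2 powr (x * real j))"
    have r0: "r x > 0" for x by (simp add: r_def)
    have radd: "r x * r y = r (x + y)" for x y by (simp add: r_def powr_add[symmetric] distrib_right)
    have rmono: "r x \<le> r y" if "x \<le> y" for x y
      unfolding r_def using that by (intro powr_mono mult_right_mono) auto
    have r1: "2 ^ j = r 1" by (simp add: r_def powr_realpow)
    have rpow: "r x ^ n = r (x * real n)" for x n
      unfolding r_def by (simp add: powr_powr mult_ac flip: powr_realpow)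
    have rpowr: "r x powr y = r (x * y)" for x y
      unfolding r_def by (simp add: powr_powr mult_ac)
    define \<delta> where "\<delta> = \<delta>0 * r (- (1 + \<epsilon>))"
    have "r (- (1 + \<epsilon>)) \<le> r 0" using \<epsilon> by (intro rmono) simp
    then have "\<delta> \<le> \<delta>0" using \<delta>0 by (simp add: \<delta>_def r_def mult_left_le)
    then have "\<delta> < \<delta>'" using \<delta>0(2) by linarith
    moreover have "\<delta> > 0" using \<delta>0(1) r0[of "- (1 + \<epsilon>)"] by (simp add: \<delta>_def)
    ultimately have \<delta>: "\<delta> > 0" "\<delta> < \<delta>'" by auto
    have osc: "osc L * \<delta> * 2 ^ j = o' * \<delta>0 * r (- \<epsilon>)"
      using radd[of "- (1 + \<epsilon>)" 1] by (simp add: \<delta>_def r1 o'_def mult_ac)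
    have "r (- \<epsilon>) \<le> r 0" using \<epsilon> by (intro rmono) simp
    then have "r (- \<epsilon>) \<le> 1" by (simp add: r_def)
    then have "o' * \<delta>0 * r (- \<epsilon>) \<le> 1 / 2 * 1"
      using \<delta>0 r0[of "- \<epsilon>"] o' by (intro mult_mono) auto
    then have small: "osc L * \<delta> * 2 ^ j \<le> 1 / 2" using osc by simp
    have small2: "osc L * \<delta> * 2 ^ j \<le> r (- \<epsilon>)" unfolding osc using \<delta>0 r0[of "- \<epsilon>"] by (simp add: mult_right_le_one_le)
    have pos: "0 \<le> osc L * \<delta> * 2 ^ j" unfolding osc using \<delta>0 o' r0[of "- \<epsilon>"] by simp
    obtain Sc where Sc: "finite Sc" "E \<subseteq> (\<Union>c\<in>Sc. {c..c + \<delta>})" "\<And>c. c \<in> Sc \<Longrightarrow> 1 / 2 \<le> c"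
      "real (card Sc) \<le> \<delta> powr - (\<beta> + \<epsilon>)"
      using \<delta>'(2)[OF \<delta>] by auto
    define B where "B = (int_cube (2 ^ j) :: (int ^ 'n) set)"
    obtain G where G: "continuous_on UNIV G" "\<forall>x. 0 \<le> G x"
      "\<forall>t\<in>E. \<forall>x. (cmod (piece L \<alpha> \<gamma> (shell j) t x))\<^sup>2 \<le> G x"
      and Gint: "(LINT x|torus L. G x) \<le> L ^ CARD('n) *
      (2 * 4 ^ K * (real K)\<^sup>2 * real (card Sc) * C\<^sup>2 * (2 ^ j / (4 * L)) powr (- 2 * a)
        + 8 * (osc L * \<delta> * 2 ^ j) ^ (2 * K) * (measure \<mu> UNIV)\<^sup>2 * real (card B)) * real (card B) *
      (\<Sum>k\<in>B. (cmod (\<alpha> k))\<^sup>2) * (\<Sum>l\<in>B. (cmod (\<gamma> l))\<^sup>2)"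
      using piece_majorant[OF L \<delta>(1) small B_def Sc(1-3)] by metis
    have cardB: "real (card B) \<le> 3 ^ CARD('n) * r d"
      using card_int_cube_pow2_le[of j, where 'n='n] by (simp add: B_def r_def d_def)
    have DX: "(\<Sum>k\<in>B. (cmod (\<alpha> k))\<^sup>2) \<le> 9 * 3 ^ CARD('n) * r (d * (2 / p - 1)) * X"
      using bernstein_int_cube[OF L p j, of \<alpha>] by (simp add: B_def r_def d_def X)
    have DY: "(\<Sum>k\<in>B. (cmod (\<gamma> k))\<^sup>2) \<le> 9 * 3 ^ CARD('n) * r (d * (2 / q - 1)) * Y"
      using bernstein_int_cube[OF L q j, of \<gamma>] by (simp add: B_def r_def d_def Y)
    have X0: "X \<ge> 0" "Y \<ge> 0" by (simp_all add: X Y)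
    have card: "real (card Sc) \<le> \<delta>0 powr - (\<beta> + \<epsilon>) * r ((1 + \<epsilon>) * (\<beta> + \<epsilon>))"
    proof -
      have "\<delta> powr - (\<beta> + \<epsilon>) = \<delta>0 powr - (\<beta> + \<epsilon>) * r (- (1 + \<epsilon>)) powr - (\<beta> + \<epsilon>)"
        unfolding \<delta>_def by (rule powr_mult)
      also have "r (- (1 + \<epsilon>)) powr - (\<beta> + \<epsilon>) = r ((1 + \<epsilon>) * (\<beta> + \<epsilon>))"
        by (simp add: rpowr algebra_simps)
      finally show ?thesis using Sc(4) by simp
    qed
    have dec: "(2 ^ j / (4 * L)) powr (- 2 * a) = (4 * L) powr (2 * a) * r (- 2 * a)"
    proof -
      have "(2 ^ j / (4 * L)) powr (- 2 * a) = r 1 powr (- 2 * a) / (4 * L) powr (- 2 * a)"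
        unfolding r1 by (rule powr_divide)
      also have "r 1 powr (- 2 * a) = r (- 2 * a)" by (simp add: rpowr)
      also have "(4 * L) powr (- 2 * a) = 1 / (4 * L) powr (2 * a)"
        by (simp add: powr_minus_divide)
      finally show ?thesis by simp
    qed
    have T1: "2 * 4 ^ K * (real K)\<^sup>2 * real (card Sc) * C\<^sup>2 * (2 ^ j / (4 * L)) powr (- 2 * a)
        \<le> A1 * r ((1 + \<epsilon>) * (\<beta> + \<epsilon>) - 2 * a)"
    proof -
      have "2 * 4 ^ K * (real K)\<^sup>2 * real (card Sc) * C\<^sup>2 * (2 ^ j / (4 * L)) powr (- 2 * a)
        \<le> 2 * 4 ^ K * (real K)\<^sup>2 * (\<delta>0 powr - (\<beta> + \<epsilon>) * r ((1 + \<epsilon>) * (\<beta> + \<epsilon>))) * C\<^sup>2 * ((4 * L) powr (2 * a) * r (- 2 * a))"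
        unfolding dec using r0[of "- 2 * a"] by (intro mult_right_mono mult_left_mono card) auto
      also have "\<dots> = A1 * (r ((1 + \<epsilon>) * (\<beta> + \<epsilon>)) * r (- 2 * a))"
        by (simp add: A1_def mult_ac)
      finally show ?thesis by (simp add: radd)
    qed
    have T2: "8 * (osc L * \<delta> * 2 ^ j) ^ (2 * K) * (measure \<mu> UNIV)\<^sup>2 * real (card B) \<le> A2 * r (d - 2 * real K * \<epsilon>)"
    proof -
      have "8 * (osc L * \<delta> * 2 ^ j) ^ (2 * K) * (measure \<mu> UNIV)\<^sup>2 * real (card B)
          \<le> 8 * r (- \<epsilon>) ^ (2 * K) * (measure \<mu> UNIV)\<^sup>2 * (3 ^ CARD('n) * r d)"
        using small2 pos r0[of "- \<epsilon>"] cardB by (intro mult_mono power_mono) auto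
      also have "\<dots> = A2 * (r (- \<epsilon> * real (2 * K)) * r d)"
        by (simp add: A2_def m_def rpow mult_ac)
      also have "r (- \<epsilon> * real (2 * K)) * r d = r (d - 2 * real K * \<epsilon>)"
        unfolding radd by (rule arg_cong[of _ _ r]) (simp add: algebra_simps)
      finally show ?thesis .
    qed
    have T: "2 * 4 ^ K * (real K)\<^sup>2 * real (card Sc) * C\<^sup>2 * (2 ^ j / (4 * L)) powr (- 2 * a)
        + 8 * (osc L * \<delta> * 2 ^ j) ^ (2 * K) * (measure \<mu> UNIV)\<^sup>2 * real (card B) \<le> (A1 + A2) * r (- \<rho> - d - s)"
    proof -
      have "(1 + \<epsilon>) * (\<beta> + \<epsilon>) - 2 * a = - \<rho> - d - s" by (simp add: \<rho>_def)
      moreover have "r (d - 2 * real K * \<epsilon>) \<le> r (- \<rho> - d - s)" using K' by (intro rmono) simp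
      ultimately show ?thesis
        using T1 T2 mult_left_mono[OF _ A(2), of "r (d - 2 * real K * \<epsilon>)" "r (- \<rho> - d - s)"]
        by (simp add: distrib_right)
    qed
    have "(LINT x|torus L. G x) \<le> L ^ CARD('n) * ((A1 + A2) * r (- \<rho> - d - s)) * (3 ^ CARD('n) * r d)
        * (9 * 3 ^ CARD('n) * r (d * (2 / p - 1)) * X) * (9 * 3 ^ CARD('n) * r (d * (2 / q - 1)) * Y)"
      using A L r0 X0
      by (intro order_trans[OF Gint] mult_mono T cardB DX DY order_refl)
         (auto intro!: mult_nonneg_nonneg sum_nonneg add_nonneg_nonneg simp: less_imp_le pos)
    also have "\<dots> = M * (r (- \<rho> - d - s) * r d * r (d * (2 / p - 1)) * r (d * (2 / q - 1))) * (X * Y)"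
      by (simp add: M_def mult_ac)
    also have "r (- \<rho> - d - s) * r d * r (d * (2 / p - 1)) * r (d * (2 / q - 1)) = r (- \<rho>)"
      unfolding radd by (rule arg_cong[of _ _ r]) (simp add: s_def)
    finally show ?thesis using G unfolding r_def by blast
  qed
  show ?thesis using \<rho> M main by blast
qed

text \<open>The rate \<rho> is halved: \<open>w j\<close>, with rate \<rho>/2, is the
  Cauchy--Schwarz weight, and dividing by it still leaves decay at rate \<rho>/2. Both sums over j
  are bounded by the same geometric series \<open>W\<close>, whatever the degree.\<close>

lemma trig_maximal:
  assumes L: "L \<ge> 1" and E: "E \<subseteq> {1..2}" and dim: "upper_minkowski_dim E = ereal \<beta>"
    and p: "1 \<le> p" "p \<le> 2" and q: "1 \<le> q" "q \<le> 2"
    and gap: "1 / p + 1 / q < 1 / 2 + (2 * a - \<beta>) / (2 * real CARD('n))"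
  shows "\<exists>M\<ge>0. \<forall>F G \<alpha> \<gamma>. finite F \<and> finite G \<longrightarrow>
    (\<exists>H. continuous_on UNIV H \<and> (\<forall>x. 0 \<le> H x) \<and>
    (\<forall>t\<in>E. \<forall>x. (cmod (bilinear_average \<mu> (trig_sum L F \<alpha>) (trig_sum L G \<gamma>) t x))\<^sup>2 \<le> H x) \<and>
    (LINT x|torus L. H x) \<le> M *
      ((LINT x|torus L. cmod (trig_sum L F \<alpha> x) powr p) powr (2 / p) *
       (LINT x|torus L. cmod (trig_sum L G \<gamma> x) powr q) powr (2 / q)))"
proof -
  obtain \<rho> M where \<rho>: "\<rho> > 0" and M: "M \<ge> 0" and est: "\<forall>J. \<forall>j\<le>J. \<forall>\<alpha> \<gamma>. \<exists>G. continuous_on UNIV G \<and> (\<forall>x. 0 \<le> G x) \<and>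
    (\<forall>t\<in>E. \<forall>x. (cmod (piece L \<alpha> \<gamma> (shell j) t x))\<^sup>2 \<le> G x) \<and>
    (LINT x|torus L. G x) \<le> M * 2 powr (- \<rho> * real j) *
      ((LINT x|torus L. cmod (trig_sum L (int_cube (2 ^ J)) \<alpha> x) powr p) powr (2 / p) *
       (LINT x|torus L. cmod (trig_sum L (int_cube (2 ^ J)) \<gamma> x) powr q) powr (2 / q))"
    using shell_estimate[OF L E dim p q gap] by auto
  define w where "w = (\<lambda>j::nat. 2 powr (- (\<rho> / 2) * real j))"
  define W where "W = 1 / (1 - 2 powr - (\<rho> / 2))"
  have w0: "w j > 0" for j by (simp add: w_def)
  have wW: "(\<Sum>j\<le>J. w j) \<le> W" for J unfolding w_def W_def using \<rho> by (intro sum_pow2_le) simp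
  have W0: "W \<ge> 0" using wW[of 0] w0[of 0] by simp
  have "\<exists>H. continuous_on UNIV H \<and> (\<forall>x. 0 \<le> H x) \<and>
    (\<forall>t\<in>E. \<forall>x. (cmod (bilinear_average \<mu> (trig_sum L F \<alpha>0) (trig_sum L G \<gamma>0) t x))\<^sup>2 \<le> H x) \<and>
    (LINT x|torus L. H x) \<le> W\<^sup>2 * M *
      ((LINT x|torus L. cmod (trig_sum L F \<alpha>0 x) powr p) powr (2 / p) *
       (LINT x|torus L. cmod (trig_sum L G \<gamma>0 x) powr q) powr (2 / q))"
    if F: "finite F" and G: "finite G" for F G \<alpha>0 \<gamma>0
  proof -
    \<comment> \<open>Extending the coefficients by zero puts both sums on one dyadic cube without
      changing the functions, hence without changing their norms.\<close>
    define \<alpha> where "\<alpha> = (\<lambda>k. if k \<in> F then \<alpha>0 k else 0)"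
    define \<gamma> where "\<gamma> = (\<lambda>k. if k \<in> G then \<gamma>0 k else 0)"
    obtain N where N: "\<And>M. M \<ge> N \<Longrightarrow> F \<union> G \<subseteq> int_cube M"
      using finite_subset_int_cube[of "F \<union> G"] F G by auto
    define J where "J = N"
    have "N \<le> 2 ^ J" unfolding J_def by (rule less_imp_le[OF less_exp])
    then have sub: "F \<subseteq> int_cube (2 ^ J)" "G \<subseteq> int_cube (2 ^ J)" using N[of "2 ^ J"] by auto
    have PF: "trig_sum L F \<alpha>0 = trig_sum L (int_cube (2 ^ J)) \<alpha>"
    proof
      fix x show "trig_sum L F \<alpha>0 x = trig_sum L (int_cube (2 ^ J)) \<alpha> x"
        unfolding trig_sum_def by (rule sum.mono_neutral_cong_left) (use sub in \<open>auto simp: \<alpha>_def\<close>)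
    qed
    have PG: "trig_sum L G \<gamma>0 = trig_sum L (int_cube (2 ^ J)) \<gamma>"
    proof
      fix x show "trig_sum L G \<gamma>0 x = trig_sum L (int_cube (2 ^ J)) \<gamma> x"
        unfolding trig_sum_def by (rule sum.mono_neutral_cong_left) (use sub in \<open>auto simp: \<gamma>_def\<close>)
    qed
    define X where "X = (LINT x|torus L. cmod (trig_sum L (int_cube (2 ^ J)) \<alpha> x) powr p) powr (2 / p) *
       (LINT x|torus L. cmod (trig_sum L (int_cube (2 ^ J)) \<gamma> x) powr q) powr (2 / q)"
    have X0: "X \<ge> 0" by (simp add: X_def)
    have "\<forall>j. \<exists>Gj. j \<le> J \<longrightarrow> continuous_on UNIV Gj \<and> (\<forall>x. 0 \<le> Gj x) \<and>
      (\<forall>t\<in>E. \<forall>x. (cmod (piece L \<alpha> \<gamma> (shell j) t x))\<^sup>2 \<le> Gj x) \<and>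
      (LINT x|torus L. Gj x) \<le> M * 2 powr (- \<rho> * real j) * X"
      using est unfolding X_def by blast
    then obtain Gm where "\<forall>j. j \<le> J \<longrightarrow> continuous_on UNIV (Gm j) \<and> (\<forall>x. 0 \<le> Gm j x) \<and>
      (\<forall>t\<in>E. \<forall>x. (cmod (piece L \<alpha> \<gamma> (shell j) t x))\<^sup>2 \<le> Gm j x) \<and>
      (LINT x|torus L. Gm j x) \<le> M * 2 powr (- \<rho> * real j) * X"
      using choice[of "\<lambda>j Gj. j \<le> J \<longrightarrow> continuous_on UNIV Gj \<and> (\<forall>x. 0 \<le> Gj x) \<and>
      (\<forall>t\<in>E. \<forall>x. (cmod (piece L \<alpha> \<gamma> (shell j) t x))\<^sup>2 \<le> Gj x) \<and>
      (LINT x|torus L. Gj x) \<le> M * 2 powr (- \<rho> * real j) * X"] by blast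
    then have Gc: "j \<le> J \<Longrightarrow> continuous_on UNIV (Gm j)"
      and G0: "j \<le> J \<Longrightarrow> 0 \<le> Gm j x"
      and Gb: "j \<le> J \<Longrightarrow> t \<in> E \<Longrightarrow> (cmod (piece L \<alpha> \<gamma> (shell j) t x))\<^sup>2 \<le> Gm j x"
      and Gi: "j \<le> J \<Longrightarrow> (LINT x|torus L. Gm j x) \<le> M * 2 powr (- \<rho> * real j) * X" for j t x
      by blast+
    define H where "H = (\<lambda>x. W * (\<Sum>j\<le>J. Gm j x / w j))"
    have Hc: "continuous_on UNIV H"
      unfolding H_def using w0 by (intro continuous_intros Gc) (auto simp: less_imp_neq[THEN not_sym])
    have H0: "0 \<le> H x" for x
      unfolding H_def using W0 w0 G0 by (intro mult_nonneg_nonneg sum_nonneg divide_nonneg_pos) auto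
    have Hb: "(cmod (bilinear_average \<mu> (trig_sum L F \<alpha>0) (trig_sum L G \<gamma>0) t x))\<^sup>2 \<le> H x" if t: "t \<in> E" for t x
    proof -
      have "bilinear_average \<mu> (trig_sum L F \<alpha>0) (trig_sum L G \<gamma>0) t x = (\<Sum>j\<le>J. piece L \<alpha> \<gamma> (shell j) t x)"
        unfolding PF PG piece_def
        by (subst bilinear_average_trig_sum[OF finite_int_cube finite_int_cube]) (rule sum_shells)
      then have "cmod (bilinear_average \<mu> (trig_sum L F \<alpha>0) (trig_sum L G \<gamma>0) t x) \<le> (\<Sum>j\<le>J. cmod (piece L \<alpha> \<gamma> (shell j) t x))"
        by (simp add: norm_sum)
      then have "(cmod (bilinear_average \<mu> (trig_sum L F \<alpha>0) (trig_sum L G \<gamma>0) t x))\<^sup>2 \<le> (\<Sum>j\<le>J. cmod (piece L \<alpha> \<gamma> (shell j) t x))\<^sup>2"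
        by (intro power_mono) auto
      also have "\<dots> \<le> (\<Sum>j\<le>J. w j) * (\<Sum>j\<le>J. (cmod (piece L \<alpha> \<gamma> (shell j) t x))\<^sup>2 / w j)"
        by (rule weighted_sum_squared_le[OF w0])
      also have "\<dots> \<le> W * (\<Sum>j\<le>J. Gm j x / w j)"
        using t wW W0 w0 by (intro mult_mono sum_mono divide_right_mono Gb) (auto intro!: sum_nonneg simp: less_imp_le)
      finally show ?thesis unfolding H_def .
    qed
    have "(LINT x|torus L. H x) = W * (\<Sum>j\<le>J. (LINT x|torus L. Gm j x) / w j)"
      unfolding H_def using integrable_torus_continuous[OF Gc]
      by (simp add: Bochner_Integration.integral_sum)
    also have "\<dots> \<le> W * (\<Sum>j\<le>J. w j * (M * X))"
    proof (intro mult_left_mono[OF _ W0] sum_mono)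
      fix j assume "j \<in> {..J}"
      then have "(LINT x|torus L. Gm j x) / w j \<le> M * 2 powr (- \<rho> * real j) * X / w j"
        using w0 by (intro divide_right_mono Gi) (auto simp: less_imp_le)
      also have "2 powr (- \<rho> * real j) = w j * w j"
        by (simp add: w_def powr_add[symmetric])
      finally show "(LINT x|torus L. Gm j x) / w j \<le> w j * (M * X)"
        using w0[of j] by (simp add: mult_ac)
    qed
    also have "\<dots> = W * ((\<Sum>j\<le>J. w j) * (M * X))" by (simp add: sum_distrib_right)
    also have "\<dots> \<le> W * (W * (M * X))"
      using W0 M X0 wW by (intro mult_left_mono mult_right_mono) auto
    also have "\<dots> = W\<^sup>2 * M * X" by (simp add: power2_eq_square)
    finally show ?thesis
      using Hc H0 Hb unfolding X_def PF PG by blast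
  qed
  then show ?thesis using M by (intro exI[of _ "W\<^sup>2 * M"]) auto
qed

end

section \<open>Density of trigonometric polynomials\<close>

definition trig_poly :: "real \<Rightarrow> (real ^ 'n \<Rightarrow> complex) \<Rightarrow> bool" where
  "trig_poly L P \<longleftrightarrow> (\<exists>F a. finite F \<and> P = trig_sum L F a)"

lemma trig_poly_wave: "trig_poly L (\<lambda>x. c * wave L k x)"
  unfolding trig_poly_def
  by (rule exI[of _ "{k}"], rule exI[of _ "\<lambda>_. c"]) (auto simp: trig_sum_def fun_eq_iff)

lemma trig_poly_const: "trig_poly L (\<lambda>x. c)"
  using trig_poly_wave[of L c 0] by simp

lemma trig_poly_add:
  assumes "trig_poly L P" "trig_poly L Q"
  shows "trig_poly L (\<lambda>x. P x + Q x)"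
proof -
  obtain F a G b where F: "finite F" "P = trig_sum L F a" and G: "finite G" "Q = trig_sum L G b"
    using assms unfolding trig_poly_def by metis
  have "P x + Q x = trig_sum L (F \<union> G) (\<lambda>k. (if k \<in> F then a k else 0) + (if k \<in> G then b k else 0)) x" for x
  proof -
    have "P x = (\<Sum>k\<in>F \<union> G. (if k \<in> F then a k else 0) * wave L k x)"
      unfolding F trig_sum_def by (rule sum.mono_neutral_cong_left) (use F G in auto)
    moreover have "Q x = (\<Sum>k\<in>F \<union> G. (if k \<in> G then b k else 0) * wave L k x)"
      unfolding G trig_sum_def by (rule sum.mono_neutral_cong_left) (use F G in auto)
    ultimately show ?thesis
      unfolding trig_sum_def distrib_right sum.distrib by simp
  qed
  then show ?thesis unfolding trig_poly_def using F G by blast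
qed

lemma trig_poly_sum:
  assumes "\<And>i. i \<in> I \<Longrightarrow> trig_poly L (P i)"
  shows "trig_poly L (\<lambda>x. \<Sum>i\<in>I. P i x)"
  using assms by (induction I rule: infinite_finite_induct) (auto intro: trig_poly_const trig_poly_add)

lemma trig_poly_mult:
  assumes "trig_poly L P" "trig_poly L Q"
  shows "trig_poly L (\<lambda>x. P x * Q x)"
proof -
  obtain F a G b where F: "finite F" "P = trig_sum L F a" and G: "finite G" "Q = trig_sum L G b"
    using assms unfolding trig_poly_def by metis
  have "P x * Q x = (\<Sum>k\<in>F. \<Sum>l\<in>G. (a k * b l) * wave L (k + l) x)" for x
    unfolding F G trig_sum_def sum_product wave_add by (simp only: mult_ac)
  then show ?thesis by (simp only:) (intro trig_poly_sum trig_poly_wave)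
qed

text \<open>Places the torus inside a Euclidean space as a compact set, where ordinary polynomials
  restrict to trigonometric ones and Stone--Weierstrass applies.\<close>

definition circle_coords :: "real \<Rightarrow> real ^ 'n \<Rightarrow> complex ^ 'n" where
  "circle_coords L x = (\<chi> i. cis (2 * pi / L * x $ i))"

lemma circle_coords_wave: "circle_coords L x $ i = wave L (axis i 1) x"
proof -
  have "real_vec (axis i 1) = axis i 1"
    by (auto simp: real_vec_def vec_eq_iff axis_def)
  then show ?thesis by (simp add: circle_coords_def wave_def inner_axis')
qed

lemma cnj_circle_coords_wave: "cnj (circle_coords L x $ i) = wave L (- axis i 1) x"
  using wave_mult_cnj[of L 0 x "axis i 1"] by (simp add: circle_coords_wave)

text \<open>Real and imaginary parts of a coordinate are combinations of the waves with frequencies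
  plus and minus \<open>axis i 1\<close>; the rest is closure under sums and products.\<close>

lemma trig_poly_real_polynomial:
  fixes g :: "complex ^ 'n \<Rightarrow> real"
  assumes "real_polynomial_function g"
  shows "trig_poly L (\<lambda>x. complex_of_real (g (circle_coords L x)))"
  using assms
proof (induction rule: real_polynomial_function.induct)
  case (linear f)
  have coord: "trig_poly L (\<lambda>x. complex_of_real (circle_coords L x \<bullet> b))" if b0: "b \<in> Basis" for b
  proof -
    obtain i u where b: "b = axis i u" "u \<in> Basis" using b0 unfolding Basis_vec_def by blast
    have re: "trig_poly L (\<lambda>x. complex_of_real (Re (circle_coords L x $ i)))"
    proof -
      have "complex_of_real (Re (circle_coords L x $ i)) = 1 / 2 * wave L (axis i 1) x + 1 / 2 * wave L (- axis i 1) x" for x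
        unfolding circle_coords_wave[symmetric] cnj_circle_coords_wave[symmetric]
        by (simp add: complex_eq_iff)
      then show ?thesis by (simp only:) (intro trig_poly_add trig_poly_wave)
    qed
    have im: "trig_poly L (\<lambda>x. complex_of_real (Im (circle_coords L x $ i)))"
    proof -
      have "complex_of_real (Im (circle_coords L x $ i)) = (- \<i> / 2) * wave L (axis i 1) x + (\<i> / 2) * wave L (- axis i 1) x" for x
        unfolding circle_coords_wave[symmetric] cnj_circle_coords_wave[symmetric]
        by (simp add: complex_eq_iff)
      then show ?thesis by (simp only:) (intro trig_poly_add trig_poly_wave)
    qed
    show ?thesis
      using b(2) re im by (auto simp: b(1) inner_axis Basis_complex_def inner_complex_def)
  qed
  have "complex_of_real (f (circle_coords L x)) = (\<Sum>b\<in>Basis. complex_of_real (f b) * complex_of_real (circle_coords L x \<bullet> b))" for x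
  proof -
    interpret bounded_linear f by (rule linear)
    have "f (circle_coords L x) = f (\<Sum>b\<in>Basis. (circle_coords L x \<bullet> b) *\<^sub>R b)"
      by (simp only: euclidean_representation)
    also have "\<dots> = (\<Sum>b\<in>Basis. f b * (circle_coords L x \<bullet> b))"
      by (simp add: sum scaleR mult.commute)
    finally show ?thesis by simp
  qed
  then show ?case by (simp only:) (intro trig_poly_sum trig_poly_mult trig_poly_const coord)
next
  case (const c)
  then show ?case by (rule trig_poly_const)
next
  case (add f g)
  then show ?case by (simp add: trig_poly_add)
next
  case (mult f g)
  then show ?case by (simp add: trig_poly_mult)
qed

lemma continuous_on_circle_coords: "continuous_on S (circle_coords L :: real ^ 'n \<Rightarrow> complex ^ 'n)"
proof -
  have "(circle_coords L :: real ^ 'n \<Rightarrow> complex ^ 'n) = (\<lambda>x. \<chi> i. wave L (axis i 1) x)"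
    by (simp add: fun_eq_iff vec_eq_iff circle_coords_wave)
  then show ?thesis by (simp only:) (intro continuous_on_vec_lambda continuous_on_wave)
qed

text \<open>A continuous map from a compact set to a Hausdorff space is closed, hence a quotient map
  onto its image.\<close>

lemma continuous_on_factor:
  fixes \<Phi> :: "'a::t2_space \<Rightarrow> 'b::t2_space" and h :: "'a \<Rightarrow> 'c::topological_space"
  assumes S: "compact S" and \<Phi>: "continuous_on S \<Phi>" and h: "continuous_on S h"
    and g: "\<And>x. x \<in> S \<Longrightarrow> g (\<Phi> x) = h x"
  shows "continuous_on (\<Phi> ` S) g"
proof -
  have cl: "closed (\<Phi> ` S)" using S \<Phi> compact_continuous_image compact_imp_closed by blast
  have "closed (g -` B \<inter> \<Phi> ` S)" if B: "closed B" for B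
  proof -
    have "g -` B \<inter> \<Phi> ` S = \<Phi> ` (S \<inter> h -` B)" using g by auto
    moreover have "compact (S \<inter> h -` B)"
      using closed_vimage_Int[OF B] S h
      by (metis B compact_Int_closed compact_imp_closed continuous_on_closed_vimage inf.absorb_iff2 inf_commute inf_le2)
    ultimately show ?thesis
      using \<Phi> by (metis compact_continuous_image compact_imp_closed continuous_on_subset inf_le1)
  qed
  then show ?thesis using cl by (simp add: continuous_on_closed_vimage)
qed

text \<open>Vanishing on the faces makes \<open>f\<close> compatible with the identification of
  opposite faces, so it descends to a continuous function on the image of
  \<open>circle_coords\<close>.\<close>

lemma trig_poly_dense:
  fixes f :: "real ^ 'n \<Rightarrow> complex"
  assumes L: "L > 0" and f: "continuous_on UNIV f" and e: "e > 0"
    and bdry: "\<And>x i. \<bar>x $ i\<bar> \<ge> L / 2 \<Longrightarrow> f x = 0"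
  shows "\<exists>P. trig_poly L P \<and> (\<forall>x\<in>space (torus L). cmod (f x - P x) < e)"
proof -
  define T where "T = (cbox (\<chi> i. - L / 2) (\<chi> i. L / 2) :: (real ^ 'n) set)"
  have T: "x \<in> T \<longleftrightarrow> (\<forall>i. \<bar>x $ i\<bar> \<le> L / 2)" for x
  proof -
    have "\<bar>y\<bar> \<le> L / 2 \<longleftrightarrow> - L / 2 \<le> y \<and> y \<le> L / 2" for y by linarith
    then show ?thesis by (simp add: T_def mem_box_cart)
  qed
  \<comment> \<open>Two points of the cube with equal images and different i-th coordinates differ
    there by a nonzero multiple of L; this forces both onto faces, where \<open>f\<close> is
    0.\<close>
  have inj: "f x = f y" if x: "x \<in> T" and y: "y \<in> T" and eq: "circle_coords L x = circle_coords L y" for x y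
  proof (cases "x = y")
    case False
    then obtain i where i: "x $ i \<noteq> y $ i" by (auto simp: vec_eq_iff)
    have "cis (2 * pi / L * x $ i) = cis (2 * pi / L * y $ i)"
      using eq by (simp add: circle_coords_def vec_eq_iff)
    then obtain m :: int where "2 * pi / L * x $ i = 2 * pi / L * y $ i + 2 * pi * m"
      unfolding cis_conv_exp exp_eq by (auto simp: complex_eq_iff)
    then have "pi * (2 * (x $ i - y $ i - L * real_of_int m)) = 0" using L by (simp add: field_simps)
    then have m: "x $ i - y $ i = L * real_of_int m" by simp
    have "m \<noteq> 0" using m i by auto
    then have "1 \<le> \<bar>real_of_int m\<bar>" by linarith
    then have "L * 1 \<le> L * \<bar>real_of_int m\<bar>" using L by (intro mult_left_mono) auto
    then have "L \<le> \<bar>x $ i - y $ i\<bar>" using m L by (simp add: abs_mult)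
    moreover have "\<bar>x $ i\<bar> \<le> L / 2" "\<bar>y $ i\<bar> \<le> L / 2" using x y T by auto
    ultimately have "\<bar>x $ i\<bar> \<ge> L / 2" "\<bar>y $ i\<bar> \<ge> L / 2" by linarith+
    then show ?thesis using bdry by simp
  qed simp
  \<comment> \<open>Which preimage is chosen is immaterial by \<open>inj\<close>.\<close>
  define g where "g = (\<lambda>z. f (SOME x. x \<in> T \<and> circle_coords L x = z))"
  have g: "g (circle_coords L x) = f x" if "x \<in> T" for x
  proof -
    have "(SOME x'. x' \<in> T \<and> circle_coords L x' = circle_coords L x) \<in> T \<and>
      circle_coords L (SOME x'. x' \<in> T \<and> circle_coords L x' = circle_coords L x) = circle_coords L x"
      by (rule someI[of _ x]) (use that in auto)
    then show ?thesis unfolding g_def using inj that by blast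
  qed
  have cT: "compact T" by (simp add: T_def)
  have "continuous_on (circle_coords L ` T) g"
    by (rule continuous_on_factor[OF cT continuous_on_circle_coords continuous_on_subset[OF f] g]) auto
  moreover have "compact (circle_coords L ` T)"
    by (rule compact_continuous_image[OF continuous_on_circle_coords cT])
  ultimately obtain q where q: "polynomial_function q" "\<And>z. z \<in> circle_coords L ` T \<Longrightarrow> norm (g z - q z) < e"
    using Stone_Weierstrass_polynomial_function[of "circle_coords L ` T" g e] e by blast
  have "real_polynomial_function (\<lambda>x. q x \<bullet> 1)" "real_polynomial_function (\<lambda>x. q x \<bullet> \<i>)"
    using q(1) unfolding polynomial_function_iff_Basis_inner by (auto simp: Basis_complex_def)
  then have "real_polynomial_function (\<lambda>x. Re (q x))" "real_polynomial_function (\<lambda>x. Im (q x))"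
    by (simp_all add: inner_complex_def)
  then have "trig_poly L (\<lambda>x. complex_of_real (Re (q (circle_coords L x))) + \<i> * complex_of_real (Im (q (circle_coords L x))))"
    by (intro trig_poly_add trig_poly_mult trig_poly_const trig_poly_real_polynomial)
  then have "trig_poly L (\<lambda>x. q (circle_coords L x))"
    by (simp add: complex_eq[symmetric])
  moreover have "cmod (f x - q (circle_coords L x)) < e" if "x \<in> space (torus L)" for x
    using q(2)[of "circle_coords L x"] g[of x] that by (auto simp: space_torus T_def)
  ultimately show ?thesis by blast
qed

section \<open>The local estimate for continuous functions\<close>

lemma trig_poly_continuous: "trig_poly L P \<Longrightarrow> continuous_on S P"
  unfolding trig_poly_def using continuous_on_trig_sum by blast

lemma trig_poly_bounded:
  assumes "trig_poly L P"
  shows "\<exists>B. \<forall>x. cmod (P x) \<le> B"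
proof -
  obtain F a where F: "finite F" "P = trig_sum L F a" using assms by (auto simp: trig_poly_def)
  have "cmod (P x) \<le> (\<Sum>k\<in>F. cmod (a k))" for x
    unfolding F trig_sum_def by (rule order_trans[OF norm_sum]) (simp add: norm_mult)
  then show ?thesis by blast
qed

lemma bilinear_maximal_eq:
  "bilinear_maximal \<mu> E f g x = (SUP t\<in>E. cmod (bilinear_average \<mu> f g t x))"
  by (simp add: bilinear_maximal_def bilinear_average_def)

context decaying_measure
begin

lemma integrable_bilinear:
  assumes f: "continuous_on UNIV f" "\<And>x. cmod (f x) \<le> Bf" and g: "continuous_on UNIV g" "\<And>x. cmod (g x) \<le> Bg"
  shows "integrable \<mu> (\<lambda>w. f (x - t *\<^sub>R fst w) * g (x - t *\<^sub>R snd w))"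
proof (rule integrable_bounded_continuous[where B = "Bf * Bg"])
  show "continuous_on UNIV (\<lambda>w. f (x - t *\<^sub>R fst w) * g (x - t *\<^sub>R snd w))"
    by (intro continuous_intros continuous_on_compose2[OF f(1)] continuous_on_compose2[OF g(1)]) auto
  show "cmod (f (x - t *\<^sub>R fst w) * g (x - t *\<^sub>R snd w)) \<le> Bf * Bg" for w
    unfolding norm_mult using f(2) g(2) by (intro mult_mono) (auto intro: order_trans[OF norm_ge_zero])
qed

lemma bilinear_average_eq:
  "bilinear_average \<mu> f g t x = (LINT w|\<mu>. f (x - t *\<^sub>R fst w) * g (x - t *\<^sub>R snd w))"
  unfolding bilinear_average_def by (rule Bochner_Integration.integral_cong) auto

lemma norm_bilinear_average_le:
  assumes f: "continuous_on UNIV f" "\<And>x. cmod (f x) \<le> Bf" and g: "continuous_on UNIV g" "\<And>x. cmod (g x) \<le> Bg"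
  shows "cmod (bilinear_average \<mu> f g t x) \<le> Bf * Bg * measure \<mu> UNIV"
proof -
  have "cmod (bilinear_average \<mu> f g t x) \<le> (LINT w|\<mu>. cmod (f (x - t *\<^sub>R fst w) * g (x - t *\<^sub>R snd w)))"
    unfolding bilinear_average_eq by (rule integral_norm_bound)
  also have "\<dots> \<le> (LINT w|\<mu>. Bf * Bg)"
  proof (rule integral_mono)
    show "integrable \<mu> (\<lambda>w. cmod (f (x - t *\<^sub>R fst w) * g (x - t *\<^sub>R snd w)))"
      by (intro integrable_norm integrable_bilinear[OF f g])
    show "cmod (f (x - t *\<^sub>R fst w) * g (x - t *\<^sub>R snd w)) \<le> Bf * Bg" for w
      unfolding norm_mult using f(2) g(2) by (intro mult_mono) (auto intro: order_trans[OF norm_ge_zero])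
  qed simp
  finally show ?thesis by (simp add: space_eq mult_ac)
qed

lemma bdd_above_bilinear_average:
  assumes f: "continuous_on UNIV f" "\<And>x. cmod (f x) \<le> Bf" and g: "continuous_on UNIV g" "\<And>x. cmod (g x) \<le> Bg"
  shows "bdd_above ((\<lambda>t. cmod (bilinear_average \<mu> f g t x)) ` E)"
  using norm_bilinear_average_le[OF f g] by (intro bdd_aboveI2)

lemma continuous_on_bilinear_average:
  assumes f: "continuous_on UNIV f" "\<And>x. cmod (f x) \<le> Bf" and g: "continuous_on UNIV g" "\<And>x. cmod (g x) \<le> Bg"
  shows "continuous_on UNIV (bilinear_average \<mu> f g t)"
  unfolding continuous_on_sequentially
proof (intro allI ballI impI, elim conjE)
  fix u :: "nat \<Rightarrow> real ^ 'n" and x assume u: "u \<longlonglongrightarrow> x"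
  have cont: "isCont f y" "isCont g y" for y
    using f(1) g(1) by (simp_all add: continuous_on_eq_continuous_at)
  show "(bilinear_average \<mu> f g t \<circ> u) \<longlonglongrightarrow> bilinear_average \<mu> f g t x"
    unfolding o_def bilinear_average_eq
  proof (rule integral_dominated_convergence[where w = "\<lambda>_. Bf * Bg"])
    show "AE w in \<mu>. (\<lambda>n. f (u n - t *\<^sub>R fst w) * g (u n - t *\<^sub>R snd w)) \<longlonglongrightarrow> f (x - t *\<^sub>R fst w) * g (x - t *\<^sub>R snd w)"
      by (intro AE_I2 tendsto_intros isCont_tendsto_compose[OF cont(1)] isCont_tendsto_compose[OF cont(2)] u)
    show "AE w in \<mu>. cmod (f (u n - t *\<^sub>R fst w) * g (u n - t *\<^sub>R snd w)) \<le> Bf * Bg" for n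
      unfolding norm_mult using f(2) g(2) by (intro AE_I2 mult_mono) (auto intro: order_trans[OF norm_ge_zero])
    show "(\<lambda>w. f (u n - t *\<^sub>R fst w) * g (u n - t *\<^sub>R snd w)) \<in> borel_measurable \<mu>" for n
      using integrable_bilinear[OF f g] by (rule borel_measurable_integrable)
    show "(\<lambda>w. f (x - t *\<^sub>R fst w) * g (x - t *\<^sub>R snd w)) \<in> borel_measurable \<mu>"
      using integrable_bilinear[OF f g] by (rule borel_measurable_integrable)
  qed simp
qed

lemma bilinear_maximal_nonneg:
  assumes "E \<noteq> {}" and f: "continuous_on UNIV f" "\<And>x. cmod (f x) \<le> Bf" and g: "continuous_on UNIV g" "\<And>x. cmod (g x) \<le> Bg"
  shows "0 \<le> bilinear_maximal \<mu> E f g x"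
proof -
  obtain t where "t \<in> E" using assms by blast
  then have "cmod (bilinear_average \<mu> f g t x) \<le> bilinear_maximal \<mu> E f g x"
    unfolding bilinear_maximal_eq by (intro cSUP_upper bdd_above_bilinear_average[OF f g])
  then show ?thesis using norm_ge_zero order_trans by blast
qed

text \<open>\<open>E\<close> may be uncountable, so measurability cannot come from a countable
  supremum; instead the superlevel sets are unions of open sets.\<close>

lemma borel_measurable_bilinear_maximal:
  assumes "E \<noteq> {}" and f: "continuous_on UNIV f" "\<And>x. cmod (f x) \<le> Bf" and g: "continuous_on UNIV g" "\<And>x. cmod (g x) \<le> Bg"
  shows "bilinear_maximal \<mu> E f g \<in> borel_measurable borel"
proof (rule borel_measurableI_greater)
  fix y
  have "{x. y < bilinear_maximal \<mu> E f g x} = (\<Union>t\<in>E. {x. y < cmod (bilinear_average \<mu> f g t x)})"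
    unfolding bilinear_maximal_eq using less_cSUP_iff[OF assms(1) bdd_above_bilinear_average[OF f g]] by auto
  moreover have "open {x. y < cmod (bilinear_average \<mu> f g t x)}" for t
    by (rule open_Collect_less[OF continuous_on_const continuous_on_norm[OF continuous_on_bilinear_average[OF f g]]])
  ultimately have "open {x. y < bilinear_maximal \<mu> E f g x}" by auto
  then have "{x. y < bilinear_maximal \<mu> E f g x} \<in> sets borel" by (rule borel_open)
  then show "{x \<in> space borel. y < bilinear_maximal \<mu> E f g x} \<in> sets borel"
    unfolding space_borel by (simp only: UNIV_I simp_thms)
qed

text \<open>The approximating polynomials are close to \<open>f\<close> and \<open>g\<close> on the
  cube only, which is why all points x - t y must stay in it. Squaring main term plus error costs a
  factor 2, and the error then tends to zero.\<close>

lemma local_maximal: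
  fixes Q :: "(real ^ 'n) set"
  assumes L: "L \<ge> 1" and E: "E \<subseteq> {1..2}" "E \<noteq> {}" and dim: "upper_minkowski_dim E = ereal \<beta>"
    and p: "1 \<le> p" "p \<le> 2" and q: "1 \<le> q" "q \<le> 2"
    and gap: "1 / p + 1 / q < 1 / 2 + (2 * a - \<beta>) / (2 * real CARD('n))"
    and Q: "Q \<subseteq> space (torus L)"
      "\<And>x t y. x \<in> Q \<Longrightarrow> t \<in> E \<Longrightarrow> norm y \<le> R \<Longrightarrow> x - t *\<^sub>R y \<in> space (torus L)"
  shows "\<exists>M\<ge>0. \<forall>f g. continuous_on UNIV f \<and> continuous_on UNIV g \<and>
    (\<forall>x i. \<bar>x $ i\<bar> \<ge> L / 2 \<longrightarrow> f x = 0 \<and> g x = 0) \<longrightarrow>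
    (\<integral>\<^sup>+x. ennreal ((bilinear_maximal \<mu> E f g x)\<^sup>2) * indicator Q x \<partial>lborel) \<le>
    ennreal (M * ((LINT x|torus L. cmod (f x) powr p) powr (2 / p) * (LINT x|torus L. cmod (g x) powr q) powr (2 / q)))"
proof -
  let ?N = "\<lambda>p f. (LINT x|torus L. cmod (f x) powr p) powr (2 / p)"
  obtain M where M: "M \<ge> 0" and trig: "\<forall>F G \<alpha> \<gamma>. finite F \<and> finite G \<longrightarrow>
    (\<exists>H. continuous_on UNIV H \<and> (\<forall>x. 0 \<le> H x) \<and>
    (\<forall>t\<in>E. \<forall>x. (cmod (bilinear_average \<mu> (trig_sum L F \<alpha>) (trig_sum L G \<gamma>) t x))\<^sup>2 \<le> H x) \<and>
    (LINT x|torus L. H x) \<le> M * (?N p (trig_sum L F \<alpha>) * ?N q (trig_sum L G \<gamma>)))"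
    using trig_maximal[OF L E(1) dim p q gap] by auto
  interpret T: finite_measure "torus L :: (real ^ 'n) measure" by (rule finite_measure_torus)
  define V where "V = measure (torus L :: (real ^ 'n) measure) (space (torus L))"
  have L0: "L > 0" using L by simp
  have "(\<integral>\<^sup>+x. ennreal ((bilinear_maximal \<mu> E f g x)\<^sup>2) * indicator Q x \<partial>lborel) \<le> ennreal (2 * M * (?N p f * ?N q g))"
    if f: "continuous_on UNIV f" and g: "continuous_on UNIV g"
      and bdry: "\<And>x i. \<bar>x $ i\<bar> \<ge> L / 2 \<Longrightarrow> f x = 0 \<and> g x = 0" for f g
  proof -
    have bounded: "\<exists>B\<ge>0. \<forall>x. cmod (h x) \<le> B"
      if h: "continuous_on UNIV h" "\<And>x i. \<bar>x $ i\<bar> \<ge> L / 2 \<Longrightarrow> h x = 0" for h :: "real ^ 'n \<Rightarrow> complex"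
    proof -
      let ?T = "cbox (\<chi> i. - L / 2) (\<chi> i. L / 2) :: (real ^ 'n) set"
      have "compact (h ` ?T)"
        by (intro compact_continuous_image continuous_on_subset[OF h(1)]) auto
      then obtain B where B: "\<forall>y\<in>h ` ?T. norm y \<le> B" using compact_imp_bounded bounded_iff by metis
      have "cmod (h x) \<le> max 0 B" for x
      proof (cases "x \<in> ?T")
        case True
        then show ?thesis using B by (simp add: le_max_iff_disj)
      next
        case False
        then obtain i where "\<not> (- L / 2 \<le> x $ i \<and> x $ i \<le> L / 2)" by (auto simp: mem_box_cart)
        then have "\<bar>x $ i\<bar> \<ge> L / 2" by linarith
        then show ?thesis using h(2) by simp
      qed
      then show ?thesis by (intro exI[of _ "max 0 B"]) auto
    qed
    obtain Bf where Bf: "Bf \<ge> 0" "\<And>x. cmod (f x) \<le> Bf" using bounded[OF f] bdry by blast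
    obtain Bg where Bg: "Bg \<ge> 0" "\<And>x. cmod (g x) \<le> Bg" using bounded[OF g] bdry by blast
    define e where "e = (\<lambda>n. inverse (real (Suc n)))"
    have e0: "e n > 0" and e1: "e n \<le> 1" for n by (auto simp: e_def inverse_le_1_iff)
    have elim: "e \<longlonglongrightarrow> 0" unfolding e_def by (rule LIMSEQ_inverse_real_of_nat)
    have "\<forall>n. \<exists>P. trig_poly L P \<and> (\<forall>x\<in>space (torus L). cmod (f x - P x) < e n)"
      using trig_poly_dense[OF L0 f e0] bdry by blast
    then obtain P where P: "\<And>n. trig_poly L (P n)" "\<And>n x. x \<in> space (torus L) \<Longrightarrow> cmod (f x - P n x) < e n"
      by metis
    have "\<forall>n. \<exists>P. trig_poly L P \<and> (\<forall>x\<in>space (torus L). cmod (g x - P x) < e n)"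
      using trig_poly_dense[OF L0 g e0] bdry by blast
    then obtain S where S: "\<And>n. trig_poly L (S n)" "\<And>n x. x \<in> space (torus L) \<Longrightarrow> cmod (g x - S n x) < e n"
      by metis
    \<comment> \<open>\<open>\<kappa> * e n\<close> bounds the difference of the two averages:
      \<open>f\<close> is at most \<open>Bf\<close>, the approximant of \<open>g\<close> is at most
      \<open>Bg + 1\<close>, and \<mu> has finite mass.\<close>
    define \<kappa> where "\<kappa> = (Bf + Bg + 1) * measure \<mu> UNIV"
    define z where "z = (\<lambda>n. 2 * (M * (?N p (P n) * ?N q (S n))) + 2 * (\<kappa> * e n)\<^sup>2 * V)"
    have bound: "(\<integral>\<^sup>+x. ennreal ((bilinear_maximal \<mu> E f g x)\<^sup>2) * indicator Q x \<partial>lborel) \<le> ennreal (z n)" for n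
    proof -
      obtain BP where BP: "\<And>x. cmod (P n x) \<le> BP" using trig_poly_bounded[OF P(1)] by blast
      obtain BS where BS: "\<And>x. cmod (S n x) \<le> BS" using trig_poly_bounded[OF S(1)] by blast
      obtain H where H: "continuous_on UNIV H" "\<And>x. 0 \<le> H x"
        "\<And>t x. t \<in> E \<Longrightarrow> (cmod (bilinear_average \<mu> (P n) (S n) t x))\<^sup>2 \<le> H x"
        "(LINT x|torus L. H x) \<le> M * (?N p (P n) * ?N q (S n))"
        using P(1)[of n] S(1)[of n] trig unfolding trig_poly_def by metis
      define H' where "H' = (\<lambda>x. 2 * H x + 2 * (\<kappa> * e n)\<^sup>2)"
      have H'0: "H' x \<ge> 0" for x using H(2)[of x] by (simp add: H'_def)
      have H'c: "continuous_on UNIV H'" unfolding H'_def by (intro continuous_intros H)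
      have avg: "(cmod (bilinear_average \<mu> f g t x))\<^sup>2 \<le> H' x" if t: "t \<in> E" and x: "x \<in> Q" for t x
      proof -
        let ?u = "\<lambda>w. f (x - t *\<^sub>R fst w) * g (x - t *\<^sub>R snd w)"
        let ?v = "\<lambda>w. P n (x - t *\<^sub>R fst w) * S n (x - t *\<^sub>R snd w)"
        have iu: "integrable \<mu> ?u" by (rule integrable_bilinear[OF f Bf(2) g Bg(2)])
        have iv: "integrable \<mu> ?v"
          by (rule integrable_bilinear[OF trig_poly_continuous[OF P(1)] BP trig_poly_continuous[OF S(1)] BS])
        have "cmod (bilinear_average \<mu> f g t x - bilinear_average \<mu> (P n) (S n) t x) = cmod (LINT w|\<mu>. ?u w - ?v w)"
          unfolding bilinear_average_eq using iu iv by simp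
        also have "\<dots> \<le> (LINT w|\<mu>. cmod (?u w - ?v w))" by (rule integral_norm_bound)
        also have "\<dots> \<le> (LINT w|\<mu>. (Bf + Bg + 1) * e n)"
        proof (rule integral_mono_AE)
          show "integrable \<mu> (\<lambda>w. cmod (?u w - ?v w))" using iu iv by (intro integrable_norm Bochner_Integration.integrable_diff)
          show "AE w in \<mu>. cmod (?u w - ?v w) \<le> (Bf + Bg + 1) * e n"
            using R(2)
          proof eventually_elim
            case (elim w)
            define y1 where "y1 = x - t *\<^sub>R fst w"
            define y2 where "y2 = x - t *\<^sub>R snd w"
            have y: "y1 \<in> space (torus L)" "y2 \<in> space (torus L)" using Q(2)[OF x t] elim by (auto simp: y1_def y2_def)
            have Pf: "cmod (f y1 - P n y1) \<le> e n" and Sg: "cmod (g y2 - S n y2) \<le> e n"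
              using P(2)[OF y(1), of n] S(2)[OF y(2), of n] by linarith+
            have "cmod (S n y2) \<le> cmod (g y2) + cmod (g y2 - S n y2)"
              using norm_triangle_ineq4[of "g y2" "g y2 - S n y2"] by simp
            then have Sb: "cmod (S n y2) \<le> Bg + 1" using Sg e1[of n] Bg(2)[of y2] by linarith
            have "f y1 * g y2 - P n y1 * S n y2 = f y1 * (g y2 - S n y2) + (f y1 - P n y1) * S n y2"
              by (simp add: algebra_simps)
            then have "cmod (f y1 * g y2 - P n y1 * S n y2) \<le> cmod (f y1 * (g y2 - S n y2)) + cmod ((f y1 - P n y1) * S n y2)"
              by (metis norm_triangle_ineq)
            also have "\<dots> \<le> Bf * e n + e n * (Bg + 1)"
              unfolding norm_mult using Bf Pf Sg Sb e0[of n] by (intro add_mono mult_mono) auto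
            finally show ?case unfolding y1_def y2_def by (simp add: algebra_simps)
          qed
        qed simp
        also have "\<dots> = \<kappa> * e n" by (simp add: space_eq \<kappa>_def)
        finally have "cmod (bilinear_average \<mu> f g t x) \<le> cmod (bilinear_average \<mu> (P n) (S n) t x) + \<kappa> * e n"
          using norm_triangle_sub[of "bilinear_average \<mu> f g t x" "bilinear_average \<mu> (P n) (S n) t x"] by linarith
        then have "(cmod (bilinear_average \<mu> f g t x))\<^sup>2 \<le> (cmod (bilinear_average \<mu> (P n) (S n) t x) + \<kappa> * e n)\<^sup>2"
          by (intro power_mono) auto
        also have "\<dots> \<le> 2 * (cmod (bilinear_average \<mu> (P n) (S n) t x))\<^sup>2 + 2 * (\<kappa> * e n)\<^sup>2"
          using sum_squares_bound[of "cmod (bilinear_average \<mu> (P n) (S n) t x)" "\<kappa> * e n"] by (simp add: power2_sum)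
        also have "\<dots> \<le> H' x" unfolding H'_def using H(3)[OF t, of x] by simp
        finally show ?thesis .
      qed
      have maxi: "(bilinear_maximal \<mu> E f g x)\<^sup>2 \<le> H' x" if x: "x \<in> Q" for x
      proof -
        have "bilinear_maximal \<mu> E f g x \<le> sqrt (H' x)"
          unfolding bilinear_maximal_eq using E(2) avg[OF _ x] by (intro cSUP_least real_le_rsqrt)
        moreover have "0 \<le> bilinear_maximal \<mu> E f g x"
          by (rule bilinear_maximal_nonneg[OF E(2) f Bf(2) g Bg(2)])
        ultimately have "(bilinear_maximal \<mu> E f g x)\<^sup>2 \<le> (sqrt (H' x))\<^sup>2" by (rule power_mono)
        then show ?thesis using H'0 by simp
      qed
      have "(\<integral>\<^sup>+x. ennreal ((bilinear_maximal \<mu> E f g x)\<^sup>2) * indicator Q x \<partial>lborel)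
          \<le> (\<integral>\<^sup>+x. ennreal (H' x) * indicator (space (torus L)) x \<partial>lborel)"
        using maxi Q(1) by (intro nn_integral_mono) (auto simp: indicator_def intro: ennreal_leI)
      also have "\<dots> = (\<integral>\<^sup>+x. ennreal (H' x) \<partial>torus L)"
        unfolding space_torus unfolding torus_def by (subst nn_integral_restrict_space) auto
      also have "\<dots> = ennreal (LINT x|torus L. H' x)"
        using H'0 by (intro nn_integral_eq_integral integrable_torus_continuous[OF H'c]) auto
      also have "(LINT x|torus L. H' x) = 2 * (LINT x|torus L. H x) + 2 * (\<kappa> * e n)\<^sup>2 * V"
        unfolding H'_def V_def using integrable_torus_continuous[OF H(1)] by simp
      also have "ennreal \<dots> \<le> ennreal (z n)"
        unfolding z_def using H(4) by (intro ennreal_leI) simp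
      finally show ?thesis .
    qed
    \<comment> \<open>The norms of the approximants converge too: the convergence is uniform on a
      set of finite measure, with the constant majorant \<open>(B + 1) powr s\<close>.\<close>
    have conv: "(\<lambda>n. ?N s (U n)) \<longlonglongrightarrow> ?N s h"
      if s: "1 \<le> s" and h: "continuous_on UNIV h" "\<And>x. cmod (h x) \<le> B"
        and U: "\<And>n. trig_poly L (U n)" "\<And>n x. x \<in> space (torus L) \<Longrightarrow> cmod (h x - U n x) < e n"
      for s B and h :: "real ^ 'n \<Rightarrow> complex" and U :: "nat \<Rightarrow> real ^ 'n \<Rightarrow> complex"
    proof (rule tendsto_powr')
      show "(\<lambda>n. LINT x|torus L. cmod (U n x) powr s) \<longlonglongrightarrow> (LINT x|torus L. cmod (h x) powr s)"
      proof (rule integral_dominated_convergence[where w = "\<lambda>_. (B + 1) powr s"])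
        have cp: "(\<lambda>x. cmod (k x) powr s) \<in> borel_measurable (torus L)" if "continuous_on UNIV k" for k :: "real ^ 'n \<Rightarrow> complex"
          using s that by (intro borel_measurable_integrable integrable_torus_continuous continuous_on_powr' continuous_intros) auto
        show "(\<lambda>x. cmod (h x) powr s) \<in> borel_measurable (torus L)" by (rule cp[OF h(1)])
        show "(\<lambda>x. cmod (U n x) powr s) \<in> borel_measurable (torus L)" for n
          by (rule cp[OF trig_poly_continuous[OF U(1)]])
        show "AE x in torus L. (\<lambda>n. cmod (U n x) powr s) \<longlonglongrightarrow> cmod (h x) powr s"
        proof (rule AE_I2)
          fix x assume x: "x \<in> space (torus L :: (real ^ 'n) measure)"
          have "(\<lambda>n. U n x - h x) \<longlonglongrightarrow> 0"
            by (rule Lim_null_comparison[OF _ elim])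
               (use U(2)[OF x] in \<open>auto simp: norm_minus_commute intro!: eventuallyI less_imp_le\<close>)
          then have "(\<lambda>n. U n x) \<longlonglongrightarrow> h x" by (simp add: LIM_zero_iff)
          then show "(\<lambda>n. cmod (U n x) powr s) \<longlonglongrightarrow> cmod (h x) powr s"
            using s by (intro tendsto_powr' tendsto_intros) auto
        qed
        show "AE x in torus L. norm (cmod (U n x) powr s) \<le> (B + 1) powr s" for n
        proof (rule AE_I2)
          fix x assume x: "x \<in> space (torus L :: (real ^ 'n) measure)"
          have "cmod (U n x) \<le> cmod (h x) + cmod (h x - U n x)"
            using norm_triangle_ineq4[of "h x" "h x - U n x"] by simp
          then have "cmod (U n x) \<le> B + 1" using U(2)[OF x, of n] e1[of n] h(2)[of x] by linarith
          then show "norm (cmod (U n x) powr s) \<le> (B + 1) powr s" using s by (simp add: powr_mono2)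
        qed
      qed simp
    qed (use s in \<open>auto intro!: eventuallyI Bochner_Integration.integral_nonneg\<close>)
    have "z \<longlonglongrightarrow> 2 * (M * (?N p f * ?N q g)) + 2 * (\<kappa> * 0)\<^sup>2 * V"
      unfolding z_def
      by (intro tendsto_intros conv[OF p(1) f Bf(2) P] conv[OF q(1) g Bg(2) S] elim)
    then have "(\<lambda>n. ennreal (z n)) \<longlonglongrightarrow> ennreal (2 * (M * (?N p f * ?N q g)) + 2 * (\<kappa> * 0)\<^sup>2 * V)"
      by (rule tendsto_ennrealI)
    then have "(\<integral>\<^sup>+x. ennreal ((bilinear_maximal \<mu> E f g x)\<^sup>2) * indicator Q x \<partial>lborel)
      \<le> ennreal (2 * (M * (?N p f * ?N q g)) + 2 * (\<kappa> * 0)\<^sup>2 * V)"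
      by (rule LIMSEQ_le_const) (use bound in blast)
    then show ?thesis by (simp add: mult.assoc)
  qed
  then show ?thesis using M by (intro exI[of _ "2 * M"]) auto
qed

end

section \<open>From local to global\<close>

lemma nn_integral_translation:
  fixes u :: "'a::euclidean_space \<Rightarrow> ennreal"
  assumes [measurable]: "u \<in> borel_measurable borel"
  shows "(\<integral>\<^sup>+x. u (c + x) \<partial>lborel) = (\<integral>\<^sup>+x. u x \<partial>lborel)"
proof -
  have "(\<integral>\<^sup>+x. u x \<partial>lborel) = (\<integral>\<^sup>+x. u x \<partial>distr lborel borel ((+) c))"
    by (simp only: lborel_distr_plus)
  also have "\<dots> = (\<integral>\<^sup>+x. u (c + x) \<partial>lborel)"
    by (rule nn_integral_distr) auto
  finally show ?thesis ..
qed

lemma measurable_window: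
  fixes u :: "'a::euclidean_space \<Rightarrow> ennreal"
  assumes [measurable]: "u \<in> borel_measurable borel" "S \<in> sets borel"
  shows "(\<lambda>v. \<integral>\<^sup>+x. u (x + v) * indicator S x \<partial>lborel) \<in> borel_measurable lborel"
  by measurable

text \<open>Tonelli and translation invariance. With the unit cube it recovers a global integral
  from local ones without loss; with the larger cube the overlap costs only its volume.\<close>

lemma nn_integral_window:
  fixes u :: "'a::euclidean_space \<Rightarrow> ennreal"
  assumes [measurable]: "u \<in> borel_measurable borel" "S \<in> sets borel"
  shows "(\<integral>\<^sup>+v. \<integral>\<^sup>+x. u (x + v) * indicator S x \<partial>lborel \<partial>lborel) = (\<integral>\<^sup>+x. u x \<partial>lborel) * emeasure lborel S"
proof -
  have "(\<integral>\<^sup>+v. \<integral>\<^sup>+x. u (x + v) * indicator S x \<partial>lborel \<partial>lborel)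
      = (\<integral>\<^sup>+x. \<integral>\<^sup>+v. u (x + v) * indicator S x \<partial>lborel \<partial>lborel)"
    by (rule lborel_pair.Fubini') measurable
  also have "\<dots> = (\<integral>\<^sup>+x. (\<integral>\<^sup>+x. u x \<partial>lborel) * indicator S x \<partial>lborel)"
  proof (rule nn_integral_cong)
    fix x :: 'a
    have "(\<integral>\<^sup>+v. u (x + v) * indicator S x \<partial>lborel) = (\<integral>\<^sup>+v. u (x + v) \<partial>lborel) * indicator S x"
      by (rule nn_integral_multc) measurable
    then show "(\<integral>\<^sup>+v. u (x + v) * indicator S x \<partial>lborel) = (\<integral>\<^sup>+x. u x \<partial>lborel) * indicator S x"
      by (simp only: nn_integral_translation[OF assms(1)])
  qed
  also have "\<dots> = (\<integral>\<^sup>+x. u x \<partial>lborel) * emeasure lborel S"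
    by (rule nn_integral_cmult_indicator) simp
  finally show ?thesis .
qed

text \<open>A concave function lies below its tangents: this is the tangent at l of s to the power
  r/2, evaluated at s = u^2.\<close>

lemma powr_le_tangent:
  fixes u l r :: real
  assumes "0 \<le> u" "0 < l" "0 < r" "r \<le> 2"
  shows "u powr r \<le> r / 2 * l powr (r / 2 - 1) * u\<^sup>2 + (1 - r / 2) * l powr (r / 2)"
proof (cases "u = 0")
  case True
  then show ?thesis using assms by simp
next
  case False
  then have u: "u > 0" using assms by simp
  have "(u\<^sup>2) powr (r / 2) * l powr (1 - r / 2) \<le> r / 2 * u\<^sup>2 + (1 - r / 2) * l"
    using assms u by (intro Youngs_inequality_0) auto
  then have "((u\<^sup>2) powr (r / 2) * l powr (1 - r / 2)) * l powr (r / 2 - 1) \<le> (r / 2 * u\<^sup>2 + (1 - r / 2) * l) * l powr (r / 2 - 1)"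
    by (rule mult_right_mono) simp
  moreover have "(u\<^sup>2) powr (r / 2) = u powr r"
    using u by (simp add: powr_powr flip: powr_numeral)
  moreover have "l powr (1 - r / 2) * l powr (r / 2 - 1) = 1"
    using assms by (simp add: powr_add[symmetric])
  moreover have "l * l powr (r / 2 - 1) = l powr (r / 2)"
    using assms by (simp add: powr_mult_base)
  moreover have "(r / 2 * u\<^sup>2 + (1 - r / 2) * l) * l powr (r / 2 - 1) =
      r / 2 * l powr (r / 2 - 1) * u\<^sup>2 + (1 - r / 2) * (l * l powr (r / 2 - 1))"
    by (simp add: algebra_simps)
  ultimately show ?thesis by (simp add: mult.assoc)
qed

text \<open>Jensen's inequality for a concave power on a set of measure at most one, by integrating
  a tangent line.\<close>

lemma nn_integral_powr_le:
  fixes u :: "'a::euclidean_space \<Rightarrow> real"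
  assumes u[measurable]: "u \<in> borel_measurable borel" and u0: "\<And>x. 0 \<le> u x"
    and Q[measurable]: "Q \<in> sets borel" and Q1: "emeasure lborel Q \<le> 1"
    and r: "0 < r" "r \<le> 2" and l: "0 \<le> l"
    and le: "(\<integral>\<^sup>+x. ennreal ((u x)\<^sup>2) * indicator Q x \<partial>lborel) \<le> ennreal l"
  shows "(\<integral>\<^sup>+x. ennreal (u x powr r) * indicator Q x \<partial>lborel) \<le> ennreal (l powr (r / 2))"
proof -
  have bound: "(\<integral>\<^sup>+x. ennreal (u x powr r) * indicator Q x \<partial>lborel) \<le> ennreal (k powr (r / 2))"
    if k: "k > 0" "l \<le> k" for k
  proof -
    define c1 where "c1 = r / 2 * k powr (r / 2 - 1)"
    define c2 where "c2 = (1 - r / 2) * k powr (r / 2)"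
    have c: "c1 \<ge> 0" "c2 \<ge> 0" using r by (auto simp: c1_def c2_def)
    have "(\<integral>\<^sup>+x. ennreal (u x powr r) * indicator Q x \<partial>lborel)
      \<le> (\<integral>\<^sup>+x. ennreal c1 * (ennreal ((u x)\<^sup>2) * indicator Q x) + ennreal c2 * indicator Q x \<partial>lborel)"
    proof (rule nn_integral_mono)
      fix x
      have "u x powr r \<le> c1 * (u x)\<^sup>2 + c2"
        unfolding c1_def c2_def by (rule powr_le_tangent[OF u0 k(1) r])
      then have "ennreal (u x powr r) \<le> ennreal c1 * ennreal ((u x)\<^sup>2) + ennreal c2"
        using c by (simp flip: ennreal_mult ennreal_plus add: ennreal_leI)
      then show "ennreal (u x powr r) * indicator Q x \<le> ennreal c1 * (ennreal ((u x)\<^sup>2) * indicator Q x) + ennreal c2 * indicator Q x"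
        by (simp add: indicator_def)
    qed
    also have "\<dots> = ennreal c1 * (\<integral>\<^sup>+x. ennreal ((u x)\<^sup>2) * indicator Q x \<partial>lborel) + ennreal c2 * emeasure lborel Q"
      by (simp add: nn_integral_add nn_integral_cmult)
    also have "\<dots> \<le> ennreal c1 * ennreal k + ennreal c2 * 1"
      using k by (intro add_mono mult_left_mono Q1 order_trans[OF le] ennreal_leI) auto
    also have "\<dots> = ennreal (c1 * k + c2)"
      using c k by (simp add: ennreal_mult)
    also have "c1 * k + c2 = k powr (r / 2)"
    proof -
      have "k powr (r / 2 - 1) * k = k powr (r / 2)" using k by (simp add: powr_mult_base mult.commute)
      then show ?thesis by (simp add: c1_def c2_def algebra_simps)
    qed
    finally show ?thesis .
  qed
  \<comment> \<open>At l = 0 the tangent may be vertical, so the point of tangency is taken above l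
    and moved down to it.\<close>
  have "(\<lambda>n. (l + inverse (real (Suc n))) powr (r / 2)) \<longlonglongrightarrow> (l + 0) powr (r / 2)"
    using r l by (intro tendsto_powr' tendsto_intros LIMSEQ_inverse_real_of_nat) auto
  then have "(\<lambda>n. ennreal ((l + inverse (real (Suc n))) powr (r / 2))) \<longlonglongrightarrow> ennreal ((l + 0) powr (r / 2))"
    by (rule tendsto_ennrealI)
  then have "(\<integral>\<^sup>+x. ennreal (u x powr r) * indicator Q x \<partial>lborel) \<le> ennreal ((l + 0) powr (r / 2))"
  proof (rule LIMSEQ_le_const, intro exI allI impI)
    fix n :: nat
    show "(\<integral>\<^sup>+x. ennreal (u x powr r) * indicator Q x \<partial>lborel) \<le> ennreal ((l + inverse (real (Suc n))) powr (r / 2))"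
    proof (rule bound)
      have "inverse (real (Suc n)) > 0" by simp
      then show "0 < l + inverse (real (Suc n))" "l \<le> l + inverse (real (Suc n))" using l by linarith+
    qed
  qed
  then show ?thesis by simp
qed

text \<open>After division by N and N' both factors are at most one, so their exponents may be
  lowered until they add up to one, and Young's inequality applies. The outcome is linear in F and G
  and can be integrated over translates. It is used with s = r/p and t = r/q, where s + t \<ge> 1
  expresses r \<ge> r_H.\<close>

lemma powr_mult_powr_le:
  fixes F G N N' s t :: real
  assumes F: "0 \<le> F" "F \<le> N" and G: "0 \<le> G" "G \<le> N'" and N: "0 < N" "0 < N'"
    and st: "0 < s" "0 < t" "1 \<le> s + t"
  shows "F powr s * G powr t \<le> N powr s * N' powr t * (s / (s + t) * (F / N) + t / (s + t) * (G / N'))"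
proof (cases "F = 0 \<or> G = 0")
  case True
  then show ?thesis using assms by auto
next
  case False
  define x where "x = F / N"
  define y where "y = G / N'"
  have x: "0 < x" "x \<le> 1" and y: "0 < y" "y \<le> 1"
    using assms False by (auto simp: x_def y_def)
  have FG: "F = N * x" "G = N' * y" using N by (auto simp: x_def y_def)
  have ls: "s / (s + t) \<le> s" "t / (s + t) \<le> t"
    using st by (simp_all add: pos_divide_le_eq mult_le_cancel_left1)
  have "x powr s * y powr t \<le> x powr (s / (s + t)) * y powr (t / (s + t))"
    using x y ls by (intro mult_mono powr_mono') auto
  also have "\<dots> \<le> s / (s + t) * x + t / (s + t) * y"
    using x y st by (intro Youngs_inequality_0) (auto simp: add_divide_distrib[symmetric])
  finally have "N powr s * N' powr t * (x powr s * y powr t) \<le> N powr s * N' powr t * (s / (s + t) * x + t / (s + t) * y)"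
    by (intro mult_left_mono) auto
  moreover have "F powr s * G powr t = N powr s * N' powr t * (x powr s * y powr t)"
    unfolding FG using N x y by (simp add: powr_mult)
  ultimately show ?thesis by (simp add: x_def y_def)
qed

section \<open>Test functions and cut-offs\<close>

lemma test_function_continuous:
  assumes "f \<in> test_functions"
  shows "continuous_on UNIV f"
proof -
  have "k_times_cont_diff 0 f" using assms unfolding test_functions_def by blast
  then show ?thesis by simp
qed

lemma test_function_bounded:
  assumes "f \<in> test_functions"
  shows "\<exists>B. \<forall>x. cmod (f x) \<le> B"
proof -
  let ?K = "closure {x. f x \<noteq> 0}"
  have "compact (f ` ?K)"
    using assms by (intro compact_continuous_image continuous_on_subset[OF test_function_continuous[OF assms]])
      (auto simp: test_functions_def)
  then have "bounded (f ` ?K)" by (rule compact_imp_bounded)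
  then obtain B where B: "\<forall>y\<in>f ` ?K. cmod y \<le> B" unfolding bounded_iff ..
  have "cmod (f x) \<le> max 0 B" for x
  proof (cases "f x = 0")
    case False
    then have "x \<in> ?K" by (intro subsetD[OF closure_subset]) simp
    then show ?thesis using B by (simp add: le_max_iff_disj)
  qed simp
  then show ?thesis by blast
qed

lemma test_function_integral_finite:
  fixes f :: "'a::euclidean_space \<Rightarrow> complex"
  assumes f: "f \<in> test_functions" and p: "p > 0"
  shows "(\<integral>\<^sup>+x. ennreal (cmod (f x) powr p) \<partial>lborel) < \<infinity>"
proof -
  let ?K = "closure {x. f x \<noteq> 0}"
  obtain B where B: "\<And>x. cmod (f x) \<le> B" using test_function_bounded[OF f] by blast
  have K: "emeasure lborel ?K < \<infinity>" "?K \<in> sets borel"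
    using f by (auto simp: test_functions_def intro!: emeasure_bounded_finite[simplified] compact_imp_bounded)
  have "(\<integral>\<^sup>+x. ennreal (cmod (f x) powr p) \<partial>lborel) \<le> (\<integral>\<^sup>+x. ennreal (B powr p) * indicator ?K x \<partial>lborel)"
  proof (rule nn_integral_mono)
    fix x
    show "ennreal (cmod (f x) powr p) \<le> ennreal (B powr p) * indicator ?K x"
    proof (cases "f x = 0")
      case False
      then have "x \<in> ?K" by (intro subsetD[OF closure_subset]) simp
      then show ?thesis using B[of x] p by (simp add: ennreal_leI powr_mono2)
    qed simp
  qed
  also have "\<dots> = ennreal (B powr p) * emeasure lborel ?K"
    using K by (intro nn_integral_cmult_indicator) simp
  also have "\<dots> < \<infinity>" using K by (simp add: ennreal_mult_less_top)
  finally show ?thesis .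
qed

text \<open>Piecewise linear in the norm: the local estimate asks for continuity only, so no smooth
  cut-off has to be built.\<close>

definition cutoff :: "real \<Rightarrow> 'a::real_normed_vector \<Rightarrow> real" where
  "cutoff \<rho> x = max 0 (min 1 (2 - norm x / \<rho>))"

lemma cutoff_range: "0 \<le> cutoff \<rho> x" "cutoff \<rho> x \<le> 1"
  by (auto simp: cutoff_def)

lemma continuous_on_cutoff: "\<rho> > 0 \<Longrightarrow> continuous_on S (cutoff \<rho>)"
  unfolding cutoff_def by (intro continuous_intros) auto

lemma cutoff_eq_1: "\<rho> > 0 \<Longrightarrow> norm x \<le> \<rho> \<Longrightarrow> cutoff \<rho> x = 1"
  by (auto simp: cutoff_def min_def max_def field_simps)

lemma cutoff_eq_0: "\<rho> > 0 \<Longrightarrow> norm x \<ge> 2 * \<rho> \<Longrightarrow> cutoff \<rho> x = 0"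
  by (auto simp: cutoff_def min_def max_def field_simps)

context decaying_measure
begin

text \<open>Almost every point of \<mu> has both components in the ball of radius \<open>R\<close>,
  so agreement at the resulting arguments is all that an average can see.\<close>

lemma bilinear_maximal_localize:
  fixes x :: "real ^ 'n"
  assumes f: "continuous_on UNIV f" and g: "continuous_on UNIV g"
    and f': "continuous_on UNIV f'" and g': "continuous_on UNIV g'"
    and eq: "\<And>t y. t \<in> E \<Longrightarrow> norm y \<le> R \<Longrightarrow>
      f' (x - t *\<^sub>R y) = f (x + v - t *\<^sub>R y) \<and> g' (x - t *\<^sub>R y) = g (x + v - t *\<^sub>R y)"
  shows "bilinear_maximal \<mu> E f g (x + v) = bilinear_maximal \<mu> E f' g' x"
  unfolding bilinear_maximal_eq
proof (rule SUP_cong[OF refl])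
  fix t assume t: "t \<in> E"
  have meas: "(\<lambda>w. h (z - t *\<^sub>R fst w) * k (z - t *\<^sub>R snd w)) \<in> borel_measurable \<mu>"
    if "continuous_on UNIV h" "continuous_on UNIV k" for h k :: "real ^ 'n \<Rightarrow> complex" and z
    by (intro measurable_eq borel_measurable_continuous_onI continuous_intros
        continuous_on_compose2[OF that(1)] continuous_on_compose2[OF that(2)]) auto
  have "bilinear_average \<mu> f g t (x + v) = bilinear_average \<mu> f' g' t x"
    unfolding bilinear_average_eq
  proof (rule integral_cong_AE)
    show "AE w in \<mu>. f (x + v - t *\<^sub>R fst w) * g (x + v - t *\<^sub>R snd w) = f' (x - t *\<^sub>R fst w) * g' (x - t *\<^sub>R snd w)"
      using R(2) by eventually_elim (use eq[OF t] in simp)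
  qed (intro meas f g f' g')+
  then show "cmod (bilinear_average \<mu> f g t (x + v)) = cmod (bilinear_average \<mu> f' g' t x)" by simp
qed

text \<open>Two bounds with different uses: the window integral can be averaged over v, while the
  bound by the full integral is uniform in v and supplies the normalisation in
  \<open>powr_mult_powr_le\<close>.\<close>

lemma windowed_norm:
  fixes f :: "real ^ 'n \<Rightarrow> complex"
  assumes f: "f \<in> test_functions" and p: "p \<ge> 1" and \<rho>: "\<rho> > 0"
    and N: "(\<integral>\<^sup>+x. ennreal (cmod (f x) powr p) \<partial>lborel) = ennreal N" "N \<ge> 0"
  shows "ennreal (LINT x|torus L. cmod (f (x + v) * cutoff \<rho> x) powr p)
      \<le> (\<integral>\<^sup>+x. ennreal (cmod (f (x + v)) powr p) * indicator (space (torus L)) x \<partial>lborel)" (is "ennreal ?F \<le> ?\<Phi>")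
    and "(LINT x|torus L. cmod (f (x + v) * cutoff \<rho> x) powr p) \<le> N"
proof -
  have c: "continuous_on UNIV (\<lambda>x. cmod (f (x + v) * cutoff \<rho> x) powr p)"
    using p \<rho> by (intro continuous_on_powr' continuous_intros continuous_on_cutoff
        continuous_on_compose2[OF test_function_continuous[OF f]]) auto
  have m: "(\<lambda>x. ennreal (cmod (f x) powr p)) \<in> borel_measurable borel"
    using p by (intro borel_measurable_continuous_onI continuous_on_ennreal continuous_on_powr' continuous_intros
        test_function_continuous[OF f]) auto
  have "ennreal ?F = (\<integral>\<^sup>+x. ennreal (cmod (f (x + v) * cutoff \<rho> x) powr p) \<partial>torus L)"
    by (rule nn_integral_eq_integral[symmetric]) (auto intro: integrable_torus_continuous[OF c])
  also have "\<dots> = (\<integral>\<^sup>+x. ennreal (cmod (f (x + v) * cutoff \<rho> x) powr p) * indicator (space (torus L)) x \<partial>lborel)"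
    unfolding space_torus unfolding torus_def by (subst nn_integral_restrict_space) auto
  also have "\<dots> \<le> ?\<Phi>"
  proof (intro nn_integral_mono mult_right_mono ennreal_leI powr_mono2)
    fix x
    show "cmod (f (x + v) * cutoff \<rho> x) \<le> cmod (f (x + v))"
      using cutoff_range[of \<rho> x] by (simp add: norm_mult mult_left_le)
  qed (use p in auto)
  finally show 1: "ennreal ?F \<le> ?\<Phi>" .
  also have "?\<Phi> \<le> (\<integral>\<^sup>+x. ennreal (cmod (f (x + v)) powr p) \<partial>lborel)"
    by (intro nn_integral_mono) (auto simp: indicator_def)
  also have "\<dots> = ennreal N"
    using nn_integral_translation[OF m, of v] N by (simp add: add.commute)
  finally show "?F \<le> N" using N(2) by (simp add: ennreal_le_iff)
qed

text \<open>An integral over the translation parameter v replaces a tiling by cubes: the integral of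
  the r-th power becomes an integral over v of local quantities, each controlled by functions cut
  off near the unit cube.\<close>

lemma bilinear_maximal_boundedI:
  assumes E: "E \<subseteq> {1..2}" "E \<noteq> {}" and dim: "upper_minkowski_dim E = ereal \<beta>"
    and p: "1 \<le> p" "p \<le> 2" and q: "1 \<le> q" "q \<le> 2"
    and gap: "1 / p + 1 / q < 1 / 2 + (2 * a - \<beta>) / (2 * real CARD('n))"
    and r: "0 < r" "r \<le> 2" "1 \<le> r / p + r / q"
  shows "bilinear_maximal_bounded \<mu> E p q r"
proof -
  define Q where "Q = (cbox 0 One :: (real ^ 'n) set)"
  have Qs: "Q \<in> sets borel" by (simp add: Q_def)
  have Q1: "emeasure lborel Q = 1"
    unfolding Q_def by (subst emeasure_lborel_cbox) auto
  have "bounded Q" by (simp add: Q_def)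
  then obtain D where D: "D > 0" "\<And>x. x \<in> Q \<Longrightarrow> norm x \<le> D" using bounded_pos by metis
  \<comment> \<open>\<open>D\<close> accounts for the unit cube, 2R for dilations up to 2, and 1
    ensures \<rho> \<ge> 1.\<close>
  define \<rho> where "\<rho> = D + 2 * R + 1"
  \<comment> \<open>Then L/2 = 2\<rho> is the radius from which on the cut-off vanishes, so
    functions that are cut off are 0 on the faces of the cube.\<close>
  define L where "L = 4 * \<rho>"
  have \<rho>: "\<rho> > 0" "\<rho> \<ge> 1" and L: "L \<ge> 1" using D R by (auto simp: \<rho>_def L_def)
  define T where "T = space (torus L :: (real ^ 'n) measure)"
  have Ts: "T \<in> sets borel" by (simp add: T_def space_torus)
  have inT: "x \<in> T" if "norm x \<le> \<rho>" for x
  proof -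
    have "\<bar>x $ i\<bar> \<le> L / 2" for i
      using component_le_norm_cart[of x i] that \<rho> by (simp add: L_def)
    then have "- L / 2 \<le> x $ i \<and> x $ i \<le> L / 2" for i
      using abs_le_D1[of "x $ i" "L / 2"] abs_le_D2[of "x $ i" "L / 2"] by (metis minus_divide_left minus_le_iff)
    then show ?thesis by (simp add: T_def space_torus mem_box_cart)
  qed
  have near: "norm (x - t *\<^sub>R y) \<le> \<rho>" if "x \<in> Q" "t \<in> E" "norm y \<le> R" for x t y
  proof -
    have t: "0 \<le> t" "t \<le> 2" using E(1) that(2) by auto
    have "norm (x - t *\<^sub>R y) \<le> norm x + t * norm y"
      using norm_triangle_ineq4[of x "t *\<^sub>R y"] t by simp
    also have "t * norm y \<le> 2 * R" using t that(3) by (intro mult_mono) auto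
    finally show ?thesis using D(2)[OF that(1)] by (simp add: \<rho>_def)
  qed
  have QT: "Q \<subseteq> space (torus L)"
  proof
    fix x assume "x \<in> Q"
    then have "norm x \<le> \<rho>" using D(2)[of x] R by (simp add: \<rho>_def)
    then show "x \<in> space (torus L)" using inT by (simp add: T_def)
  qed
  have nearT: "x - t *\<^sub>R y \<in> space (torus L)" if "x \<in> Q" "t \<in> E" "norm y \<le> R" for x t y
    using inT[OF near[OF that]] by (simp add: T_def)
  obtain M where M: "M \<ge> 0" and loc: "\<forall>f g. continuous_on UNIV f \<and> continuous_on UNIV g \<and>
    (\<forall>x i. \<bar>x $ i\<bar> \<ge> L / 2 \<longrightarrow> f x = 0 \<and> g x = 0) \<longrightarrow>
    (\<integral>\<^sup>+x. ennreal ((bilinear_maximal \<mu> E f g x)\<^sup>2) * indicator Q x \<partial>lborel) \<le>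
    ennreal (M * ((LINT x|torus L. cmod (f x) powr p) powr (2 / p) * (LINT x|torus L. cmod (g x) powr q) powr (2 / q)))"
    using local_maximal[OF L E dim p q gap QT nearT] by auto
  have "emeasure lborel T < \<infinity>"
    unfolding T_def space_torus by (rule emeasure_lborel_cbox_finite)
  then obtain V where V: "V \<ge> 0" "emeasure lborel T = ennreal V"
    by (cases "emeasure lborel T") auto
  define W where "W = V * M powr (r / 2)"
  have W: "W \<ge> 0" using V M by (simp add: W_def)
  have "Lp_norm r (bilinear_maximal \<mu> E f g) \<le> ennreal (W powr (1 / r)) * Lp_norm p f * Lp_norm q g"
    if f: "f \<in> test_functions" and g: "g \<in> test_functions" for f g
  proof -
    let ?A = "bilinear_maximal \<mu> E f g"
    let ?nf = "\<lambda>x. ennreal (cmod (f x) powr p)" and ?ng = "\<lambda>x. ennreal (cmod (g x) powr q)"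
    have fc: "continuous_on UNIV f" and gc: "continuous_on UNIV g"
      using f g test_function_continuous by auto
    obtain Bf where Bf: "\<And>x. cmod (f x) \<le> Bf" using test_function_bounded[OF f] by blast
    obtain Bg where Bg: "\<And>x. cmod (g x) \<le> Bg" using test_function_bounded[OF g] by blast
    have p0: "p > 0" and q0: "q > 0" using p q by auto
    obtain Nf where Nf: "(\<integral>\<^sup>+x. ?nf x \<partial>lborel) = ennreal Nf" "Nf \<ge> 0"
      using test_function_integral_finite[OF f p0] by (cases "\<integral>\<^sup>+x. ?nf x \<partial>lborel") auto
    obtain Ng where Ng: "(\<integral>\<^sup>+x. ?ng x \<partial>lborel) = ennreal Ng" "Ng \<ge> 0"
      using test_function_integral_finite[OF g q0] by (cases "\<integral>\<^sup>+x. ?ng x \<partial>lborel") auto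
    have mf: "?nf \<in> borel_measurable borel"
      using p by (intro borel_measurable_continuous_onI continuous_on_ennreal continuous_on_powr' continuous_intros fc) auto
    have mg: "?ng \<in> borel_measurable borel"
      using q by (intro borel_measurable_continuous_onI continuous_on_ennreal continuous_on_powr' continuous_intros gc) auto
    have mA: "?A \<in> borel_measurable borel"
      by (rule borel_measurable_bilinear_maximal[OF E(2) fc Bf gc Bg])
    have A0: "0 \<le> ?A x" for x by (rule bilinear_maximal_nonneg[OF E(2) fc Bf gc Bg])
    define F where "F = (\<lambda>v. LINT x|torus L. cmod (f (x + v) * cutoff \<rho> x) powr p)"
    define G where "G = (\<lambda>v. LINT x|torus L. cmod (g (x + v) * cutoff \<rho> x) powr q)"
    define \<Phi> where "\<Phi> = (\<lambda>v. \<integral>\<^sup>+x. ?nf (x + v) * indicator T x \<partial>lborel)"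
    define \<Psi> where "\<Psi> = (\<lambda>v. \<integral>\<^sup>+x. ?ng (x + v) * indicator T x \<partial>lborel)"
    define h where "h = (\<lambda>v. \<integral>\<^sup>+x. ennreal (?A (x + v) powr r) * indicator Q x \<partial>lborel)"
    have F: "ennreal (F v) \<le> \<Phi> v" "F v \<le> Nf" "0 \<le> F v" for v
      using windowed_norm[OF f p(1) \<rho>(1) Nf] unfolding F_def \<Phi>_def T_def by auto
    have G: "ennreal (G v) \<le> \<Psi> v" "G v \<le> Ng" "0 \<le> G v" for v
      using windowed_norm[OF g q(1) \<rho>(1) Ng] unfolding G_def \<Psi>_def T_def by auto
    have hle: "h v \<le> ennreal (M powr (r / 2) * (F v powr (r / p) * G v powr (r / q)))" for v
    proof -
      define f' where "f' = (\<lambda>x. f (x + v) * cutoff \<rho> x)"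
      define g' where "g' = (\<lambda>x. g (x + v) * cutoff \<rho> x)"
      have c: "continuous_on UNIV f'" "continuous_on UNIV g'"
        unfolding f'_def g'_def using \<rho>
        by (intro continuous_intros continuous_on_cutoff continuous_on_compose2[OF fc] continuous_on_compose2[OF gc]; auto)+
      have b: "cmod (f' x) \<le> Bf" "cmod (g' x) \<le> Bg" for x
        using cutoff_range[of \<rho> x] mult_left_le[of "cutoff \<rho> x" "cmod (f (x + v))"] mult_left_le[of "cutoff \<rho> x" "cmod (g (x + v))"]
          Bf[of "x + v"] Bg[of "x + v"] unfolding f'_def g'_def norm_mult by auto
      have z: "f' x = 0 \<and> g' x = 0" if "\<bar>x $ i\<bar> \<ge> L / 2" for x i
        using that component_le_norm_cart[of x i] cutoff_eq_0[OF \<rho>(1), of x] by (simp add: f'_def g'_def L_def)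
      have shift: "?A (x + v) = bilinear_maximal \<mu> E f' g' x" if "x \<in> Q" for x
      proof (rule bilinear_maximal_localize[OF fc gc c])
        fix t and y :: "real ^ 'n" assume "t \<in> E" "norm y \<le> R"
        then have "cutoff \<rho> (x - t *\<^sub>R y) = 1" using cutoff_eq_1[OF \<rho>(1)] near[OF that] by blast
        then show "f' (x - t *\<^sub>R y) = f (x + v - t *\<^sub>R y) \<and> g' (x - t *\<^sub>R y) = g (x + v - t *\<^sub>R y)"
          by (simp add: f'_def g'_def algebra_simps)
      qed
      have FG: "F v = (LINT x|torus L. cmod (f' x) powr p)" "G v = (LINT x|torus L. cmod (g' x) powr q)"
        by (simp_all add: F_def G_def f'_def g'_def)
      let ?l = "M * (F v powr (2 / p) * G v powr (2 / q))"
      have "h v = (\<integral>\<^sup>+x. ennreal (bilinear_maximal \<mu> E f' g' x powr r) * indicator Q x \<partial>lborel)"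
        unfolding h_def using shift by (intro nn_integral_cong) (auto simp: indicator_def)
      also have "\<dots> \<le> ennreal (?l powr (r / 2))"
      proof (rule nn_integral_powr_le[OF _ _ Qs _ r(1,2)])
        show "bilinear_maximal \<mu> E f' g' \<in> borel_measurable borel"
          by (rule borel_measurable_bilinear_maximal[OF E(2) c(1) b(1) c(2) b(2)])
        show "0 \<le> bilinear_maximal \<mu> E f' g' x" for x
          by (rule bilinear_maximal_nonneg[OF E(2) c(1) b(1) c(2) b(2)])
        show "emeasure lborel Q \<le> 1" using Q1 by simp
        show "0 \<le> ?l" using M by simp
        show "(\<integral>\<^sup>+x. ennreal ((bilinear_maximal \<mu> E f' g' x)\<^sup>2) * indicator Q x \<partial>lborel) \<le> ennreal ?l"
          unfolding FG by (rule loc[rule_format]) (use c z in blast)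
      qed
      also have "?l powr (r / 2) = M powr (r / 2) * (F v powr (r / p) * G v powr (r / q))"
        using M F(3)[of v] G(3)[of v] by (simp add: powr_mult powr_powr)
      finally show ?thesis .
    qed
    have total: "(\<integral>\<^sup>+x. ennreal (?A x powr r) \<partial>lborel) = (\<integral>\<^sup>+v. h v \<partial>lborel)"
    proof -
      have "(\<lambda>x. ennreal (?A x powr r)) \<in> borel_measurable borel" using mA by measurable
      from nn_integral_window[OF this Qs] show ?thesis by (simp add: h_def Q1)
    qed
    have main: "(\<integral>\<^sup>+x. ennreal (?A x powr r) \<partial>lborel) \<le> ennreal (W * (Nf powr (r / p) * Ng powr (r / q)))"
    proof (cases "Nf = 0 \<or> Ng = 0")
      case True
      \<comment> \<open>With a zero norm the local bound already vanishes; the other case divides by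
        \<open>Nf\<close> and \<open>Ng\<close>.\<close>
      then have "h v \<le> 0" for v
        using hle[of v] F(2,3)[of v] G(2,3)[of v] by auto
      then have "h = (\<lambda>_. 0)" by (simp add: fun_eq_iff)
      then show ?thesis unfolding total by simp
    next
      case False
      then have N: "Nf > 0" "Ng > 0" using Nf Ng by auto
      define c where "c = M powr (r / 2) * (Nf powr (r / p) * Ng powr (r / q))"
      define \<theta> where "\<theta> = r / p / (r / p + r / q)"
      define \<theta>' where "\<theta>' = r / q / (r / p + r / q)"
      have st: "0 < r / p" "0 < r / q" using r p0 q0 by auto
      have \<theta>: "0 \<le> \<theta>" "0 \<le> \<theta>'" "\<theta> + \<theta>' = 1"
      proof -
        have "0 \<le> s / (s + t) \<and> 0 \<le> t / (s + t) \<and> s / (s + t) + t / (s + t) = 1"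
          if "0 < s" "0 < t" for s t :: real
          using that by (simp add: add_divide_distrib[symmetric])
        from this[OF st] show "0 \<le> \<theta>" "0 \<le> \<theta>'" "\<theta> + \<theta>' = 1"
          unfolding \<theta>_def \<theta>'_def by blast+
      qed
      have c0: "c \<ge> 0" by (simp add: c_def)
      \<comment> \<open>Linear in the two window integrals, the powers of the global norms being
        collected in \<open>c\<close>.\<close>
      have hv: "h v \<le> ennreal (c * \<theta> / Nf) * \<Phi> v + ennreal (c * \<theta>' / Ng) * \<Psi> v" for v
      proof -
        have "M powr (r / 2) * (F v powr (r / p) * G v powr (r / q)) \<le>
            M powr (r / 2) * (Nf powr (r / p) * Ng powr (r / q) * (\<theta> * (F v / Nf) + \<theta>' * (G v / Ng)))"
          unfolding \<theta>_def \<theta>'_def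
          by (intro mult_left_mono powr_mult_powr_le F G N st r(3)) simp
        also have "\<dots> = c * \<theta> / Nf * F v + c * \<theta>' / Ng * G v"
          by (simp add: c_def algebra_simps)
        finally have "h v \<le> ennreal (c * \<theta> / Nf * F v + c * \<theta>' / Ng * G v)"
          using hle[of v] by (meson ennreal_leI order_trans)
        also have "\<dots> = ennreal (c * \<theta> / Nf) * ennreal (F v) + ennreal (c * \<theta>' / Ng) * ennreal (G v)"
          using c0 \<theta> N F(3)[of v] G(3)[of v] by (simp add: ennreal_mult[symmetric] flip: ennreal_plus)
        also have "\<dots> \<le> ennreal (c * \<theta> / Nf) * \<Phi> v + ennreal (c * \<theta>' / Ng) * \<Psi> v"
          by (intro add_mono mult_left_mono F G) auto
        finally show ?thesis .
      qed
      have m: "\<Phi> \<in> borel_measurable lborel" "\<Psi> \<in> borel_measurable lborel"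
        unfolding \<Phi>_def \<Psi>_def by (rule measurable_window[OF mf Ts], rule measurable_window[OF mg Ts])
      have "(\<integral>\<^sup>+v. h v \<partial>lborel) \<le> (\<integral>\<^sup>+v. ennreal (c * \<theta> / Nf) * \<Phi> v + ennreal (c * \<theta>' / Ng) * \<Psi> v \<partial>lborel)"
        by (rule nn_integral_mono) (rule hv)
      also have "\<dots> = (\<integral>\<^sup>+v. ennreal (c * \<theta> / Nf) * \<Phi> v \<partial>lborel) + (\<integral>\<^sup>+v. ennreal (c * \<theta>' / Ng) * \<Psi> v \<partial>lborel)"
        by (rule nn_integral_add) (rule borel_measurable_times_ennreal[OF borel_measurable_const m(1)]
            borel_measurable_times_ennreal[OF borel_measurable_const m(2)])+
      also have "\<dots> = ennreal (c * \<theta> / Nf) * (\<integral>\<^sup>+v. \<Phi> v \<partial>lborel) + ennreal (c * \<theta>' / Ng) * (\<integral>\<^sup>+v. \<Psi> v \<partial>lborel)"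
        by (simp only: nn_integral_cmult[OF m(1)] nn_integral_cmult[OF m(2)])
      \<comment> \<open>Each averaged window gives back the global integral times the volume
        \<open>V\<close>; so the divisions by \<open>Nf\<close> and \<open>Ng\<close> cancel and the
        weights \<theta>, \<theta>' add up to one.\<close>
      also have "\<dots> = ennreal (c * \<theta> / Nf) * (ennreal Nf * ennreal V) + ennreal (c * \<theta>' / Ng) * (ennreal Ng * ennreal V)"
        unfolding \<Phi>_def \<Psi>_def nn_integral_window[OF mf Ts] nn_integral_window[OF mg Ts] Nf(1) Ng(1) V(2) ..
      also have "\<dots> = ennreal (c * \<theta> / Nf * (Nf * V) + c * \<theta>' / Ng * (Ng * V))"
        using c0 \<theta> N V by (simp add: ennreal_mult[symmetric] flip: ennreal_plus)
      also have "c * \<theta> / Nf * (Nf * V) + c * \<theta>' / Ng * (Ng * V) = c * V * (\<theta> + \<theta>')"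
        using N by (simp add: field_simps)
      also have "\<dots> = W * (Nf powr (r / p) * Ng powr (r / q))"
        unfolding \<theta>(3) by (simp add: W_def c_def)
      finally show ?thesis unfolding total .
    qed
    define I where "I = (\<integral>\<^sup>+x. ennreal (?A x powr r) \<partial>lborel)"
    have I: "I = ennreal (enn2real I)" "enn2real I \<le> W * (Nf powr (r / p) * Ng powr (r / q))"
    proof -
      have "I < \<infinity>" using main unfolding I_def by (rule order_le_less_trans) simp
      then show "I = ennreal (enn2real I)" by simp
      show "enn2real I \<le> W * (Nf powr (r / p) * Ng powr (r / q))"
        using main W unfolding I_def[symmetric] by (intro enn2real_leI) auto
    qed
    have "Lp_norm r ?A = ennreal (enn2real I powr (1 / r))"
    proof -
      have "(\<integral>\<^sup>+x. ennreal (norm (?A x) powr r) \<partial>lborel) = I" using A0 by (simp add: I_def)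
      \<comment> \<open>Finiteness selects the second branch in the definition of
        \<open>Lp_norm\<close>.\<close>
      moreover have "I \<noteq> \<infinity>" using I(1) by (metis ennreal_neq_top infinity_ennreal_def)
      ultimately show ?thesis by (simp add: Lp_norm_def)
    qed
    also have "\<dots> \<le> ennreal ((W * (Nf powr (r / p) * Ng powr (r / q))) powr (1 / r))"
      using I(2) r by (intro ennreal_leI powr_mono2) auto
    also have "(W * (Nf powr (r / p) * Ng powr (r / q))) powr (1 / r) = W powr (1 / r) * (Nf powr (1 / p) * Ng powr (1 / q))"
      using W r by (simp add: powr_mult powr_powr)
    also have "ennreal \<dots> = ennreal (W powr (1 / r)) * Lp_norm p f * Lp_norm q g"
    proof -
      have "Lp_norm p f = ennreal (Nf powr (1 / p))" "Lp_norm q g = ennreal (Ng powr (1 / q))"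
        using Nf Ng by (simp_all add: Lp_norm_def)
      then show ?thesis by (simp add: ennreal_mult mult.assoc)
    qed
    finally show ?thesis .
  qed
  then show ?thesis unfolding bilinear_maximal_bounded_def by (intro exI[of _ "W powr (1 / r)"]) auto
qed

end

section \<open>Both ranges of exponents reduced to one condition\<close>

theorem proposition6p6:
  fixes \<mu> :: "((real ^ 'n) \<times> (real ^ 'n)) measure"
    and E :: "real set" and a \<beta> :: real
  assumes "E \<subseteq> {1..2}" and "E \<noteq> {}"
    and "upper_minkowski_dim E = ereal \<beta>"
    and "sets \<mu> = sets borel" and "finite_measure \<mu>" and "compactly_supported_measure \<mu>"
    and "admissible a (fourier_measure \<mu>)"
    and "2 * a > real CARD('n) + \<beta>"
  shows "(a \<le> real CARD('n) + \<beta> / 2 \<longrightarrow>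
           (\<forall>p q r :: real.
              2 * real CARD('n) / (2 * a - \<beta>) < p \<and> p \<le> 2 \<and>
              2 * real CARD('n) / (2 * a - \<beta>) < q \<and> q \<le> 2 \<and>
              1 / p + 1 / q < 1 / 2 + (2 * a - \<beta>) / (2 * real CARD('n)) \<and>
              hoelder_exponent p q \<le> r \<and> r \<le> 2 \<longrightarrow>
              bilinear_maximal_bounded \<mu> E p q r)) \<and>
         (a > real CARD('n) + \<beta> / 2 \<longrightarrow>
           (\<forall>p q r :: real.
              1 < p \<and> p \<le> 2 \<and> 1 < q \<and> q \<le> 2 \<and>
              1 / p + 1 / q < 3 / 2 \<and>
              hoelder_exponent p q \<le> r \<and> r \<le> 2 \<longrightarrow>
              bilinear_maximal_bounded \<mu> E p q r))"
proof -
  let ?d = "real CARD('n)"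
  obtain K where K: "compact K" "emeasure \<mu> (- K) = 0"
    using assms(6) by (auto simp: compactly_supported_measure_def)
  obtain R where R: "R > 0" "\<And>w. w \<in> K \<Longrightarrow> norm w \<le> R"
    using compact_imp_bounded[OF K(1)] unfolding bounded_pos by blast
  obtain C where C: "\<And>\<xi> \<eta>. cmod (fourier_measure \<mu> \<xi> \<eta>) \<le> C * (1 + norm \<xi> + norm \<eta>) powr (- a)"
    and a: "a > ?d / 2"
    using assms(7) by (auto simp: admissible_def)
  have d: "?d > 0" by simp
  interpret decaying_measure \<mu> a C R
  proof (intro decaying_measure.intro decaying_measure_axioms.intro)
    show "finite_measure \<mu>" "sets \<mu> = sets borel" "R > 0" by fact+
    have "open (- K)" by (rule open_Compl[OF compact_imp_closed[OF K(1)]])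
    then have "- K \<in> sets \<mu>" unfolding assms(4) by (rule borel_open)
    with K(2) have "- K \<in> null_sets \<mu>" by (rule null_setsI)
    \<comment> \<open>The norm of a pair dominates the norms of its components, so the condition can
      fail only off the compact set.\<close>
    then show "AE w in \<mu>. norm (fst w) \<le> R \<and> norm (snd w) \<le> R"
    proof (rule AE_I', intro subsetI)
      fix w assume "w \<in> {w \<in> space \<mu>. \<not> (norm (fst w) \<le> R \<and> norm (snd w) \<le> R)}"
      then have "norm w > R"
        using norm_fst_le[of "fst w" "snd w"] norm_snd_le[of "snd w" "fst w"] by auto
      then show "w \<in> - K" using R(2)[of w] by auto
    qed
    \<comment> \<open>At the origin the weight is 1, so the decay bound compares \<open>C\<close>
      itself with a norm.\<close>
    show "0 \<le> C" using order_trans[OF norm_ge_zero C[of 0 0]] by simp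
    show "cmod (fourier_measure \<mu> \<xi> \<eta>) \<le> C * (1 + norm \<xi> + norm \<eta>) powr - a" for \<xi> \<eta> by (rule C)
    show "a > 0" using a d by linarith
  qed
  have main: "bilinear_maximal_bounded \<mu> E p q r"
    if p: "1 \<le> p" "p \<le> 2" and q: "1 \<le> q" "q \<le> 2"
      and gap: "1 / p + 1 / q < 1 / 2 + (2 * a - \<beta>) / (2 * ?d)"
      and r: "hoelder_exponent p q \<le> r" "r \<le> 2" for p q r
  proof (rule bilinear_maximal_boundedI[OF assms(1-3) p q gap _ r(2)])
    have s: "1 / p + 1 / q > 0" using p q by (simp add: add_pos_pos)
    then have "hoelder_exponent p q > 0" by (simp add: hoelder_exponent_def)
    then show r0: "0 < r" using r(1) by linarith
    \<comment> \<open>The Hoelder exponent is the value of r at which r/p + r/q equals 1.\<close>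
    have "1 \<le> r * (1 / p + 1 / q)"
      using r(1) s by (simp only: hoelder_exponent_def pos_divide_le_eq)
    then show "1 \<le> r / p + r / q" by (simp add: distrib_left)
  qed
  show ?thesis
  proof (intro conjI impI allI; elim conjE)
    fix p q r :: real
    assume a': "a \<le> ?d + \<beta> / 2" and p: "2 * ?d / (2 * a - \<beta>) < p" "p \<le> 2"
      and q: "2 * ?d / (2 * a - \<beta>) < q" "q \<le> 2"
      and gap: "1 / p + 1 / q < 1 / 2 + (2 * a - \<beta>) / (2 * ?d)"
      and r: "hoelder_exponent p q \<le> r" "r \<le> 2"
    \<comment> \<open>Here 2a - \<beta> lies between 0 and 2d, so the threshold for p and q keeps
      both above 1, within the range of Bernstein's inequality.\<close>
    have "1 \<le> 2 * ?d / (2 * a - \<beta>)"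
    proof -
      have "0 < 2 * a - \<beta>" using assms(8) d by linarith
      moreover have "2 * a - \<beta> \<le> 2 * ?d" using a' by simp
      ultimately show ?thesis by (simp only: pos_le_divide_eq mult_1)
    qed
    then show "bilinear_maximal_bounded \<mu> E p q r"
      using p q by (intro main gap r) linarith+
  next
    fix p q r :: real
    assume a': "?d + \<beta> / 2 < a" and p: "1 < p" "p \<le> 2" and q: "1 < q" "q \<le> 2"
      and gap: "1 / p + 1 / q < 3 / 2" and r: "hoelder_exponent p q \<le> r" "r \<le> 2"
    \<comment> \<open>Here the right-hand side of the general condition is at least 3/2, so the
      hypothesis of this range implies it.\<close>
    have "1 \<le> (2 * a - \<beta>) / (2 * ?d)"
    proof -
      have "2 * ?d \<le> 2 * a - \<beta>" using a' by simp
      then show ?thesis using d by (simp add: pos_le_divide_eq)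
    qed
    then have "1 / p + 1 / q < 1 / 2 + (2 * a - \<beta>) / (2 * ?d)" using gap by linarith
    then show "bilinear_maximal_bounded \<mu> E p q r"
      using p q by (intro main r) linarith+
  qed
qed

end
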